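(* Let $p>1$ and $r_1>0$ satisfy $\frac{n}{n+p}<r_1<1\le r_1p<n$, let $r\ge 0$ and $s\in\mathbb R$, and set $r_*=1+\frac pn-\frac1{r_1}\in(0,1)$. Let $\beta>0$. There are positive constants $c_3,c_4$ depending only on $U,n,r_1,p$ such that the following holds. Assume $\alpha\in\mathbb R$ satisfies $$\alpha\ge s,\quad \alpha>\frac{p-s}{p-1},\quad \alpha>\frac{2(r+s-p)}{r_*},\quad \alpha>\frac{r_1\beta}{1-r_1}.$$ Let $\varphi>0$, $W_*>0$ and $\omega\ge 0$ be functions on $U$. With the quantities $m,\theta,\mu_1,\widehat\mu_1,\widehat\mu_2,\widehat\mu_3,\Phi_1,\widetilde\Phi_2$ defined in the context, define, for $\varepsilon>0$, $$\widehat\Phi_1=D_{1,m,\theta}\Phi_1+2^{1+\widehat\beta_1}\varepsilon^{-\frac\theta{1-\theta}}D_{2,m,\theta}\widetilde\Phi_2,\qquad \widehat\beta_1=\frac{\beta\theta}{1-\theta}\Big(1+\frac1\alpha\Big),$$ where $D_{1,m,\theta}=(c_42^m)^{\theta p}$ and $D_{2,m,\theta}=(c_3m2^m)^{\frac{\theta p}{1-\theta}}$. Then for any function $u\in W^{1,r_1pm}(U)$ and any $\varepsilon>0$, $$\int_U|u(x)|^{\alpha+r}\omega(x)\,dx\le \varepsilon\int_U\frac{|u(x)|^{\alpha-s}}{(1+|u(x)|)^\beta}|\nabla u(x)|^pW_*(x)\,dx+\widehat\Phi_1\min\Big\{J_*^{1+\widehat\mu_2/\alpha}+J_*^{1+\widehat\mu_3/\alpha},\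 (1+J_* )^{1+\widehat\mu_3/\alpha}\Big\},$$ where $J_*=\int_U|u(x)|^\alpha\varphi(x)\,dx$.
   Context: $n\ge2$ is an integer and $U$ is a non-empty, open, bounded subset of $\mathbb R^n$ with boundary of class $C^1$. All functions are Lebesgue measurable. Definitions of the numbers: $$m=\frac{\alpha-s+p}{p}\in[1,\alpha),\quad \theta=\frac{\alpha+2r}{\alpha(1+r_* )+2(p-s)}\in(0,1),\quad \mu_1=\frac{r+\theta(s-p)}{1-\theta}\in(-\alpha,\infty),$$ $$\widehat\mu_1=\mu_1+\frac{\beta\theta}{1-\theta},\quad \widehat\mu_2=\min\{r,\mu_1\},\quad \widehat\mu_3=\max\{r,\widehat\mu_1\}.$$ Definitions of the weight quantities: $$G_1=\Big(\int_U\varphi^{-\frac{\alpha-s+p}{\alpha(p-1)+s-p}}dx\Big)^{\frac{\alpha(p-1)+s-p}{\alpha}},\quad G_3=\Big(\int_U\varphi^{-1}\omega^{\frac{1}{(1-\theta)(1+\mu_1/\alpha)}}dx\Big)^{1+\mu_1/\alpha},\quad \Phi_1=G_1^\theta G_3^{1-\theta},$$ $$\widetilde G_2=\Big(\int_U\varphi^{-\frac{r_1\beta}{\alpha(1-r_1)-r_1\beta}}W_*^{-\frac{r_1\alpha}{\alpha(1-r_1)-r_1\beta}}dx\Big)^{\frac{\alpha(1-r_1)-r_1\beta}{\alpha r_1}},\quad \mathcal E_1=1+\int_U\varphi\,dx,\quad \widetilde\Phi_2=\widetilde G_2^{\frac{\theta}{1-\theta}}\,G_3\,\mathcal E_1^{\frac{\beta\theta}{\alpha(1-\theta)}}.$$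 *)

theory Defs
  imports "HOL-Analysis.Analysis"
begin

primrec C_k :: "nat \<Rightarrow> ('a::euclidean_space \<Rightarrow> real) \<Rightarrow> bool" where
  "C_k 0 f \<longleftrightarrow> continuous_on UNIV f"
| "C_k (Suc k) f \<longleftrightarrow>
     (\<forall>x. f differentiable (at x)) \<and> (\<forall>b\<in>Basis. C_k k (\<lambda>x. frechet_derivative f (at x) b))"

definition C_infinity :: "('a::euclidean_space \<Rightarrow> real) \<Rightarrow> bool" where
  "C_infinity f \<longleftrightarrow> (\<forall>k. C_k k f)"

text \<open>Near each boundary point, in coordinates whose last axis points along the unit vector
  \<open>e\<close>, the set \<open>U\<close> is the strict epigraph of a \<open>C\<^sup>1\<close> function of the remaining coordinates.
  The hyperplane orthogonal to \<open>e\<close> is not a type of its own, so the graph function is defined on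
  the whole space and is evaluated only at projections onto that hyperplane.\<close>

definition C1_boundary :: "'a::euclidean_space set \<Rightarrow> bool" where
  "C1_boundary U \<longleftrightarrow>
     (\<forall>x0\<in>frontier U. \<exists>\<rho>>0. \<exists>e \<gamma>. norm e = 1 \<and> C_k 1 \<gamma> \<and>
        U \<inter> ball x0 \<rho> = {x \<in> ball x0 \<rho>. x \<bullet> e > \<gamma> (x - (x \<bullet> e) *\<^sub>R e)})"

definition test_function :: "'a::euclidean_space set \<Rightarrow> ('a \<Rightarrow> real) \<Rightarrow> bool" where
  "test_function U \<psi> \<longleftrightarrow>
     C_infinity \<psi> \<and> compact (closure {x. \<psi> x \<noteq> 0}) \<and> closure {x. \<psi> x \<noteq> 0} \<subseteq> U"

definition locally_integrable ::
    "'a::euclidean_space set \<Rightarrow> ('a \<Rightarrow> 'b::euclidean_space) \<Rightarrow> bool" where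
  "locally_integrable U f \<longleftrightarrow> (\<forall>K. compact K \<and> K \<subseteq> U \<longrightarrow> set_integrable lebesgue K f)"

definition has_weak_gradient ::
    "'a::euclidean_space set \<Rightarrow> ('a \<Rightarrow> real) \<Rightarrow> ('a \<Rightarrow> 'a) \<Rightarrow> bool" where
  "has_weak_gradient U u g \<longleftrightarrow>
     locally_integrable U u \<and> locally_integrable U g \<and>
     (\<forall>\<psi>. test_function U \<psi> \<longrightarrow> (\<forall>b\<in>Basis.
        (LINT x|lebesgue_on U. u x * frechet_derivative \<psi> (at x) b)
          = - (LINT x|lebesgue_on U. (g x \<bullet> b) * \<psi> x)))"

definition in_Lq ::
    "'a::euclidean_space set \<Rightarrow> real \<Rightarrow> ('a \<Rightarrow> 'b::euclidean_space) \<Rightarrow> bool" where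
  "in_Lq U q f \<longleftrightarrow>
     f \<in> borel_measurable (lebesgue_on U) \<and>
     integrable (lebesgue_on U) (\<lambda>x. norm (f x) powr q)"

text \<open>\<open>u \<in> W\<^sup>1\<^sup>,\<^sup>q(U)\<close> and \<open>g\<close> represents its weak gradient. The gradient is determined only
  almost everywhere, so it is carried along as an argument instead of being a function of \<open>u\<close>.\<close>

definition in_W1_with_gradient ::
    "'a::euclidean_space set \<Rightarrow> real \<Rightarrow> ('a \<Rightarrow> real) \<Rightarrow> ('a \<Rightarrow> 'a) \<Rightarrow> bool" where
  "in_W1_with_gradient U q u g \<longleftrightarrow> in_Lq U q u \<and> in_Lq U q g \<and> has_weak_gradient U u g"

definition integral_on :: "'a::euclidean_space set \<Rightarrow> ('a \<Rightarrow> real) \<Rightarrow> ennreal" where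
  "integral_on U f = (\<integral>\<^sup>+x. ennreal (f x) \<partial>lebesgue_on U)"

text \<open>The power \<open>x\<^sup>a\<close> with \<open>\<infinity>\<^sup>a = \<infinity>\<close>, the usual meaning for \<open>a > 0\<close>. It is only used for exponents
  that the standing assumptions make positive, see \<open>exponent_ranges\<close> below.\<close>

definition enn_powr :: "ennreal \<Rightarrow> real \<Rightarrow> ennreal" (infixr "epowr" 80) where
  "x epowr a = (if x = top then top else ennreal (enn2real x powr a))"

text \<open>In HOL, \<open>0 powr 0 = 0\<close>. For \<open>\<bar>u\<bar>\<^sup>\<alpha>\<^sup>-\<^sup>s\<close> with \<open>\<alpha> = s\<close> the convention \<open>0\<^sup>0 = 1\<close> is needed.\<close>

definition powr_one :: "real \<Rightarrow> real \<Rightarrow> real" where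
  "powr_one x a = (if a = 0 then 1 else x powr a)"

definition r_star :: "real \<Rightarrow> real \<Rightarrow> real \<Rightarrow> real" where
  "r_star n p r1 = 1 + p / n - 1 / r1"

definition m_exp :: "real \<Rightarrow> real \<Rightarrow> real \<Rightarrow> real" where
  "m_exp p s \<alpha> = (\<alpha> - s + p) / p"

definition theta :: "real \<Rightarrow> real \<Rightarrow> real \<Rightarrow> real \<Rightarrow> real \<Rightarrow> real \<Rightarrow> real" where
  "theta n p r1 r s \<alpha> = (\<alpha> + 2 * r) / (\<alpha> * (1 + r_star n p r1) + 2 * (p - s))"

definition mu1 :: "real \<Rightarrow> real \<Rightarrow> real \<Rightarrow> real \<Rightarrow> real" where
  "mu1 p r s \<theta> = (r + \<theta> * (s - p)) / (1 - \<theta>)"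

definition mu1_hat :: "real \<Rightarrow> real \<Rightarrow> real \<Rightarrow> real" where
  "mu1_hat \<beta> \<theta> \<mu> = \<mu> + \<beta> * \<theta> / (1 - \<theta>)"

definition mu2_hat :: "real \<Rightarrow> real \<Rightarrow> real" where
  "mu2_hat r \<mu> = min r \<mu>"

definition mu3_hat :: "real \<Rightarrow> real \<Rightarrow> real \<Rightarrow> real \<Rightarrow> real" where
  "mu3_hat r \<beta> \<theta> \<mu> = max r (mu1_hat \<beta> \<theta> \<mu>)"

definition beta1_hat :: "real \<Rightarrow> real \<Rightarrow> real \<Rightarrow> real" where
  "beta1_hat \<alpha> \<beta> \<theta> = \<beta> * \<theta> / (1 - \<theta>) * (1 + 1 / \<alpha>)"

lemma exponent_ranges:
  fixes n p r1 r s \<alpha> \<beta> :: real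
  assumes "n > 0" "p > 1" "n / (n + p) < r1" "r1 < 1" "r1 * p < n" "r \<ge> 0" "\<beta> > 0"
    and "\<alpha> \<ge> s" "\<alpha> > (p - s) / (p - 1)" "\<alpha> > 2 * (r + s - p) / r_star n p r1"
    and "\<alpha> > r1 * \<beta> / (1 - r1)"
  defines "\<theta> \<equiv> theta n p r1 r s \<alpha>"
  shows "0 < r_star n p r1" "r_star n p r1 < 1"
    and "1 \<le> m_exp p s \<alpha>" "m_exp p s \<alpha> < \<alpha>"
    and "0 < \<theta>" "\<theta> < 1"
    and "mu1 p r s \<theta> > - \<alpha>"
    and "\<alpha> > 0" "\<alpha> * (p - 1) + s - p > 0" "\<alpha> * (1 - r1) - r1 * \<beta> > 0"
proof -
  have r1: "r1 > 0"
    using assms(1-3) by (smt (verit) divide_pos_pos)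
  have "n < r1 * (n + p)"
    using assms(1-3) by (simp add: divide_less_eq)
  then have "1 / r1 < 1 + p / n"
    using assms(1) r1 by (simp add: field_simps)
  then show rs0: "0 < r_star n p r1"
    by (simp add: r_star_def)
  have "p / n < 1 / r1"
    using assms(1,5) r1 by (simp add: field_simps)
  then show rs1: "r_star n p r1 < 1"
    by (simp add: r_star_def)
  show a0: "\<alpha> > 0"
    using assms(4,7,11) r1 by (smt (verit) divide_pos_pos mult_pos_pos)
  show "1 \<le> m_exp p s \<alpha>"
    using assms(2,8) by (simp add: m_exp_def field_simps)
  have ap: "\<alpha> * (p - 1) > p - s"
    using assms(2,9) by (simp add: divide_less_eq)
  then show "\<alpha> * (p - 1) + s - p > 0"
    by simp
  show "m_exp p s \<alpha> < \<alpha>"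
    using ap assms(2) by (simp add: m_exp_def field_simps)
  show "\<alpha> * (1 - r1) - r1 * \<beta> > 0"
    using assms(4,11) by (simp add: divide_less_eq)
  let ?R = "r_star n p r1"
  let ?d = "\<alpha> * (1 + ?R) + 2 * (p - s)"
  have aR: "\<alpha> * ?R > 2 * (r + s - p)"
    using assms(10) rs0 by (simp add: divide_less_eq)
  have num: "\<alpha> + 2 * r > 0"
    using a0 assms(6) by simp
  have lt: "\<alpha> + 2 * r < ?d"
    using aR by (simp add: algebra_simps)
  show t0: "0 < \<theta>"
    using num lt by (simp add: \<theta>_def theta_def)
  show t1: "\<theta> < 1"
    using num lt by (simp add: \<theta>_def theta_def)
  have dpos: "?d > 0" using num lt by simp
  have "\<alpha> * ?R + (p - s) - r + r * ?R > 0"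
  proof -
    have "\<alpha> * ?R > 0" "r * ?R \<ge> 0"
      using a0 rs0 assms(6) by simp_all
    then show ?thesis using aR by argo
  qed
  then have "\<alpha> * (\<alpha> * ?R + (p - s) - r + r * ?R) > 0"
    using a0 by simp
  then have "(\<alpha> + 2 * r) * (\<alpha> + p - s) < (\<alpha> + r) * ?d"
    by (simp add: algebra_simps)
  then have "\<theta> * (\<alpha> + p - s) < \<alpha> + r"
    using dpos by (simp add: \<theta>_def theta_def divide_less_eq)
  then show "mu1 p r s \<theta> > - \<alpha>"
    using t1 by (simp add: mu1_def less_divide_eq algebra_simps)
qed

definition G1 :: "'a::euclidean_space set \<Rightarrow> real \<Rightarrow> real \<Rightarrow> real \<Rightarrow> ('a \<Rightarrow> real) \<Rightarrow> ennreal" where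
  "G1 U p s \<alpha> \<phi> =
     integral_on U (\<lambda>x. \<phi> x powr (- ((\<alpha> - s + p) / (\<alpha> * (p - 1) + s - p))))
       epowr ((\<alpha> * (p - 1) + s - p) / \<alpha>)"

definition G2_tilde ::
    "'a::euclidean_space set \<Rightarrow> real \<Rightarrow> real \<Rightarrow> real \<Rightarrow> ('a \<Rightarrow> real) \<Rightarrow> ('a \<Rightarrow> real) \<Rightarrow> ennreal" where
  "G2_tilde U r1 \<alpha> \<beta> \<phi> W =
     integral_on U (\<lambda>x. \<phi> x powr (- (r1 * \<beta> / (\<alpha> * (1 - r1) - r1 * \<beta>)))
                      * W x powr (- (r1 * \<alpha> / (\<alpha> * (1 - r1) - r1 * \<beta>))))
       epowr ((\<alpha> * (1 - r1) - r1 * \<beta>) / (\<alpha> * r1))"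

definition G3 ::
    "'a::euclidean_space set \<Rightarrow> real \<Rightarrow> real \<Rightarrow> real \<Rightarrow> ('a \<Rightarrow> real) \<Rightarrow> ('a \<Rightarrow> real) \<Rightarrow> ennreal" where
  "G3 U \<alpha> \<theta> \<mu> \<phi> \<omega> =
     integral_on U (\<lambda>x. inverse (\<phi> x) * \<omega> x powr (1 / ((1 - \<theta>) * (1 + \<mu> / \<alpha>))))
       epowr (1 + \<mu> / \<alpha>)"

definition E1 :: "'a::euclidean_space set \<Rightarrow> ('a \<Rightarrow> real) \<Rightarrow> ennreal" where
  "E1 U \<phi> = 1 + integral_on U \<phi>"

definition Phi1 ::
    "'a::euclidean_space set \<Rightarrow> real \<Rightarrow> real \<Rightarrow> real \<Rightarrow> real \<Rightarrow> real
       \<Rightarrow> ('a \<Rightarrow> real) \<Rightarrow> ('a \<Rightarrow> real) \<Rightarrow> ennreal" where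
  "Phi1 U p s \<alpha> \<theta> \<mu> \<phi> \<omega> = (G1 U p s \<alpha> \<phi> epowr \<theta>) * (G3 U \<alpha> \<theta> \<mu> \<phi> \<omega> epowr (1 - \<theta>))"

definition Phi2_tilde ::
    "'a::euclidean_space set \<Rightarrow> real \<Rightarrow> real \<Rightarrow> real \<Rightarrow> real \<Rightarrow> real
       \<Rightarrow> ('a \<Rightarrow> real) \<Rightarrow> ('a \<Rightarrow> real) \<Rightarrow> ('a \<Rightarrow> real) \<Rightarrow> ennreal" where
  "Phi2_tilde U r1 \<alpha> \<beta> \<theta> \<mu> \<phi> W \<omega> =
     (G2_tilde U r1 \<alpha> \<beta> \<phi> W epowr (\<theta> / (1 - \<theta>))) * G3 U \<alpha> \<theta> \<mu> \<phi> \<omega>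
       * (E1 U \<phi> epowr (\<beta> * \<theta> / (\<alpha> * (1 - \<theta>))))"

definition D1 :: "real \<Rightarrow> real \<Rightarrow> real \<Rightarrow> real \<Rightarrow> real" where
  "D1 c4 p m \<theta> = (c4 * 2 powr m) powr (\<theta> * p)"

definition D2 :: "real \<Rightarrow> real \<Rightarrow> real \<Rightarrow> real \<Rightarrow> real" where
  "D2 c3 p m \<theta> = (c3 * m * 2 powr m) powr (\<theta> * p / (1 - \<theta>))"

end

theory Submission
  imports Defs
begin

text \<open>
  Write \<open>q = r\<^sub>1 p\<close>, \<open>q\<^sup>* = n q / (n - q)\<close> and \<open>\<kappa> = (1 - \<theta>) (1 + \<mu>\<^sub>1 / \<alpha>)\<close>. The number \<open>\<theta>\<close> is chosen so that
  the exponents in the pointwise factorization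
  \<open>|u|\<^sup>\<alpha>\<^sup>+\<^sup>r \<omega> = (|u| powr (m q\<^sup>*)) powr (p \<theta> / q\<^sup>*) \<cdot> (|u| powr \<alpha> \<phi>) powr \<kappa> \<cdot> (\<phi>\<^sup>-\<^sup>1 \<omega> powr (1 / \<kappa>)) powr \<kappa>\<close>
  add up to 1. Hoelder's inequality then bounds the left-hand side by
  \<open>X powr (p \<theta>) \<cdot> J powr \<kappa> \<cdot> G\<^sub>3 powr (1 - \<theta>)\<close>, where \<open>X\<close> is the \<open>q\<^sup>*\<close>-norm of \<open>|u|\<^sup>m\<close>
  (\<open>weighted_interpolation\<close>). The Sobolev inequality for \<open>|u|\<^sup>m\<close> bounds \<open>X\<close> by the integral of \<open>|u|\<^sup>m\<close> plus \<open>m\<close> times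
  the \<open>q\<close>-norm of \<open>|u| powr (m - 1) \<nabla>u\<close>. Two more applications of Hoelder's inequality insert the weights: the
  first term is controlled by \<open>J\<close> and \<open>G\<^sub>1\<close> (\<open>weighted_lower_power\<close>) and produces \<open>\<Phi>\<^sub>1 J powr (1 + r / \<alpha>)\<close>; the second
  is controlled by the weighted gradient integral to the power \<open>\<theta>\<close> times powers of \<open>G\<^sub>2\<close>, \<open>E\<^sub>1\<close> and \<open>1 + J\<close>
  (\<open>weighted_gradient_power\<close>), and Young's inequality with \<open>\<epsilon>\<close> splits off the gradient integral. The exponents of
  \<open>J\<close> that remain lie between those of the two bounds in the minimum. Every exponent is positive, so
  the whole computation is carried out in \<open>[0, \<infinity>]\<close> with \<open>0 \<cdot> \<infinity> = 0\<close>, and infinite weight integrals cause no case distinctions.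

  The Sobolev inequality must hold with constants that do not depend on \<open>m\<close>, for weak gradients and up to the boundary.
  It is proved by Gagliardo's method, which works on the domain itself. Near each point
  of the closure of \<open>U\<close> there are \<open>n\<close> linearly independent vectors along which short segments that start in \<open>U\<close> stay in \<open>U\<close>
  (\<open>segments_inside_cover\<close>). On almost every such segment, \<open>u\<close> is an indefinite integral of its weak directional
  derivative; this follows by duality, testing against translates of a test function
  (\<open>weak_gradient_increment\<close>). Hence a truncated power \<open>F(u)\<close> at a point is at most an integral of
  \<open>F(u)\<close> and \<open>|F'(u) \<nabla>u|\<close> over a segment in each of the \<open>n\<close> directions (\<open>weak_gradient_line_estimate\<close>). Each of these
  \<open>n\<close> bounds is constant along one direction, and the Loomis-Whitney argument in
  \<open>nn_integral_prod_partial_integrals_le\<close> turns them into a bound of the \<open>n / (n - 1)\<close>-norm of \<open>F(u)\<close> by an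
  integral. Choosing for \<open>F(u)\<close> the power \<open>m q (n - 1) / (n - q)\<close> of \<open>|u|\<close>, truncated at a level \<open>N\<close>, and absorbing
  the norm that appears on both sides gives the inequality for the exponent \<open>q\<^sup>*\<close> as \<open>N \<rightarrow> \<infinity>\<close>.
\<close>

section \<open>Powers of extended nonnegative reals and Hoelder's inequality\<close>

lemma epowr_ennreal [simp]: "0 \<le> x \<Longrightarrow> ennreal x epowr a = ennreal (x powr a)"
  by (simp add: enn_powr_def)

lemma epowr_top [simp]: "top epowr a = top"
  by (simp add: enn_powr_def)

lemma epowr_zero [simp]: "0 epowr a = 0"
  by (simp add: enn_powr_def)

lemma epowr_one_right [simp]: "x epowr 1 = x"
  by (cases x) simp_all

lemma one_epowr [simp]: "1 epowr a = 1"
  using epowr_ennreal[of 1 a] by simp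

lemma epowr_eq_0_iff [simp]: "x epowr a = 0 \<longleftrightarrow> x = 0"
  by (cases x) (auto simp: ennreal_eq_0_iff not_le)

lemma epowr_eq_top_iff [simp]: "x epowr a = top \<longleftrightarrow> x = top"
  by (cases x) auto

lemma epowr_mult: "a > 0 \<Longrightarrow> (x * y) epowr a = x epowr a * y epowr a"
  by (cases x; cases y)
     (auto simp: ennreal_mult[symmetric] powr_mult ennreal_mult_top ennreal_top_mult)

lemma epowr_epowr: "(x epowr a) epowr b = x epowr (a * b)"
  by (cases x) (auto simp: powr_powr)

lemma epowr_add: "x epowr a * x epowr b = x epowr (a + b)"
  by (cases x) (auto simp: ennreal_mult[symmetric] powr_add)

lemma epowr_mono: "a > 0 \<Longrightarrow> x \<le> y \<Longrightarrow> x epowr a \<le> y epowr a"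
  by (cases x; cases y) (auto intro!: ennreal_leI powr_mono2 simp: top_unique)

lemma epowr_prod:
  assumes "a > 0" "finite S" shows "(\<Prod>i\<in>S. f i) epowr a = (\<Prod>i\<in>S. f i epowr a)"
  using assms(2) by induction (simp_all add: epowr_mult \<open>a > 0\<close>)

lemma prod_epowr_const:
  assumes "finite S" "S \<noteq> {}"
  shows "(\<Prod>i\<in>S. z epowr a) = z epowr (real (card S) * a)"
  using assms by (induction S rule: finite_ne_induct) (simp_all add: epowr_add distrib_right)

lemma borel_measurable_epowr [measurable (raw)]:
  assumes [measurable]: "f \<in> borel_measurable M"
  shows "(\<lambda>x. f x epowr a) \<in> borel_measurable M"
  unfolding enn_powr_def by measurable

text \<open>Young's inequality, scaled so that it becomes an equality for \<open>x = F\<close> and \<open>y = G\<close>. Integrating it with \<open>F\<close> and \<open>G\<close> equal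
  to the integrals of the two functions gives Hoelder's inequality.\<close>

lemma Young_ennreal:
  fixes x y :: ennreal
  assumes a: "a > 0" "c > 0" "a + c = 1" and F: "F > 0" "G > 0"
  shows "x epowr a * y epowr c
    \<le> ennreal (F powr a * G powr c) * (ennreal (a / F) * x + ennreal (c / G) * y)"
proof (cases "x = 0 \<or> y = 0")
  case False
  show ?thesis
  proof (cases "x = top \<or> y = top")
    case True
    then show ?thesis using a F by (auto simp: ennreal_mult_top)
  next
    case fin: False
    obtain x' y' where xy: "x = ennreal x'" "y = ennreal y'" "x' > 0" "y' > 0"
      using False fin by (cases x; cases y) (auto simp: less_le)
    have "(x' / F) powr a * (y' / G) powr c \<le> a * (x' / F) + c * (y' / G)"
      using xy F a by (intro Youngs_inequality_0) auto
    then have "F powr a * G powr c * ((x' / F) powr a * (y' / G) powr c)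
        \<le> F powr a * G powr c * (a * (x' / F) + c * (y' / G))"
      using F by (intro mult_left_mono) auto
    also have "F powr a * G powr c * ((x' / F) powr a * (y' / G) powr c) = x' powr a * y' powr c"
      using xy F by (simp add: powr_divide)
    finally show ?thesis
      using xy F a by (simp flip: ennreal_mult ennreal_plus)
  qed
qed auto

text \<open>The convention \<open>0 \<cdot> \<infinity> = 0\<close> is harmless here: if one of the integrals on the right vanishes, then so does the integrand
  on the left almost everywhere.\<close>

lemma nn_integral_Holder_pair:
  assumes a: "a > 0" "c > 0" "a + c = 1"
    and [measurable]: "f \<in> borel_measurable M" "g \<in> borel_measurable M"
  shows "(\<integral>\<^sup>+x. f x epowr a * g x epowr c \<partial>M)
    \<le> (\<integral>\<^sup>+x. f x \<partial>M) epowr a * (\<integral>\<^sup>+x. g x \<partial>M) epowr c"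
    (is "?L \<le> ?F epowr a * ?G epowr c")
proof (cases "?F = 0 \<or> ?G = 0")
  case True
  then have "(AE x in M. f x = 0) \<or> (AE x in M. g x = 0)"
    by (simp add: nn_integral_0_iff_AE)
  then have "AE x in M. f x epowr a * g x epowr c = 0"
    by auto
  then have "?L = 0"
    by (subst nn_integral_0_iff_AE) auto
  then show ?thesis by simp
next
  case False
  show ?thesis
  proof (cases "?F = top \<or> ?G = top")
    case True
    then show ?thesis using False by (auto simp: ennreal_mult_top ennreal_top_mult)
  next
    case fin: False
    obtain F where F: "?F = ennreal F" "F > 0"
      using False fin by (cases ?F) (auto simp: less_le)
    obtain G where G: "?G = ennreal G" "G > 0"
      using False fin by (cases ?G) (auto simp: less_le)
    have "?L \<le>
      (\<integral>\<^sup>+x. ennreal (F powr a * G powr c) * (ennreal (a / F) * f x + ennreal (c / G) * g x) \<partial>M)"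
      using a F(2) G(2) by (intro nn_integral_mono Young_ennreal)
    also have "\<dots> = ennreal (F powr a * G powr c) * (ennreal (a / F) * F + ennreal (c / G) * G)"
      by (simp add: nn_integral_cmult nn_integral_add F(1) G(1))
    also have "ennreal (a / F) * F + ennreal (c / G) * G = 1"
      using F(2) G(2) a by (simp flip: ennreal_mult ennreal_plus)
    finally show ?thesis
      using F G by (simp add: ennreal_mult)
  qed
qed

lemma nn_integral_Holder:
  assumes "finite S" "S \<noteq> {}" "\<And>i. i \<in> S \<Longrightarrow> a i > 0" "sum a S = (1::real)"
    and "\<And>i. i \<in> S \<Longrightarrow> f i \<in> borel_measurable M"
  shows "(\<integral>\<^sup>+x. (\<Prod>i\<in>S. f i x epowr a i) \<partial>M) \<le> (\<Prod>i\<in>S. (\<integral>\<^sup>+x. f i x \<partial>M) epowr a i)"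
  using assms
proof (induction S arbitrary: a rule: finite_ne_induct)
  case (insert j S)
  note [measurable] = insert.prems(3)
  let ?c = "sum a S"
  have c: "?c > 0" using insert by (intro sum_pos) auto
  have ac: "a j + ?c = 1" using insert by simp
  have scale: "(\<Prod>i\<in>S. y i epowr a i) = (\<Prod>i\<in>S. y i epowr (a i / ?c)) epowr ?c" for y
    using c insert.hyps by (simp add: epowr_prod epowr_epowr)
  have "(\<integral>\<^sup>+x. (\<Prod>i\<in>insert j S. f i x epowr a i) \<partial>M)
      = (\<integral>\<^sup>+x. f j x epowr a j * (\<Prod>i\<in>S. f i x epowr (a i / ?c)) epowr ?c \<partial>M)"
    using insert.hyps by (simp add: scale)
  also have "\<dots> \<le> (\<integral>\<^sup>+x. f j x \<partial>M) epowr a j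
      * (\<integral>\<^sup>+x. (\<Prod>i\<in>S. f i x epowr (a i / ?c)) \<partial>M) epowr ?c"
    using insert.prems(1) c ac by (intro nn_integral_Holder_pair) auto
  also have "(\<integral>\<^sup>+x. (\<Prod>i\<in>S. f i x epowr (a i / ?c)) \<partial>M)
      \<le> (\<Prod>i\<in>S. (\<integral>\<^sup>+x. f i x \<partial>M) epowr (a i / ?c))"
    using insert.prems c by (intro insert.IH) (auto simp flip: sum_divide_distrib)
  finally show ?case
    using c insert.hyps by (simp add: scale epowr_mono mult_left_mono)
qed simp

section \<open>Smooth bumps and the fundamental lemma of the calculus of variations\<close>

text \<open>The functions \<open>P(1/t) exp(-1/t)\<close>, continued by 0 to \<open>t \<le> 0\<close>. Differentiation maps this family to itself
  (\<open>flat_exp_step\<close> computes the new polynomial), which makes all its members smooth at once.\<close>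

definition flat_exp :: "real poly \<Rightarrow> real \<Rightarrow> real" where
  "flat_exp P t = (if t > 0 then poly P (1 / t) * exp (- (1 / t)) else 0)"

definition flat_exp_step :: "real poly \<Rightarrow> real poly" where
  "flat_exp_step P = [:0, 0, 1:] * (P - pderiv P)"

lemma poly_times_exp_minus_tendsto_0:
  fixes P :: "real poly"
  shows "((\<lambda>x. poly P x * exp (- x)) \<longlongrightarrow> 0) at_top"
proof -
  have "((\<lambda>x. \<Sum>i\<le>degree P. coeff P i * (x ^ i / exp x)) \<longlongrightarrow> (\<Sum>i\<le>degree P. coeff P i * 0)) at_top"
    by (intro tendsto_sum tendsto_mult tendsto_const tendsto_power_div_exp_0)
  moreover have "(\<Sum>i\<le>degree P. coeff P i * (x ^ i / exp x)) = poly P x * exp (- x)" for x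
    by (simp add: poly_altdef sum_distrib_right exp_minus divide_inverse mult.assoc)
  ultimately show ?thesis
    by simp
qed

lemma flat_exp_tendsto_0: "(flat_exp P \<longlongrightarrow> 0) (at 0)"
proof -
  have "((\<lambda>t. poly P (inverse t) * exp (- inverse t)) \<longlongrightarrow> 0) (at_right 0)"
    by (rule filterlim_compose[OF poly_times_exp_minus_tendsto_0 filterlim_inverse_at_top_right])
  moreover have "\<forall>\<^sub>F t in at_right 0. poly P (inverse t) * exp (- inverse t) = flat_exp P t"
    by (auto simp: eventually_at_filter flat_exp_def inverse_eq_divide)
  ultimately have "(flat_exp P \<longlongrightarrow> 0) (at_right 0)"
    by (rule Lim_transform_eventually)
  moreover have "(flat_exp P \<longlongrightarrow> 0) (at_left 0)"
    by (rule tendsto_eventually) (auto simp: eventually_at_filter flat_exp_def)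
  ultimately show ?thesis
    by (simp add: filterlim_split_at)
qed

text \<open>At \<open>t = 0\<close> the difference quotient of \<open>flat_exp P\<close> is again a member of the family, for the polynomial \<open>X P\<close>, and so it tends to 0.\<close>

lemma flat_exp_has_real_derivative:
  "(flat_exp P has_real_derivative flat_exp (flat_exp_step P) t) (at t)"
proof -
  consider "t > 0" | "t < 0" | "t = 0" by linarith
  then show ?thesis
  proof cases
    case 1
    have "((\<lambda>t. poly P (1 / t) * exp (- (1 / t))) has_real_derivative
        flat_exp (flat_exp_step P) t) (at t)"
      using 1
      by (auto intro!: derivative_eq_intros DERIV_chain2[OF poly_DERIV]
          simp: flat_exp_def flat_exp_step_def field_simps)
    then show ?thesis
      by (rule DERIV_cong_ev[THEN iffD1, rotated 3])
         (use 1 in \<open>auto simp: flat_exp_def intro!: eventually_mono[OF eventually_gt_at_top[of 0]]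
           eventually_nhds_in_open[of "{0<..}", THEN eventually_mono]\<close>)
  next
    case 2
    have "((\<lambda>t. 0) has_real_derivative flat_exp (flat_exp_step P) t) (at t)"
      using 2 by (auto simp: flat_exp_def)
    then show ?thesis
      by (rule DERIV_cong_ev[THEN iffD1, rotated 3])
         (use 2 in \<open>auto simp: flat_exp_def intro!:
           eventually_nhds_in_open[of "{..<0}", THEN eventually_mono]\<close>)
  next
    case 3
    have "(flat_exp ([:0, 1:] * P) \<longlongrightarrow> 0) (at 0)"
      by (rule flat_exp_tendsto_0)
    moreover have "flat_exp ([:0, 1:] * P) = (\<lambda>h. (flat_exp P (0 + h) - flat_exp P 0) / h)"
      by (auto simp: flat_exp_def)
    ultimately show ?thesis
      using 3 by (simp add: DERIV_def flat_exp_def)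
  qed
qed

lemma C_k_pred: "C_k (Suc k) f \<Longrightarrow> C_k k f"
proof (induction k arbitrary: f)
  case 0
  then show ?case
    by (simp add: continuous_at_imp_continuous_on differentiable_imp_continuous_within)
qed auto

lemma C_k_zero: "C_k k (\<lambda>x. 0)"
  by (induction k) (simp_all add: frechet_derivative_const)

lemma C_k_add: "C_k k f \<Longrightarrow> C_k k g \<Longrightarrow> C_k k (\<lambda>x. f x + g x)"
proof (induction k arbitrary: f g)
  case (Suc k)
  have "frechet_derivative (\<lambda>x. f x + g x) (at x) b
      = frechet_derivative f (at x) b + frechet_derivative g (at x) b" for x b
    using Suc.prems
    by (intro frechet_derivative_at[symmetric, THEN fun_cong] has_derivative_add)
       (auto simp: frechet_derivative_works)
  then show ?case using Suc by auto
qed (auto intro: continuous_intros)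

lemma C_k_mult: "C_k k f \<Longrightarrow> C_k k g \<Longrightarrow> C_k k (\<lambda>x. f x * g x)"
proof (induction k arbitrary: f g)
  case (Suc k)
  have "frechet_derivative (\<lambda>x. f x * g x) (at x) b
      = f x * frechet_derivative g (at x) b + frechet_derivative f (at x) b * g x" for x b
    using Suc.prems
    by (intro frechet_derivative_at[symmetric, THEN fun_cong] has_derivative_mult)
       (auto simp: frechet_derivative_works)
  then show ?case
    using Suc C_k_pred[OF Suc.prems(1)] C_k_pred[OF Suc.prems(2)] by (auto intro!: C_k_add)
qed (auto intro: continuous_intros)

lemma C_k_const: "C_k k (\<lambda>x. c)"
  by (cases k) (simp_all add: frechet_derivative_const C_k_zero)

lemma C_k_prod: "finite I \<Longrightarrow> (\<And>i. i \<in> I \<Longrightarrow> C_k k (f i)) \<Longrightarrow> C_k k (\<lambda>x. \<Prod>i\<in>I. f i x)"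
  by (induction I rule: finite_induct) (simp_all add: C_k_const C_k_mult)

text \<open>The induction runs over all \<open>P\<close> at once, since the derivative has another polynomial.\<close>

lemma C_k_flat_exp: "C_k k (\<lambda>x. flat_exp P (x \<bullet> v + d))"
proof (induction k arbitrary: P)
  case 0
  have "continuous_on UNIV (flat_exp P)"
    by (rule DERIV_continuous_on[OF has_field_derivative_at_within])
       (rule flat_exp_has_real_derivative)
  then show ?case
    by (auto intro!: continuous_on_compose2[of UNIV "flat_exp P"] continuous_intros)
next
  case (Suc k)
  have D: "((\<lambda>x. flat_exp P (x \<bullet> v + d)) has_derivative
      (\<lambda>h. (h \<bullet> v) * flat_exp (flat_exp_step P) (x \<bullet> v + d))) (at x)" for x
    by (rule has_derivative_eq_rhs[OF DERIV_compose_FDERIV[OF flat_exp_has_real_derivative]])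
       (auto intro!: derivative_eq_intros)
  then have "frechet_derivative (\<lambda>x. flat_exp P (x \<bullet> v + d)) (at x)
      = (\<lambda>h. (h \<bullet> v) * flat_exp (flat_exp_step P) (x \<bullet> v + d))" for x
    by (metis frechet_derivative_at)
  with D show ?case
    by (auto simp: differentiable_def intro!: C_k_mult C_k_const Suc)
qed

lemma has_derivative_translate:
  assumes "(f has_derivative f') (at (x - c))"
  shows "((\<lambda>x. f (x - c)) has_derivative f') (at x)"
proof -
  have "((\<lambda>x. x - c) has_derivative (\<lambda>h. h)) (at x)"
    by (auto intro!: derivative_eq_intros)
  from has_derivative_compose[OF this assms] show ?thesis by simp
qed

lemma frechet_derivative_translate:
  assumes "(f has_derivative frechet_derivative f (at (x - c))) (at (x - c))"
  shows "frechet_derivative (\<lambda>x. f (x - c)) (at x) = frechet_derivative f (at (x - c))"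
  using has_derivative_translate[OF assms] by (metis frechet_derivative_at)

lemma C_k_translate: "C_k k f \<Longrightarrow> C_k k (\<lambda>x. f (x - c))"
proof (induction k arbitrary: f)
  case 0
  then show ?case by (auto intro!: continuous_on_compose2[of UNIV f] continuous_intros)
next
  case (Suc k)
  have f': "(f has_derivative frechet_derivative f (at y)) (at y)" for y
    using Suc.prems by (simp add: frechet_derivative_works)
  have "C_k k (\<lambda>x. frechet_derivative f (at (x - c)) b)" if "b \<in> Basis" for b
    using Suc.IH[of "\<lambda>x. frechet_derivative f (at x) b"] Suc.prems that by simp
  then show ?case
    using has_derivative_translate[OF f'] frechet_derivative_translate[OF f']
    by (auto simp: differentiable_def)
qed

lemma test_function_translate:
  assumes "test_function V \<psi>" "\<And>x. x \<in> V \<Longrightarrow> x + c \<in> U"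
  shows "test_function U (\<lambda>x. \<psi> (x - c))"
proof -
  have eq: "{x. \<psi> (x - c) \<noteq> 0} = (+) c ` {x. \<psi> x \<noteq> 0}"
    by (force simp: image_iff)
  have cl: "closure {x. \<psi> (x - c) \<noteq> 0} = (+) c ` closure {x. \<psi> x \<noteq> 0}"
    unfolding eq by (rule closure_translation)
  have "compact (closure {x. \<psi> (x - c) \<noteq> 0})"
    unfolding cl using assms(1) by (intro compact_translation) (auto simp: test_function_def)
  then show ?thesis
    using assms cl unfolding test_function_def C_infinity_def
    by (auto intro: C_k_translate simp: add.commute subset_iff)
qed

text \<open>A smooth function that is positive exactly on the box and tends to its indicator function as \<open>k \<rightarrow> \<infinity>\<close>, because
  \<open>exp(-1/(k t)) \<rightarrow> 1\<close> for \<open>t > 0\<close>. The inner products are arranged in the form to which \<open>C_k_flat_exp\<close> applies.\<close>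

definition box_bump :: "'a::euclidean_space \<Rightarrow> 'a \<Rightarrow> nat \<Rightarrow> 'a \<Rightarrow> real" where
  "box_bump a b k x = (\<Prod>i\<in>Basis.
     flat_exp 1 (x \<bullet> (real (Suc k) *\<^sub>R i) + - (real (Suc k) * (a \<bullet> i)))
     * flat_exp 1 (x \<bullet> (- real (Suc k) *\<^sub>R i) + real (Suc k) * (b \<bullet> i)))"

lemma box_bump_alt: "box_bump a b k x = (\<Prod>i\<in>Basis.
     flat_exp 1 (real (Suc k) * (x \<bullet> i - a \<bullet> i)) * flat_exp 1 (real (Suc k) * (b \<bullet> i - x \<bullet> i)))"
  unfolding box_bump_def by (simp add: algebra_simps)

lemma flat_exp_one_bounds: "0 \<le> flat_exp 1 t" "flat_exp 1 t \<le> 1"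
  by (auto simp: flat_exp_def)

lemma box_bump_bounds: "0 \<le> box_bump a b k x" "box_bump a b k x \<le> 1"
  unfolding box_bump_alt
  by (intro prod_nonneg prod_le_1 conjI mult_nonneg_nonneg mult_le_one flat_exp_one_bounds)+

lemma box_bump_eq_0: "x \<notin> box a b \<Longrightarrow> box_bump a b k x = 0"
proof -
  assume "x \<notin> box a b"
  then obtain i where i: "i \<in> Basis" "x \<bullet> i - a \<bullet> i \<le> 0 \<or> b \<bullet> i - x \<bullet> i \<le> 0"
    by (auto simp: mem_box not_less)
  have "flat_exp 1 (real (Suc k) * t) = 0" if "t \<le> 0" for t
    using that by (simp add: flat_exp_def zero_less_mult_iff)
  with i show ?thesis
    unfolding box_bump_alt by (intro prod_zero) (auto intro!: bexI[of _ i])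
qed

lemma box_bump_tendsto: "(\<lambda>k. box_bump a b k x) \<longlonglongrightarrow> indicator (box a b) x"
proof (cases "x \<in> box a b")
  case True
  have *: "(\<lambda>k. flat_exp 1 (real (Suc k) * c)) \<longlonglongrightarrow> 1" if "c > 0" for c
  proof -
    have "(\<lambda>k. exp (- (1 / real (Suc k) * (1 / c)))) \<longlonglongrightarrow> exp (- (0 * (1 / c)))"
      by (intro tendsto_intros LIMSEQ_Suc lim_1_over_n)
    then show ?thesis using that by (simp add: flat_exp_def zero_less_mult_iff)
  qed
  have "(\<lambda>k. box_bump a b k x) \<longlonglongrightarrow> (\<Prod>i\<in>(Basis::'a set). 1 * 1)"
    unfolding box_bump_alt
    using True by (intro tendsto_prod tendsto_mult *) (auto simp: mem_box)
  then show ?thesis using True by simp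
qed (simp add: box_bump_eq_0)

lemma test_function_box_bump:
  assumes "cbox a b \<subseteq> V" shows "test_function V (box_bump a b k)"
proof -
  have "C_k j (box_bump a b k)" for j
    unfolding box_bump_def by (intro C_k_prod C_k_mult C_k_flat_exp) auto
  moreover have *: "closure {x. box_bump a b k x \<noteq> 0} \<subseteq> cbox a b"
    by (rule closure_minimal) (use box_bump_eq_0 box_subset_cbox[of a b] in blast)+
  moreover have "compact (closure {x. box_bump a b k x \<noteq> 0})"
    using * bounded_subset[OF bounded_cbox] by (auto simp: compact_eq_bounded_closed)
  ultimately show ?thesis
    using assms by (auto simp: test_function_def C_infinity_def)
qed

text \<open>Smooth bumps approximate indicator functions of boxes, so the integral of \<open>f\<close> vanishes over every box whose closure lies in \<open>V\<close>. The positive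
  and the negative part of \<open>f\<close> are then densities of measures that agree on the boxes, an intersection-stable generator of the Borel
  sets.\<close>

lemma fundamental_lemma_of_variations:
  fixes f :: "'a::euclidean_space \<Rightarrow> real"
  assumes f: "integrable lborel f" and V: "open V"
    and zero: "\<And>\<psi>. test_function V \<psi> \<Longrightarrow> (LINT x|lborel. f x * \<psi> x) = 0"
  shows "AE x in lborel. x \<in> V \<longrightarrow> f x = 0"
proof -
  note [measurable] = borel_measurable_integrable[OF f]
  have box0: "(LINT x|lborel. f x * indicator (box a b) x) = 0" if "cbox a b \<subseteq> V" for a b
  proof -
    have [measurable]: "box_bump a b k \<in> borel_measurable borel" for k
      using test_function_box_bump[OF that, of k]
      by (intro borel_measurable_continuous_onI)
         (auto simp: test_function_def C_infinity_def dest: spec[of _ 0])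
    have "(\<lambda>k. LINT x|lborel. f x * box_bump a b k x) \<longlonglongrightarrow> (LINT x|lborel. f x * indicator (box a b) x)"
      using f
      by (intro integral_dominated_convergence[where w="\<lambda>x. \<bar>f x\<bar>"])
         (auto intro!: tendsto_mult box_bump_tendsto AE_I2
           simp: abs_mult box_bump_bounds mult_left_le)
    then show ?thesis
      by (simp add: zero[OF test_function_box_bump[OF that]] LIMSEQ_const_iff)
  qed
  have ae: "AE x in lborel. x \<in> box a b \<longrightarrow> f x = 0" if ab: "cbox a b \<subseteq> V" for a b
  proof -
    define f1 where "f1 = (\<lambda>x. ennreal (f x) * indicator (box a b) x)"
    define f2 where "f2 = (\<lambda>x. ennreal (- f x) * indicator (box a b) x)"
    have [measurable]: "f1 \<in> borel_measurable borel" "f2 \<in> borel_measurable borel"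
      by (simp_all add: f1_def f2_def)
    have fin: "(\<integral>\<^sup>+x. ennreal (h x) * indicator A x \<partial>lborel) < top"
      if "integrable lborel h" for h and A :: "'a set"
    proof -
      have "(\<integral>\<^sup>+x. ennreal (h x) * indicator A x \<partial>lborel) \<le> (\<integral>\<^sup>+x. ennreal (norm (h x)) \<partial>lborel)"
        by (intro nn_integral_mono) (auto split: split_indicator intro!: ennreal_leI)
      also have "\<dots> < top" using that by (simp add: integrable_iff_bounded)
      finally show ?thesis .
    qed
    have "density lborel f1 = density lborel f2"
    proof (rule measure_eqI_generator_eq[where \<Omega>=UNIV and E="range (\<lambda>(a, b). box a b)"
          and A="\<lambda>n. box (- (real n *\<^sub>R One)) (real n *\<^sub>R One)"])
      show "Int_stable (range (\<lambda>(a::'a, b). box a b))"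
        by (auto simp: Int_stable_def box_Int_box)
      show "sets (density lborel f1) = sigma_sets UNIV (range (\<lambda>(a, b). box a b))"
        "sets (density lborel f2) = sigma_sets UNIV (range (\<lambda>(a, b). box a b))"
        by (simp_all add: borel_eq_box)
      show "(\<Union>n. box (- (real n *\<^sub>R One)) (real n *\<^sub>R One)) = (UNIV :: 'a set)"
        by (rule UN_box_eq_UNIV)
      show "emeasure (density lborel f1) (box (- (real n *\<^sub>R One)) (real n *\<^sub>R One)) \<noteq> \<infinity>" for n
        using fin[OF f, of "box a b \<inter> box (- (real n *\<^sub>R One)) (real n *\<^sub>R One)"]
        by (simp add: emeasure_density f1_def mult.assoc flip: indicator_inter_arith)
    next
      fix X assume "X \<in> range (\<lambda>(a::'a, b). box a b)"
      then obtain c d where X: "X = box c d" by auto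
      obtain c' d' where I: "box a b \<inter> X = box c' d'"
        unfolding X box_Int_box by blast
      let ?f = "\<lambda>x. f x * indicator (box c' d') x"
        and ?I1 = "\<integral>\<^sup>+x. f1 x * indicator X x \<partial>lborel" and ?I2 = "\<integral>\<^sup>+x. f2 x * indicator X x \<partial>lborel"
      have "(LINT x|lborel. ?f x) = 0"
      proof (cases "box c' d' = {}")
        case False
        then have "cbox c' d' \<subseteq> cbox a b"
          using I closure_mono[of "box c' d'" "cbox a b"] box_subset_cbox[of a b]
          by (auto simp: closure_box[OF False])
        with ab show ?thesis by (intro box0) auto
      qed simp
      moreover have *: "integrable lborel (\<lambda>x. ?f x)"
        using f by (intro integrable_real_mult_indicator) auto
      ultimately have "enn2real (\<integral>\<^sup>+x. ennreal (?f x) \<partial>lborel)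
          = enn2real (\<integral>\<^sup>+x. ennreal (- (?f x)) \<partial>lborel)"
        by (simp add: real_lebesgue_integral_def)
      moreover have e: "ennreal (?f x) = f1 x * indicator X x"
        "ennreal (- (?f x)) = f2 x * indicator X x" for x
        unfolding I[symmetric] by (auto simp: f1_def f2_def split: split_indicator)
      moreover have "?I1 < top"
        "?I2 < top"
        using fin[OF f, of "box a b \<inter> X"] fin[of "\<lambda>x. - f x" "box a b \<inter> X"] f
        by (simp_all add: f1_def f2_def mult.assoc flip: indicator_inter_arith)
      ultimately have "?I1 = ?I2"
        unfolding e by (metis (no_types) ennreal_enn2real)
      then show "emeasure (density lborel f1) X = emeasure (density lborel f2) X"
        by (simp add: emeasure_density X)
    qed auto
    then have "AE x in lborel. f1 x = f2 x"
      by (intro sigma_finite_measure.density_unique[OF lborel.sigma_finite_measure_axioms]) auto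
    moreover have "f x = 0" if "f1 x = f2 x" "x \<in> box a b" for x
    proof -
      have "ennreal (f x) = ennreal (- f x)"
        using that by (simp add: f1_def f2_def)
      then have "max 0 (f x) = max 0 (- f x)"
        by (metis enn2real_ennreal ennreal_max_0 max.cobounded1)
      then show ?thesis by (auto simp: max_def split: if_splits)
    qed
    ultimately show ?thesis
      by (auto elim: eventually_mono)
  qed
  let ?F = "{box a b |a b. cbox a b \<subseteq> V}"
  obtain D where D: "D \<subseteq> ?F" "countable D" "\<Union>D = \<Union>?F"
    by (rule Lindelof[of ?F]) auto
  have "AE x in lborel. \<forall>X\<in>D. x \<in> X \<longrightarrow> f x = 0"
    using D by (intro AE_ball_countable') (auto dest!: ae)
  moreover have "V \<subseteq> \<Union>D"
  proof
    fix x assume "x \<in> V"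
    from open_contains_cbox[OF V this] obtain a b where "cbox a b \<subseteq> V" "x \<in> box a b" by metis
    then show "x \<in> \<Union>D" unfolding D(3) by blast
  qed
  ultimately show ?thesis
    by (elim eventually_mono) blast
qed

section \<open>Gagliardo's inequality\<close>

text \<open>The Loomis-Whitney inequality in the form used by Gagliardo: for \<open>I = S\<close>, the \<open>i\<close>-th factor is the integral of \<open>H i\<close> over the
  \<open>i\<close>-th coordinate. The statement with a subset \<open>I\<close> of coordinates makes an induction possible. When a coordinate \<open>j\<close> is added,
  the factor of index \<open>j\<close> does not depend on it, and the other \<open>|S| - 1\<close> factors, each with exponent \<open>1 / (|S| - 1)\<close>, are
  handled by Hoelder's inequality in the variable \<open>j\<close>.\<close>

lemma nn_integral_prod_partial_integrals_le:
  fixes M :: "'i \<Rightarrow> 'a measure" and H :: "'i \<Rightarrow> ('i \<Rightarrow> 'a) \<Rightarrow> ennreal"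
  assumes "product_sigma_finite M" and S: "finite S" "card S \<ge> 2" and "I \<subseteq> S"
    and "\<And>i. i \<in> S \<Longrightarrow> H i \<in> borel_measurable (PiM I M)"
  defines "a \<equiv> 1 / (real (card S) - 1)"
  shows "(\<integral>\<^sup>+x. (\<Prod>i\<in>S. (if i \<in> I then \<integral>\<^sup>+t. H i (x(i := t)) \<partial>M i else H i x) epowr a) \<partial>PiM I M)
    \<le> (\<Prod>i\<in>S. (\<integral>\<^sup>+x. H i x \<partial>PiM I M) epowr a)"
proof -
  interpret product_sigma_finite M by fact
  have "finite I" using S \<open>I \<subseteq> S\<close> finite_subset by blast
  then show ?thesis
    using assms(4,5)
  proof (induction I arbitrary: H rule: finite_induct)
    case empty
    then show ?case by (simp add: PiM_empty nn_integral_count_space_finite)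
  next
    case (insert j I)
    have j: "j \<in> S" "I \<subseteq> S" using insert.prems by auto
    note meas [measurable] = insert.prems(2)
    note [simp] = insert.hyps(1)
    \<comment> \<open>The family for which the induction hypothesis is used when coordinate \<open>j\<close> has the value \<open>t\<close>.\<close>
    define K where "K = (\<lambda>t i x. if i = j then \<integral>\<^sup>+s. H j (x(j := s)) \<partial>M j else H i (x(j := t)))"
    have upd [measurable]: "(\<lambda>p. (fst p)(j := snd p)) \<in> measurable (PiM I M \<Otimes>\<^sub>M M j) (PiM (insert j I) M)"
      by measurable
    have upd2 [measurable]: "(\<lambda>p. (snd p)(j := fst p)) \<in> measurable (M j \<Otimes>\<^sub>M PiM I M) (PiM (insert j I) M)"
      by measurable
    have Hm1 [measurable]: "(\<lambda>x. H i (x(j := t))) \<in> borel_measurable (PiM I M)"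
      if "i \<in> S" "t \<in> space (M j)" for i t
      using that by measurable
    have Hm2 [measurable]: "(\<lambda>(t, x). H i (x(j := t))) \<in> borel_measurable (M j \<Otimes>\<^sub>M PiM I M)"
      "(\<lambda>(x, t). H i (x(j := t))) \<in> borel_measurable (PiM I M \<Otimes>\<^sub>M M j)"
      if "i \<in> S" for i
      using that measurable_compose[OF upd meas] measurable_compose[OF upd2 meas]
      by (simp_all add: split_beta)
    have Km: "K t i \<in> borel_measurable (PiM I M)" if "i \<in> S" "t \<in> space (M j)" for t i
      using that j Hm2(2)[OF j(1)]
      by (auto simp: K_def intro!: sigma_finite_measure.borel_measurable_nn_integral sigma_finite_measures)
    have full: "(\<integral>\<^sup>+x. h x \<partial>PiM (insert j I) M) = (\<integral>\<^sup>+t. \<integral>\<^sup>+x. h (x(j := t)) \<partial>PiM I M \<partial>M j)"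
      if "h \<in> borel_measurable (PiM (insert j I) M)" for h
      by (rule product_nn_integral_insert_rev) (use insert that in auto)
    have Kj: "(\<integral>\<^sup>+x. K t j x \<partial>PiM I M) = (\<integral>\<^sup>+x. H j x \<partial>PiM (insert j I) M)" for t
      unfolding K_def using j(1) insert.hyps
      by (simp add: product_nn_integral_insert)
    have point: "(if i \<in> insert j I then \<integral>\<^sup>+s. H i ((x(j := t))(i := s)) \<partial>M i else H i (x(j := t)))
        = (if i \<in> I then \<integral>\<^sup>+s. K t i (x(i := s)) \<partial>M i else K t i x)" for i t x
      using insert.hyps(2) by (auto simp: K_def fun_upd_twist)
    have inner: "(\<lambda>t. \<integral>\<^sup>+x. H i (x(j := t)) \<partial>PiM I M) \<in> borel_measurable (M j)" if "i \<in> S" for i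
      using Hm2(1)[OF that] by (intro sigma_finite_measure.borel_measurable_nn_integral sigma_finite) auto
    let ?Q = "\<lambda>i x. if i \<in> insert j I then \<integral>\<^sup>+t. H i (x(i := t)) \<partial>M i else H i x"
      and ?E = "(\<integral>\<^sup>+x. H j x \<partial>PiM (insert j I) M) epowr a"
      and ?R = "\<lambda>t. \<Prod>i\<in>S - {j}. (\<integral>\<^sup>+x. H i (x(j := t)) \<partial>PiM I M) epowr a"
    have "(\<integral>\<^sup>+x. (\<Prod>i\<in>S. ?Q i x epowr a)
          \<partial>PiM (insert j I) M)
        = (\<integral>\<^sup>+t. \<integral>\<^sup>+x. (\<Prod>i\<in>S. (if i \<in> I then \<integral>\<^sup>+s. K t i (x(i := s)) \<partial>M i else K t i x) epowr a)
          \<partial>PiM I M \<partial>M j)"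
    proof (subst full)
      have "(\<lambda>x. \<integral>\<^sup>+t. H i (x(i := t)) \<partial>M i) \<in> borel_measurable (PiM (insert j I) M)"
        if i: "i \<in> S" "i \<in> insert j I" for i
      proof -
        have "(\<lambda>p. (fst p)(i := snd p)) \<in> measurable (PiM (insert j I) M \<Otimes>\<^sub>M M i) (PiM (insert j I) M)"
          using i by (intro measurable_fun_upd[where J="insert j I"]) auto
        from measurable_compose[OF this meas[OF i(1)]] show ?thesis
          by (intro sigma_finite_measure.borel_measurable_nn_integral sigma_finite_measures)
             (simp only: split_beta')
      qed
      then have "(\<lambda>x. ?Q i x)
          \<in> borel_measurable (PiM (insert j I) M)" if "i \<in> S" for i
        using that meas by (cases "i \<in> insert j I") auto
      then show "(\<lambda>x. \<Prod>i\<in>S. ?Q i x epowr a)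
          \<in> borel_measurable (PiM (insert j I) M)"
        by (intro borel_measurable_prod_ennreal borel_measurable_epowr)
    qed (simp only: point)
    also have "\<dots> \<le> (\<integral>\<^sup>+t. (\<Prod>i\<in>S. (\<integral>\<^sup>+x. K t i x \<partial>PiM I M) epowr a) \<partial>M j)"
      using Km j by (intro nn_integral_mono insert.IH) auto
    also have "\<dots> = (\<integral>\<^sup>+t. ?E
        * ?R t \<partial>M j)"
      unfolding prod.remove[OF S(1) j(1)] Kj
      by (auto simp: K_def intro!: nn_integral_cong arg_cong2[where f="(*)"] prod.cong)
    also have "\<dots> = ?E
        * (\<integral>\<^sup>+t. ?R t \<partial>M j)"
      using inner
      by (intro nn_integral_cmult borel_measurable_prod_ennreal borel_measurable_epowr) auto
    also have "\<dots> \<le> ?E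
        * (\<Prod>i\<in>S - {j}. (\<integral>\<^sup>+t. \<integral>\<^sup>+x. H i (x(j := t)) \<partial>PiM I M \<partial>M j) epowr a)"
    proof (intro mult_left_mono nn_integral_Holder)
      have c: "card (S - {j}) = card S - 1" using S j by simp
      then show "S - {j} \<noteq> {}" using S j by (metis card.empty diff_is_0_eq not_less_eq_eq numeral_2_eq_2 One_nat_def)
      show "(\<Sum>i\<in>S - {j}. a) = 1" using S c by (simp add: a_def of_nat_diff)
      show "a > 0" using S by (simp add: a_def)
    qed (use S inner in auto)
    also have "\<dots> = (\<Prod>i\<in>S. (\<integral>\<^sup>+x. H i x \<partial>PiM (insert j I) M) epowr a)"
      unfolding prod.remove[OF S(1) j(1)] using meas by (simp add: full)
    finally show ?case .
  qed
qed

lemma nn_integral_lborel_translate: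
  fixes f :: "'a::euclidean_space \<Rightarrow> ennreal"
  assumes "f \<in> borel_measurable borel"
  shows "(\<integral>\<^sup>+x. f (c + x) \<partial>lborel) = (\<integral>\<^sup>+x. f x \<partial>lborel)"
  using nn_integral_distr[of "(+) c" lborel borel f] assms by (simp add: lborel_distr_plus)

lemma borel_measurable_linear:
  fixes T :: "'a::euclidean_space \<Rightarrow> 'b::euclidean_space"
  assumes "linear T" shows "T \<in> borel_measurable borel"
  using assms by (intro borel_measurable_continuous_onI)
    (simp add: linear_continuous_on linear_conv_bounded_linear)

text \<open>The uniqueness argument for translation-invariant measures: the double integral of \<open>f(T x) g(T x + y)\<close> is computed in both orders,
  with the indicator function of the unit box for \<open>g\<close>. The constant is the volume of the preimage of the unit box.\<close>

lemma nn_integral_lborel_linear: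
  fixes T :: "'a::euclidean_space \<Rightarrow> 'a"
  assumes T: "linear T" "inj T"
  obtains c :: real where "c > 0"
    and "\<And>f. f \<in> borel_measurable borel \<Longrightarrow>
      (\<integral>\<^sup>+x. f (T x) \<partial>lborel) = ennreal c * (\<integral>\<^sup>+x. f x \<partial>lborel)"
proof -
  obtain T' where T': "linear T'" "\<And>x. T' (T x) = x" "\<And>x. T (T' x) = x"
    using linear_injective_isomorphism[OF T] by metis
  have cont: "continuous_on A T" "continuous_on A T'" for A
    using T T' by (simp_all add: linear_continuous_on linear_conv_bounded_linear)
  note [measurable] = borel_measurable_linear[OF T(1)] borel_measurable_linear[OF T'(1)]
  define g :: "'a \<Rightarrow> ennreal" where "g = indicator (box 0 One)"
  have [measurable]: "g \<in> borel_measurable borel" by (simp add: g_def)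
  have g1: "(\<integral>\<^sup>+x. g x \<partial>lborel) = 1"
    by (simp add: g_def emeasure_lborel_box_eq inner_Basis)
  let ?P = "T -` box 0 One"
  have im: "?P = T' ` box 0 One"
    using T' by (auto simp: image_iff) metis
  have gT: "(\<integral>\<^sup>+x. g (T x) \<partial>lborel) = emeasure lborel ?P"
    using measurable_sets[of T borel borel "box 0 One"]
    by (simp add: g_def flip: indicator_vimage nn_integral_indicator)
  have "open ?P" using cont(1)[of UNIV] by (intro open_vimage) auto
  moreover have "?P \<noteq> {}" unfolding im by (auto simp: box_eq_empty)
  ultimately have pos: "emeasure lborel ?P \<noteq> 0"
    using open_not_negligible[of ?P]
    by (auto simp: negligible_iff_null_sets intro!: null_sets_completionI null_setsI)
  have "bounded ?P"
    unfolding im using bounded_linear_image[OF bounded_box] T'(1)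
    by (simp add: linear_conv_bounded_linear)
  then have fin: "emeasure lborel ?P < top"
    using emeasure_bounded_finite by (simp add: infinity_ennreal_def)
  have main: "(\<integral>\<^sup>+x. f (T x) \<partial>lborel) = emeasure lborel ?P * (\<integral>\<^sup>+x. f x \<partial>lborel)"
    if [measurable]: "f \<in> borel_measurable borel" for f
  proof -
    have "(\<integral>\<^sup>+x. f (T x) \<partial>lborel) = (\<integral>\<^sup>+x. \<integral>\<^sup>+y. f (T x) * g (T x + y) \<partial>lborel \<partial>lborel)"
      by (simp add: nn_integral_cmult nn_integral_lborel_translate g1)
    also have "\<dots> = (\<integral>\<^sup>+y. \<integral>\<^sup>+x. f (T x) * g (T x + y) \<partial>lborel \<partial>lborel)"
      by (rule lborel_pair.Fubini') measurable
    also have "\<dots> = (\<integral>\<^sup>+y. \<integral>\<^sup>+x. f (T (- T' y + x)) * g (T (- T' y + x) + y) \<partial>lborel \<partial>lborel)"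
      by (rule nn_integral_cong, subst nn_integral_lborel_translate) auto
    also have "\<dots> = (\<integral>\<^sup>+y. \<integral>\<^sup>+x. g (T x) * f (T x - y) \<partial>lborel \<partial>lborel)"
      using T' by (simp add: linear_add[OF T(1)] linear_diff[OF T(1)] linear_neg[OF T(1)] mult.commute)
    also have "\<dots> = (\<integral>\<^sup>+x. \<integral>\<^sup>+y. g (T x) * f (T x - y) \<partial>lborel \<partial>lborel)"
      by (rule lborel_pair.Fubini') measurable
    also have "\<dots> = (\<integral>\<^sup>+x. g (T x) * (\<integral>\<^sup>+y. f (- y) \<partial>lborel) \<partial>lborel)"
    proof (rule nn_integral_cong)
      fix x
      have "(\<integral>\<^sup>+y. g (T x) * f (T x - y) \<partial>lborel) = g (T x) * (\<integral>\<^sup>+y. f (- (- T x + y)) \<partial>lborel)"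
        by (simp add: nn_integral_cmult)
      also have "(\<integral>\<^sup>+y. f (- (- T x + y)) \<partial>lborel) = (\<integral>\<^sup>+y. f (- y) \<partial>lborel)"
        by (rule nn_integral_lborel_translate) auto
      finally show "(\<integral>\<^sup>+y. g (T x) * f (T x - y) \<partial>lborel) = g (T x) * (\<integral>\<^sup>+y. f (- y) \<partial>lborel)" .
    qed
    also have "\<dots> = emeasure lborel ?P * (\<integral>\<^sup>+y. f (- y) \<partial>lborel)"
      by (simp add: nn_integral_multc gT)
    also have "(\<integral>\<^sup>+y. f (- y) \<partial>lborel) = (\<integral>\<^sup>+y. f y \<partial>lborel)"
      by (subst lborel_affine[of "-1" 0]) (simp_all add: nn_integral_density nn_integral_distr)
    finally show ?thesis .
  qed
  obtain c where c: "emeasure lborel ?P = ennreal c" "c > 0"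
    using fin pos by (cases "emeasure lborel ?P") (auto simp: less_le)
  show thesis
    by (rule that[OF c(2)]) (simp add: main c(1))
qed

lemma AE_lborel_linear:
  fixes T :: "'a::euclidean_space \<Rightarrow> 'a"
  assumes T: "linear T" "inj T" and ae: "AE x in lborel. P x"
  shows "AE x in lborel. P (T x)"
proof -
  obtain c :: real where c: "c > 0" "\<And>f. f \<in> borel_measurable borel \<Longrightarrow>
      (\<integral>\<^sup>+x. f (T x) \<partial>lborel) = ennreal c * (\<integral>\<^sup>+x. f x \<partial>lborel)"
    using nn_integral_lborel_linear[OF T] by metis
  note [measurable] = borel_measurable_linear[OF T(1)]
  obtain N where N: "N \<in> null_sets lborel" "{x. \<not> P x} \<subseteq> N"
    using ae by (auto elim!: AE_E2 simp: eventually_ae_filter)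
  have [measurable]: "N \<in> sets borel" using N by auto
  have "(\<integral>\<^sup>+x. indicator N (T x) \<partial>lborel) = 0"
    using N by (subst c(2)) auto
  then have "AE x in lborel. indicator N (T x) = (0::ennreal)"
    by (subst (asm) nn_integral_0_iff_AE) auto
  then show ?thesis
    by (rule eventually_mono) (use N in \<open>auto split: split_indicator_asm\<close>)
qed

text \<open>The linear map \<open>T\<close> turns the coordinate axes into the lines along which \<open>f\<close> is bounded, so
  \<open>nn_integral_prod_partial_integrals_le\<close> applies to \<open>f \<circ> T\<close> in the coordinates of the product measure.\<close>

lemma Gagliardo_inequality:
  fixes T :: "'a::euclidean_space \<Rightarrow> 'a"
  assumes T: "linear T" "inj T" and dim: "DIM('a) \<ge> 2"
  defines "n \<equiv> real DIM('a)"
  shows "\<exists>K>0. \<forall>(f :: 'a \<Rightarrow> ennreal) H. f \<in> borel_measurable borel \<longrightarrow>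
      (\<forall>b\<in>Basis. H b \<in> borel_measurable borel) \<longrightarrow>
      (AE x in lborel. \<forall>b\<in>Basis. f x \<le> (\<integral>\<^sup>+t. H b (x + t *\<^sub>R T b) \<partial>lborel)) \<longrightarrow>
      (\<integral>\<^sup>+x. f x epowr (n / (n - 1)) \<partial>lborel)
        \<le> ennreal K * (\<Prod>b\<in>Basis. (\<integral>\<^sup>+x. H b x \<partial>lborel) epowr (1 / (n - 1)))"
proof -
  obtain c :: real where c: "c > 0" "\<And>f. f \<in> borel_measurable borel \<Longrightarrow>
      (\<integral>\<^sup>+x. f (T x) \<partial>lborel) = ennreal c * (\<integral>\<^sup>+x. f x \<partial>lborel)"
    using nn_integral_lborel_linear[OF T] by metis
  have n: "n \<ge> 2" using dim by (simp add: n_def)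
  note [measurable] = borel_measurable_linear[OF T(1)]
  let ?M = "\<lambda>b::'a. lborel :: real measure"
  let ?E = "\<lambda>y::'a \<Rightarrow> real. \<Sum>b\<in>Basis. y b *\<^sub>R b"
  have E [measurable]: "?E \<in> measurable (PiM Basis ?M) borel" by measurable
  have E_upd: "?E (y(b := t)) = ?E y + (t - y b) *\<^sub>R b" if b: "b \<in> Basis" for y b t
    by (subst (1 2) sum.remove[OF finite_Basis b]) (simp add: algebra_simps)
  have int: "(\<integral>\<^sup>+y. f (T (?E y)) \<partial>PiM Basis ?M) = ennreal c * (\<integral>\<^sup>+x. f x \<partial>lborel)"
    if [measurable]: "f \<in> borel_measurable borel" for f
    unfolding c(2)[OF that, symmetric] by (subst lborel_eq, subst nn_integral_distr) auto
  interpret product_sigma_finite ?M by standard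
  let ?p = "1 / (n - 1)"
  have "(\<integral>\<^sup>+x. f x epowr (n / (n - 1)) \<partial>lborel)
        \<le> ennreal (c powr ?p) * (\<Prod>b\<in>Basis. (\<integral>\<^sup>+x. H b x \<partial>lborel) epowr ?p)"
    if [measurable]: "f \<in> borel_measurable borel" "\<And>b. b \<in> Basis \<Longrightarrow> H b \<in> borel_measurable borel"
    and ae: "AE x in lborel. \<forall>b\<in>Basis. f x \<le> (\<integral>\<^sup>+t. H b (x + t *\<^sub>R T b) \<partial>lborel)" for f H
  proof -
    let ?\<Pi> = "\<Prod>b\<in>Basis. (\<integral>\<^sup>+x. H b x \<partial>lborel) epowr ?p"
    let ?H = "\<lambda>b y. H b (T (?E y))"
    have line: "(\<integral>\<^sup>+t. H b (T (?E y) + t *\<^sub>R T b) \<partial>lborel) = (\<integral>\<^sup>+t. ?H b (y(b := t)) \<partial>lborel)"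
      if b: "b \<in> Basis" for b y
    proof -
      note [measurable] = \<open>\<And>b. b \<in> Basis \<Longrightarrow> H b \<in> borel_measurable borel\<close>[OF b]
      have "(\<integral>\<^sup>+t. H b (T (?E y) + t *\<^sub>R T b) \<partial>lborel)
          = (\<integral>\<^sup>+t. H b (T (?E y) + (- y b + t) *\<^sub>R T b) \<partial>lborel)"
        by (subst nn_integral_lborel_translate) auto
      moreover have "T (?E (y(b := t))) = T (?E y) + (- y b + t) *\<^sub>R T b" for t
        unfolding E_upd[OF b] by (simp add: linear_add[OF T(1)] linear_scale[OF T(1)])
      ultimately show ?thesis by simp
    qed
    have "AE x in lborel. \<forall>b\<in>Basis. f (T x) \<le> (\<integral>\<^sup>+t. H b (T x + t *\<^sub>R T b) \<partial>lborel)"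
      by (rule AE_lborel_linear[OF T ae])
    then have ae': "AE y in PiM Basis ?M. \<forall>b\<in>Basis. f (T (?E y)) \<le> (\<integral>\<^sup>+t. ?H b (y(b := t)) \<partial>lborel)"
      by (subst (asm) lborel_eq) (drule AE_distrD[OF E], simp add: line)
    have "ennreal c * (\<integral>\<^sup>+x. f x epowr (n / (n - 1)) \<partial>lborel)
        = (\<integral>\<^sup>+y. f (T (?E y)) epowr (n * ?p) \<partial>PiM Basis ?M)"
      by (subst int) simp_all
    also have "\<dots> \<le> (\<integral>\<^sup>+y. (\<Prod>b\<in>Basis. (if b \<in> Basis then \<integral>\<^sup>+t. ?H b (y(b := t)) \<partial>lborel else ?H b y)
        epowr (1 / (real (card (Basis :: 'a set)) - 1))) \<partial>PiM Basis ?M)"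
    proof (rule nn_integral_mono_AE, use ae' in \<open>rule eventually_mono\<close>)
      fix y assume y: "\<forall>b\<in>Basis. f (T (?E y)) \<le> (\<integral>\<^sup>+t. ?H b (y(b := t)) \<partial>lborel)"
      have "z epowr (n * ?p) = (\<Prod>b\<in>(Basis::'a set). z epowr ?p)" for z
        using prod_epowr_const[of "Basis :: 'a set" z ?p] by (simp add: n_def)
      then show "f (T (?E y)) epowr (n * ?p) \<le>
         (\<Prod>b\<in>Basis. (if b \<in> Basis then \<integral>\<^sup>+t. ?H b (y(b := t)) \<partial>lborel else ?H b y)
        epowr (1 / (real (card (Basis :: 'a set)) - 1)))"
        using y n unfolding n_def[symmetric]
        by (simp del: prod_constant fun_upd_apply) (auto intro!: prod_mono_ennreal epowr_mono simp del: prod_constant fun_upd_apply)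
    qed
    also have "\<dots> \<le> (\<Prod>b\<in>Basis. (\<integral>\<^sup>+y. ?H b y \<partial>PiM Basis ?M) epowr ?p)"
      unfolding n_def using dim
      by (intro nn_integral_prod_partial_integrals_le) (auto intro: product_sigma_finite_axioms)
    also have "\<dots> = (\<Prod>b\<in>Basis. (ennreal c * (\<integral>\<^sup>+x. H b x \<partial>lborel)) epowr ?p)"
      by (intro prod.cong) (auto simp: int that)
    also have "\<dots> = ennreal c * (ennreal (c powr ?p) * ?\<Pi>)"
    proof -
      have "(\<Prod>b\<in>Basis. (ennreal c * (\<integral>\<^sup>+x. H b x \<partial>lborel)) epowr ?p)
          = ennreal ((c powr ?p) ^ DIM('a)) * ?\<Pi>"
        using n c(1) by (simp add: epowr_mult prod.distrib ennreal_power)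
      also have "(c powr ?p) ^ DIM('a) = c powr (n * ?p)"
        using c(1) by (simp add: n_def powr_powr flip: powr_realpow)
      also have "n * ?p = 1 + ?p"
        using n by (simp add: field_simps)
      also have "c powr (1 + ?p) = c * c powr ?p"
        using c(1) by (simp add: powr_add)
      finally show ?thesis using c(1) by (simp add: ennreal_mult mult.assoc)
    qed
    finally show ?thesis
      using c(1) by (simp add: ennreal_mult_le_mult_iff)
  qed
  then show ?thesis
    using c(1) by (intro exI[of _ "c powr ?p"]) auto
qed

section \<open>Weak gradients along segments\<close>

lemma test_function_derivative:
  assumes "test_function U \<psi>"
  shows "(\<psi> has_derivative frechet_derivative \<psi> (at x)) (at x)"
  using assms by (auto simp: test_function_def C_infinity_def frechet_derivative_works dest: spec[of _ 1])

lemma test_function_derivative_expand: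
  fixes \<psi> :: "'a::euclidean_space \<Rightarrow> real"
  assumes "test_function U \<psi>"
  shows "frechet_derivative \<psi> (at x) e = (\<Sum>b\<in>Basis. (e \<bullet> b) * frechet_derivative \<psi> (at x) b)"
proof -
  have lin: "linear (frechet_derivative \<psi> (at x))"
    using test_function_derivative[OF assms] by (rule has_derivative_linear)
  have "frechet_derivative \<psi> (at x) (\<Sum>b\<in>Basis. (e \<bullet> b) *\<^sub>R b)
      = (\<Sum>b\<in>Basis. (e \<bullet> b) * frechet_derivative \<psi> (at x) b)"
    by (simp add: linear_sum[OF lin] linear_scale[OF lin])
  then show ?thesis by (simp add: euclidean_representation)
qed

lemma test_function_derivative_continuous:
  fixes \<psi> :: "'a::euclidean_space \<Rightarrow> real"
  assumes "test_function U \<psi>"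
  shows "continuous_on UNIV (\<lambda>x. frechet_derivative \<psi> (at x) e)"
proof -
  have C1: "C_k 1 \<psi>" using assms by (simp add: test_function_def C_infinity_def)
  have "continuous_on UNIV (\<lambda>x. \<Sum>b\<in>Basis. (e \<bullet> b) * frechet_derivative \<psi> (at x) b)"
    using C1 by (intro continuous_intros) simp
  then show ?thesis by (simp only: test_function_derivative_expand[OF assms, of _ e])
qed

lemma bounded_if_compact_support:
  fixes f :: "'a::topological_space \<Rightarrow> real"
  assumes "continuous_on UNIV f" "compact K" "\<And>x. x \<notin> K \<Longrightarrow> f x = 0"
  obtains B where "B \<ge> 0" "\<And>x. \<bar>f x\<bar> \<le> B"
proof -
  have "bounded (f ` K)"
    using assms(1,2) by (intro compact_imp_bounded compact_continuous_image) (auto intro: continuous_on_subset)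
  then obtain B where B: "\<And>x. x \<in> K \<Longrightarrow> \<bar>f x\<bar> \<le> B" by (auto simp: bounded_iff)
  have "\<bar>f x\<bar> \<le> max B 0" for x
    using B[of x] assms(3)[of x] by (cases "x \<in> K") auto
  then show thesis by (intro that[of "max B 0"]) auto
qed

lemma test_function_bounded:
  fixes \<psi> :: "'a::euclidean_space \<Rightarrow> real"
  assumes "test_function U \<psi>"
  shows "continuous_on UNIV \<psi>" "\<exists>B\<ge>0. \<forall>x. \<bar>\<psi> x\<bar> \<le> B"
    "\<exists>B\<ge>0. \<forall>x. \<bar>frechet_derivative \<psi> (at x) e\<bar> \<le> B"
proof -
  let ?K = "closure {x. \<psi> x \<noteq> 0}"
  have K: "compact ?K" using assms by (simp add: test_function_def)
  show c: "continuous_on UNIV \<psi>"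
    using assms by (auto simp: test_function_def C_infinity_def dest: spec[of _ 0])
  have "\<psi> x = 0" if "x \<notin> ?K" for x using that closure_subset[of "{x. \<psi> x \<noteq> 0}"] by auto
  then show "\<exists>B\<ge>0. \<forall>x. \<bar>\<psi> x\<bar> \<le> B"
    using bounded_if_compact_support[OF c K] by metis
  have "frechet_derivative \<psi> (at x) e = 0" if x: "x \<notin> ?K" for x
  proof -
    have "(\<psi> has_derivative (\<lambda>h. 0)) (at x)"
    proof (rule has_derivative_transform_within_open[of "\<lambda>x. 0"])
      show "open (- ?K)" by (rule open_Compl[OF closed_closure])
      show "0 = \<psi> y" if "y \<in> - ?K" for y
        using that closure_subset[of "{x. \<psi> x \<noteq> 0}"] by auto
    qed (use x in auto)
    from frechet_derivative_at[OF this] show ?thesis by metis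
  qed
  then show "\<exists>B\<ge>0. \<forall>x. \<bar>frechet_derivative \<psi> (at x) e\<bar> \<le> B"
    using bounded_if_compact_support[OF test_function_derivative_continuous[OF assms] K] by metis
qed

lemma integral_lborel_translate:
  fixes f :: "'a::euclidean_space \<Rightarrow> real"
  assumes "f \<in> borel_measurable borel"
  shows "(LINT x|lborel. f (x + c)) = (LINT x|lborel. f x)"
  using integral_distr[of "(+) c" lborel borel f] assms by (simp add: lborel_distr_plus add.commute)

lemma integrable_lborel_translate:
  fixes f :: "'a::euclidean_space \<Rightarrow> real"
  assumes "integrable lborel f"
  shows "integrable lborel (\<lambda>x. f (x + c))"
  using integrable_distr[of "(+) c" lborel borel f] assms by (simp add: lborel_distr_plus add.commute)

text \<open>The integrability that justifies each exchange of the integral over a segment with the integral over the space. The bounded weight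
  is 1, a test function or a translated derivative of one; \<open>e = 0\<close> covers the case in which \<open>k\<close> itself is not translated.\<close>

lemma integrable_along_segments:
  fixes k :: "'a::euclidean_space \<Rightarrow> real" and w :: "'a \<times> real \<Rightarrow> real"
  assumes k: "integrable lborel k" and [measurable]: "w \<in> borel_measurable borel"
    and w: "\<And>p. \<bar>w p\<bar> \<le> B"
  shows "integrable (lborel \<Otimes>\<^sub>M lborel) (\<lambda>(x, s). indicator {0..t} s * (k (x + s *\<^sub>R e) * w (x, s)))"
proof (rule integrableI_bounded)
  have [measurable]: "k \<in> borel_measurable borel" using k by auto
  have [measurable]: "w \<in> borel_measurable (borel \<Otimes>\<^sub>M borel)"
    using \<open>w \<in> borel_measurable borel\<close> by (simp add: borel_prod)
  show "(\<lambda>(x, s). indicator {0..t} s * (k (x + s *\<^sub>R e) * w (x, s))) \<in> borel_measurable (lborel \<Otimes>\<^sub>M lborel)"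
    by measurable
  have B: "B \<ge> 0" using w abs_ge_zero order.trans by blast
  have "(\<integral>\<^sup>+p. ennreal (norm (case p of (x, s) \<Rightarrow> indicator {0..t} s * (k (x + s *\<^sub>R e) * w (x, s)))) \<partial>(lborel \<Otimes>\<^sub>M lborel))
    \<le> (\<integral>\<^sup>+p. (case p of (x, s) \<Rightarrow> ennreal B * indicator {0..t} s * ennreal \<bar>k (x + s *\<^sub>R e)\<bar>) \<partial>(lborel \<Otimes>\<^sub>M lborel))"
    using w B by (intro nn_integral_mono)
      (auto simp: abs_mult mult.commute ennreal_mult[symmetric] intro!: ennreal_leI mult_right_mono split: split_indicator)
  also have "\<dots> = (\<integral>\<^sup>+s. \<integral>\<^sup>+x. ennreal B * indicator {0..t} s * ennreal \<bar>k (x + s *\<^sub>R e)\<bar> \<partial>lborel \<partial>lborel)"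
    by (subst lborel_pair.nn_integral_snd[symmetric]) auto
  also have "\<dots> = (\<integral>\<^sup>+s. ennreal B * indicator {0..t} s * (\<integral>\<^sup>+x. ennreal \<bar>k x\<bar> \<partial>lborel) \<partial>lborel)"
  proof -
    have "(\<integral>\<^sup>+x. ennreal \<bar>k (x + c)\<bar> \<partial>lborel) = (\<integral>\<^sup>+x. ennreal \<bar>k x\<bar> \<partial>lborel)" for c
      by (subst add.commute) (rule nn_integral_lborel_translate, simp)
    then show ?thesis
      by (intro nn_integral_cong, subst nn_integral_cmult) auto
  qed
  also have "\<dots> = ennreal B * emeasure lborel {0..t} * (\<integral>\<^sup>+x. ennreal \<bar>k x\<bar> \<partial>lborel)"
    by (simp add: nn_integral_multc nn_integral_cmult)
  also have "\<dots> < \<infinity>"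
    using k by (simp add: integrable_iff_bounded ennreal_mult_less_top emeasure_lborel_Icc_eq)
  finally show "(\<integral>\<^sup>+p. ennreal (norm (case p of (x, s) \<Rightarrow> indicator {0..t} s * (k (x + s *\<^sub>R e) * w (x, s)))) \<partial>(lborel \<Otimes>\<^sub>M lborel)) < \<infinity>" .
qed

lemma integrable_mult_bounded:
  fixes f w :: "'a \<Rightarrow> real"
  assumes f: "integrable M f" and [measurable]: "w \<in> borel_measurable M" and w: "\<And>x. \<bar>w x\<bar> \<le> B"
  shows "integrable M (\<lambda>x. f x * w x)"
proof (rule Bochner_Integration.integrable_bound[of _ "\<lambda>x. B * f x"])
  have "B \<ge> 0" using w abs_ge_zero order.trans by blast
  then show "AE x in M. norm (f x * w x) \<le> norm (B * f x)"
    using w by (intro AE_I2) (auto simp: abs_mult mult.commute[of B] intro!: mult_left_mono)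
qed (use f in auto)

text \<open>A weak gradient on \<open>U\<close>, with representatives that are integrable on the whole space, so that Fubini's theorem applies
  to translations without reference to the domain.\<close>

definition integrable_weak_gradient ::
    "'a::euclidean_space set \<Rightarrow> ('a \<Rightarrow> real) \<Rightarrow> ('a \<Rightarrow> 'a) \<Rightarrow> bool" where
  "integrable_weak_gradient U u g \<longleftrightarrow> integrable lborel u \<and> integrable lborel g \<and>
     (\<forall>\<psi>. test_function U \<psi> \<longrightarrow> (\<forall>b\<in>Basis.
        (LINT x|lborel. u x * frechet_derivative \<psi> (at x) b) = - (LINT x|lborel. (g x \<bullet> b) * \<psi> x)))"

lemma integrable_weak_gradientD:
  assumes "integrable_weak_gradient U u g"
  shows "integrable lborel u" "integrable lborel g"
  using assms by (simp_all add: integrable_weak_gradient_def)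

lemma weak_gradient_direction:
  fixes U :: "'a::euclidean_space set" and u :: "'a \<Rightarrow> real" and g :: "'a \<Rightarrow> 'a"
  assumes wg: "integrable_weak_gradient U u g"
    and \<psi>: "test_function U \<psi>"
  shows "(LINT x|lborel. u x * frechet_derivative \<psi> (at x) e) = - (LINT x|lborel. (g x \<bullet> e) * \<psi> x)"
proof -
  note u = integrable_weak_gradientD(1)[OF wg] and g = integrable_weak_gradientD(2)[OF wg]
  let ?D = "\<lambda>x. frechet_derivative \<psi> (at x)"
  have ge: "g x \<bullet> e = (\<Sum>b\<in>Basis. (e \<bullet> b) * (g x \<bullet> b))" for x
    by (subst euclidean_inner) (simp add: mult.commute)
  have int_bdd: "integrable lborel (\<lambda>x. f x * w x)"
    if f: "integrable lborel f" and c: "continuous_on UNIV w" and bd: "\<exists>B\<ge>0. \<forall>x. \<bar>w x\<bar> \<le> B"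
    for f w :: "'a \<Rightarrow> real"
  proof -
    obtain B where "\<And>x. \<bar>w x\<bar> \<le> B" using bd by metis
    then show ?thesis
      using f borel_measurable_continuous_onI[OF c] by (intro integrable_mult_bounded) auto
  qed
  have "(LINT x|lborel. u x * ?D x e) = (LINT x|lborel. (\<Sum>b\<in>Basis. (e \<bullet> b) * (u x * ?D x b)))"
    by (simp add: test_function_derivative_expand[OF \<psi>, of _ e] sum_distrib_left mult.left_commute)
  also have "\<dots> = (\<Sum>b\<in>Basis. (e \<bullet> b) * (LINT x|lborel. u x * ?D x b))"
    using u test_function_derivative_continuous[OF \<psi>] test_function_bounded(3)[OF \<psi>]
    by (subst Bochner_Integration.integral_sum) (auto intro!: int_bdd)
  also have "\<dots> = - (\<Sum>b\<in>Basis. (e \<bullet> b) * (LINT x|lborel. (g x \<bullet> b) * \<psi> x))"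
    using wg \<psi> by (simp add: integrable_weak_gradient_def sum_negf)
  also have "\<dots> = - (LINT x|lborel. (\<Sum>b\<in>Basis. (e \<bullet> b) * ((g x \<bullet> b) * \<psi> x)))"
    using g test_function_bounded(1,2)[OF \<psi>]
    by (subst Bochner_Integration.integral_sum) (auto intro!: int_bdd)
  also have "\<dots> = - (LINT x|lborel. (g x \<bullet> e) * \<psi> x)"
    by (simp add: ge sum_distrib_right mult.assoc)
  finally show ?thesis .
qed

text \<open>For a test function \<open>\<psi>\<close> on \<open>V\<close>, all translates of \<open>\<psi>\<close> by \<open>s e\<close> with \<open>0 \<le> s \<le> t\<close> are test functions on \<open>U\<close>. The
  fundamental theorem of calculus, applied to \<open>s \<mapsto> \<psi>(y - s e)\<close>, and the definition of the weak gradient therefore show that both sides have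
  the same integral against \<open>\<psi>\<close>.\<close>

lemma weak_gradient_increment:
  fixes U :: "'a::euclidean_space set" and u :: "'a \<Rightarrow> real" and g :: "'a \<Rightarrow> 'a"
  assumes wg: "integrable_weak_gradient U u g"
    and V: "open V" and t: "t \<ge> 0" and seg: "\<And>x s. x \<in> V \<Longrightarrow> s \<in> {0..t} \<Longrightarrow> x + s *\<^sub>R e \<in> U"
  shows "AE x in lborel. x \<in> V \<longrightarrow>
    u (x + t *\<^sub>R e) - u x = (LINT s|lborel. indicator {0..t} s * (g (x + s *\<^sub>R e) \<bullet> e))"
proof -
  note u = integrable_weak_gradientD(1)[OF wg] and g = integrable_weak_gradientD(2)[OF wg]
  have [measurable]: "u \<in> borel_measurable borel" "g \<in> borel_measurable borel"
    using u g by auto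
  have ge: "integrable lborel (\<lambda>x. g x \<bullet> e)" using g by simp
  define G where "G = (\<lambda>x. LINT s|lborel. indicator {0..t} s * (g (x + s *\<^sub>R e) \<bullet> e))"
  have G: "integrable lborel G"
    using lborel_pair.integrable_fst'[OF integrable_along_segments[OF ge, of "\<lambda>_. 1" 1 t e]]
    by (simp add: G_def)
  let ?f = "\<lambda>x. u (x + t *\<^sub>R e) - u x - G x"
  have "AE x in lborel. x \<in> V \<longrightarrow> ?f x = 0"
  proof (rule fundamental_lemma_of_variations[OF _ V])
    show "integrable lborel ?f"
      using u G integrable_lborel_translate[OF u] by (intro Bochner_Integration.integrable_diff)
  next
    fix \<psi> assume \<psi>: "test_function V \<psi>"
    let ?D = "\<lambda>x. frechet_derivative \<psi> (at x)"
    have c\<psi> [measurable]: "\<psi> \<in> borel_measurable borel"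
      using test_function_bounded(1)[OF \<psi>] by (rule borel_measurable_continuous_onI)
    have cD [measurable]: "(\<lambda>x. ?D x e) \<in> borel_measurable borel"
      using test_function_derivative_continuous[OF \<psi>] by (rule borel_measurable_continuous_onI)
    obtain B1 where B1: "\<And>x. \<bar>\<psi> x\<bar> \<le> B1" using test_function_bounded(2)[OF \<psi>] by metis
    obtain B2 where B2: "\<And>x. \<bar>?D x e\<bar> \<le> B2" using test_function_bounded(3)[OF \<psi>, of e] by metis
    have shifted: "test_function U (\<lambda>x. \<psi> (x - s *\<^sub>R e))" if "s \<in> {0..t}" for s
      using \<psi> that seg by (intro test_function_translate) auto
    have FTC: "\<psi> (y - t *\<^sub>R e) - \<psi> y = - (LINT s|lborel. indicator {0..t} s * ?D (y - s *\<^sub>R e) e)" for y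
    proof -
      have d: "((\<lambda>s. \<psi> (y - s *\<^sub>R e)) has_real_derivative - ?D (y - s *\<^sub>R e) e) (at s)" for s
      proof -
        have lin: "linear (?D (y - s *\<^sub>R e))"
          using test_function_derivative[OF \<psi>] by (rule has_derivative_linear)
        have "((\<lambda>s. y - s *\<^sub>R e) has_derivative (\<lambda>h. - (h *\<^sub>R e))) (at s)"
          by (auto intro!: derivative_eq_intros)
        from has_derivative_compose[OF this test_function_derivative[OF \<psi>]] show ?thesis
          unfolding has_field_derivative_def
          by (rule has_derivative_eq_rhs) (simp add: linear_neg[OF lin] linear_scale[OF lin] fun_eq_iff)
      qed
      have "continuous_on UNIV (\<lambda>s. ?D (y - s *\<^sub>R e) e)"
        by (intro continuous_on_compose2[OF test_function_derivative_continuous[OF \<psi>]] continuous_intros) auto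
      then have "isCont (\<lambda>s. - ?D (y - s *\<^sub>R e) e) s" for s
        by (simp add: continuous_on_eq_continuous_at continuous_minus)
      then have "(LINT s|lborel. - ?D (y - s *\<^sub>R e) e * indicator {0..t} s) = \<psi> (y - t *\<^sub>R e) - \<psi> (y - 0 *\<^sub>R e)"
        using t d by (intro integral_FTC_Icc_real) auto
      then show ?thesis by (simp add: mult.commute)
    qed
    let ?a = "\<lambda>s y. indicator {0..t} s * (u y * ?D (y - s *\<^sub>R e) e)"
      and ?b = "\<lambda>s x. indicator {0..t} s * ((g (x + s *\<^sub>R e) \<bullet> e) * \<psi> x)"
    have i1: "integrable lborel (\<lambda>x. u x * \<psi> (x - t *\<^sub>R e))" "integrable lborel (\<lambda>x. u x * \<psi> x)"
      using u B1 by (auto intro!: integrable_mult_bounded)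
    have i2: "integrable lborel (\<lambda>x. u (x + t *\<^sub>R e) * \<psi> x)" "integrable lborel (\<lambda>x. G x * \<psi> x)"
      using integrable_lborel_translate[OF u] G B1 by (auto intro!: integrable_mult_bounded)
    have "(LINT x|lborel. u (x + t *\<^sub>R e) * \<psi> x) - (LINT x|lborel. u x * \<psi> x)
        = (LINT y|lborel. u y * \<psi> (y - t *\<^sub>R e)) - (LINT x|lborel. u x * \<psi> x)"
      using integral_lborel_translate[of "\<lambda>y. u y * \<psi> (y - t *\<^sub>R e)" "t *\<^sub>R e"] by simp
    also have "\<dots> = (LINT y|lborel. u y * (\<psi> (y - t *\<^sub>R e) - \<psi> y))"
      using i1 by (simp add: right_diff_distrib)
    also have "\<dots> = - (LINT y|lborel. LINT s|lborel. ?a s y)"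
      unfolding FTC by (simp add: mult.left_commute)
    also have "\<dots> = - (LINT s|lborel. LINT y|lborel. ?a s y)"
    proof -
      have "continuous_on UNIV (\<lambda>p :: 'a \<times> real. ?D (fst p - snd p *\<^sub>R e) e)"
        by (intro continuous_on_compose2[OF test_function_derivative_continuous[OF \<psi>]] continuous_intros) auto
      then have "(\<lambda>p. ?D (fst p - snd p *\<^sub>R e) e) \<in> borel_measurable borel"
        by (rule borel_measurable_continuous_onI)
      from integrable_along_segments[OF u this, of B2 t 0] B2 show ?thesis
        by (intro arg_cong[where f=uminus] lborel_pair.Fubini_integral[symmetric]) (simp add: split_beta')
    qed
    also have "\<dots> = - (LINT s|lborel. indicator {0..t} s * (LINT y|lborel. u y * ?D (y - s *\<^sub>R e) e))"
      by simp
    \<comment> \<open>The weak gradient is tested with the translate of \<open>\<psi>\<close> by \<open>s e\<close>.\<close>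
    also have "\<dots> = - (LINT s|lborel. indicator {0..t} s * - (LINT x|lborel. (g (x + s *\<^sub>R e) \<bullet> e) * \<psi> x))"
    proof -
      have "(LINT y|lborel. u y * ?D (y - s *\<^sub>R e) e) = - (LINT x|lborel. (g (x + s *\<^sub>R e) \<bullet> e) * \<psi> x)"
        if s: "s \<in> {0..t}" for s
        using weak_gradient_direction[OF wg shifted[OF s], of e]
          integral_lborel_translate[of "\<lambda>x. (g x \<bullet> e) * \<psi> (x - s *\<^sub>R e)" "s *\<^sub>R e"]
        by (simp add: frechet_derivative_translate[OF test_function_derivative[OF \<psi>]])
      then show ?thesis
        by (intro arg_cong[where f=uminus] Bochner_Integration.integral_cong) (auto split: split_indicator)
    qed
    also have "\<dots> = (LINT s|lborel. LINT x|lborel. ?b s x)"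
      by simp
    also have "\<dots> = (LINT x|lborel. LINT s|lborel. ?b s x)"
    proof -
      have "(\<lambda>p :: 'a \<times> real. \<psi> (fst p)) \<in> borel_measurable (borel \<Otimes>\<^sub>M borel)"
        by measurable
      from integrable_along_segments[OF ge this[unfolded borel_prod], of B1 t e] B1 show ?thesis
        by (intro lborel_pair.Fubini_integral) (simp add: split_beta')
    qed
    also have "\<dots> = (LINT x|lborel. G x * \<psi> x)"
      by (simp add: G_def mult.assoc[symmetric])
    finally show "(LINT x|lborel. ?f x * \<psi> x) = 0"
      using i1 i2 by (simp add: left_diff_distrib)
  qed
  then show ?thesis
    by (elim eventually_mono) (simp add: G_def)
qed

lemma indefinite_integral_isCont:
  fixes \<gamma> :: "real \<Rightarrow> real"
  assumes \<gamma>: "integrable lborel \<gamma>"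
  shows "isCont (\<lambda>t. LINT s|lborel. indicator {..t} s * \<gamma> s) t"
  unfolding continuous_at_sequentially o_def
proof (intro allI impI)
  fix X :: "nat \<Rightarrow> real" assume X: "X \<longlonglongrightarrow> t"
  have [measurable]: "\<gamma> \<in> borel_measurable borel" using \<gamma> by auto
  show "(\<lambda>k. LINT s|lborel. indicator {..X k} s * \<gamma> s) \<longlonglongrightarrow> (LINT s|lborel. indicator {..t} s * \<gamma> s)"
  proof (rule integral_dominated_convergence[where w="\<lambda>s. \<bar>\<gamma> s\<bar>"])
    show "AE s in lborel. (\<lambda>k. indicator {..X k} s * \<gamma> s) \<longlonglongrightarrow> indicator {..t} s * \<gamma> s"
      using AE_lborel_singleton[of t]
    proof (rule eventually_mono)
      fix s assume "s \<noteq> t"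
      then have "\<forall>\<^sub>F k in sequentially. (s \<le> X k) = (s \<le> t)"
        using order_tendstoD[OF X, of s] by (cases "s < t") (auto elim!: eventually_mono)
      then have "\<forall>\<^sub>F k in sequentially. indicator {..X k} s * \<gamma> s = indicator {..t} s * \<gamma> s"
        by (rule eventually_mono) (simp add: indicator_def)
      then show "(\<lambda>k. indicator {..X k} s * \<gamma> s) \<longlonglongrightarrow> indicator {..t} s * \<gamma> s"
        by (rule tendsto_eventually)
    qed
  qed (use \<gamma> in \<open>auto intro!: AE_I2 split: split_indicator\<close>)
qed

text \<open>\<open>L\<close> plays the part of \<open>|F'|\<close>. For truncated powers \<open>F\<close> has corners, but its increments are still controlled by a continuous \<open>L\<close>.\<close>

definition slope_dominated :: "(real \<Rightarrow> real) \<Rightarrow> (real \<Rightarrow> real) \<Rightarrow> bool" where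
  "slope_dominated F L \<longleftrightarrow> continuous_on UNIV L \<and> (\<forall>x. L x \<ge> 0) \<and>
     F \<in> borel_measurable borel \<and> (\<forall>x. F x \<ge> 0) \<and>
     (\<forall>a b. \<bar>F b - F a\<bar> \<le> max (L a) (L b) * \<bar>b - a\<bar>)"

lemma slope_dominatedD:
  assumes "slope_dominated F L"
  shows "continuous_on UNIV L" "L x \<ge> 0" "F \<in> borel_measurable borel" "F x \<ge> 0"
    "\<bar>F b - F a\<bar> \<le> max (L a) (L b) * \<bar>b - a\<bar>"
  using assms by (simp_all add: slope_dominated_def)

text \<open>The chain rule \<open>|(F \<circ> v)'| \<le> L(v) |\<gamma>|\<close> in integrated form. For \<open>L(v)\<close> enlarged by \<open>\<delta> > 0\<close> the estimate holds on all short
  intervals by continuity, and it is additive in the interval; Bolzano's principle extends it to every interval.\<close>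

lemma indefinite_integral_chain_estimate:
  fixes F L \<gamma> :: "real \<Rightarrow> real" and c :: real
  assumes \<gamma>: "integrable lborel \<gamma>"
    and FL': "slope_dominated F L" and "a \<le> b"
  defines "v \<equiv> \<lambda>t. c + (LINT s|lborel. indicator {..t} s * \<gamma> s)"
  shows "ennreal \<bar>F (v b) - F (v a)\<bar> \<le> (\<integral>\<^sup>+s. indicator {a<..b} s * ennreal (L (v s) * \<bar>\<gamma> s\<bar>) \<partial>lborel)"
proof -
  note L = slope_dominatedD(1,2)[OF FL'] and FL = slope_dominatedD(5)[OF FL']
  have [measurable]: "\<gamma> \<in> borel_measurable borel" using \<gamma> by auto
  have cv: "isCont v t" for t
    unfolding v_def by (intro continuous_intros indefinite_integral_isCont[OF \<gamma>])
  have cLv: "isCont (\<lambda>s. L (v s)) t" for t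
    using L(1) by (intro isCont_o2[OF cv]) (auto simp: continuous_on_eq_continuous_at)
  have [measurable]: "(\<lambda>s. L (v s)) \<in> borel_measurable borel"
    using cLv by (intro borel_measurable_continuous_onI) (simp add: continuous_on_eq_continuous_at)
  have fin: "(\<integral>\<^sup>+s. ennreal \<bar>\<gamma> s\<bar> \<partial>lborel) < top"
    using \<gamma> by (simp add: integrable_iff_bounded)
  have v_diff: "\<bar>v t - v s\<bar> \<le> (LINT r|lborel. indicator {s<..t} r * \<bar>\<gamma> r\<bar>)" if "s \<le> t" for s t
  proof -
    have i: "integrable lborel (\<lambda>r. indicator A r * \<gamma> r)" if "A \<in> sets borel" for A
      using integrable_mult_indicator[OF _ \<gamma>, of A] that by simp
    have "v t - v s = (LINT r|lborel. indicator {..t} r * \<gamma> r - indicator {..s} r * \<gamma> r)"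
      unfolding v_def using i by simp
    also have "\<dots> = (LINT r|lborel. indicator {s<..t} r * \<gamma> r)"
      using that by (intro Bochner_Integration.integral_cong) (auto split: split_indicator)
    also have "\<bar>\<dots>\<bar> \<le> (LINT r|lborel. \<bar>indicator {s<..t} r * \<gamma> r\<bar>)"
      by (rule integral_abs_bound)
    finally show ?thesis by (simp add: abs_mult)
  qed
  let ?R = "\<lambda>\<delta> a b. \<integral>\<^sup>+s. indicator {a<..b} s * ennreal ((L (v s) + \<delta>) * \<bar>\<gamma> s\<bar>) \<partial>lborel"
  have step: "ennreal \<bar>F (v b) - F (v a)\<bar>  \<le> ?R \<delta> a b" if \<delta>: "\<delta> > 0" for \<delta>
    using \<open>a \<le> b\<close>
  proof (induction rule: Bolzano)
    case (trans a b c)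
    have "ennreal \<bar>F (v c) - F (v a)\<bar> \<le> ennreal (\<bar>F (v b) - F (v a)\<bar> + \<bar>F (v c) - F (v b)\<bar>)"
      by (intro ennreal_leI) auto
    also have "\<dots> = ennreal \<bar>F (v b) - F (v a)\<bar> + ennreal \<bar>F (v c) - F (v b)\<bar>"
      by (rule ennreal_plus) auto
    also have "\<dots> \<le> (\<integral>\<^sup>+s. indicator {a<..b} s * ennreal ((L (v s) + \<delta>) * \<bar>\<gamma> s\<bar>)
        + indicator {b<..c} s * ennreal ((L (v s) + \<delta>) * \<bar>\<gamma> s\<bar>) \<partial>lborel)"
      using trans by (subst nn_integral_add) (auto intro: add_mono)
    also have "\<dots> = ?R \<delta> a c"
      using trans by (intro nn_integral_cong) (auto split: split_indicator)
    finally show ?case .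
  next
    case (local x)
    have "\<delta> / 2 > 0" using \<delta> by simp
    then obtain d where d: "d > 0" "\<And>y. \<bar>y - x\<bar> < d \<Longrightarrow> \<bar>L (v y) - L (v x)\<bar> < \<delta> / 2"
      using cLv[of x] unfolding continuous_at_eps_delta by (metis dist_real_def)
    have "ennreal \<bar>F (v b) - F (v a)\<bar>  \<le> ?R \<delta> a b"
      if ab: "a \<le> x" "x \<le> b" "b - a < d" for a b
    proof -
      define l where "l = L (v x) + \<delta> / 2"
      have l: "l \<ge> 0" using L(2) \<delta> by (simp add: l_def)
      have ends: "max (L (v a)) (L (v b)) \<le> l"
      proof (rule max.boundedI)
        have "\<bar>L (v a) - L (v x)\<bar> < \<delta> / 2" "\<bar>L (v b) - L (v x)\<bar> < \<delta> / 2"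
          using ab by (intro d(2); simp)+
        then show "L (v a) \<le> l" "L (v b) \<le> l" unfolding l_def by linarith+
      qed
      have "\<bar>F (v b) - F (v a)\<bar> \<le> l * (LINT r|lborel. indicator {a<..b} r * \<bar>\<gamma> r\<bar>)"
        using FL[of "v b" "v a"] ends l v_diff[of a b] ab by (intro order.trans[OF FL] mult_mono) auto
      also have "\<dots> = (LINT r|lborel. l * (indicator {a<..b} r * \<bar>\<gamma> r\<bar>))" by simp
      finally have "ennreal \<bar>F (v b) - F (v a)\<bar> \<le> ennreal \<dots>"
        by (rule ennreal_leI)
      also have "\<dots> = (\<integral>\<^sup>+r. ennreal (l * (indicator {a<..b} r * \<bar>\<gamma> r\<bar>)) \<partial>lborel)"
        using l integrable_mult_indicator[OF _ integrable_abs[OF \<gamma>], of "{a<..b}"]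
        by (intro nn_integral_eq_integral[symmetric]) auto
      also have "\<dots> \<le> ?R \<delta> a b"
      proof (intro nn_integral_mono)
        fix s
        show "ennreal (l * (indicator {a<..b} s * \<bar>\<gamma> s\<bar>)) \<le> indicator {a<..b} s * ennreal ((L (v s) + \<delta>) * \<bar>\<gamma> s\<bar>)"
        proof (cases "s \<in> {a<..b}")
          case True
          then have "\<bar>L (v s) - L (v x)\<bar> < \<delta> / 2" using ab by (intro d(2)) auto
          then have "l \<le> L (v s) + \<delta>" unfolding l_def by linarith
          then show ?thesis using True by (auto intro!: ennreal_leI mult_right_mono)
        qed simp
      qed
      finally show ?thesis .
    qed
    then show ?case using d(1) by blast
  qed
  let ?I = "\<integral>\<^sup>+s. ennreal \<bar>\<gamma> s\<bar> \<partial>lborel"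
  obtain I where I: "?I = ennreal I" "I \<ge> 0" using fin by (cases ?I) auto
  show ?thesis
  proof (rule ennreal_le_epsilon)
    fix \<eta> :: real assume \<eta>: "\<eta> > 0"
    define \<delta> where "\<delta> = \<eta> / (I + 1)"
    have \<delta>: "\<delta> > 0" "\<delta> * I \<le> \<eta>" using \<eta> I(2) by (auto simp: \<delta>_def field_simps)
    have "ennreal \<bar>F (v b) - F (v a)\<bar>
      \<le> (\<integral>\<^sup>+s. indicator {a<..b} s * ennreal (L (v s) * \<bar>\<gamma> s\<bar>) + ennreal \<delta> * ennreal \<bar>\<gamma> s\<bar> \<partial>lborel)"
      using L(2) \<delta>(1)
      by (intro order.trans[OF step[OF \<delta>(1)]] nn_integral_mono)
        (auto simp: algebra_simps ennreal_mult[symmetric] ennreal_plus[symmetric] simp del: ennreal_plus split: split_indicator)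
    also have "\<dots> = (\<integral>\<^sup>+s. indicator {a<..b} s * ennreal (L (v s) * \<bar>\<gamma> s\<bar>) \<partial>lborel) + ennreal (\<delta> * I)"
      using \<delta>(1) I by (simp add: nn_integral_add nn_integral_cmult ennreal_mult)
    also have "\<dots> \<le> (\<integral>\<^sup>+s. indicator {a<..b} s * ennreal (L (v s) * \<bar>\<gamma> s\<bar>) \<partial>lborel) + ennreal \<eta>"
      using \<delta>(2) by (intro add_left_mono ennreal_leI)
    finally show "ennreal \<bar>F (v b) - F (v a)\<bar> \<le> \<dots>" .
  qed
qed

text \<open>The value \<open>F(u x)\<close> is at most \<open>F(u)\<close> at any other point of the segment plus the variation of \<open>F(u)\<close> along it; the average over
  the segment is taken. The increments are known for each \<open>t\<close> and almost every \<open>x\<close>, and Fubini's theorem exchanges the two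
  quantifiers.\<close>

lemma weak_gradient_line_estimate:
  fixes U :: "'a::euclidean_space set" and u :: "'a \<Rightarrow> real" and g :: "'a \<Rightarrow> 'a" and F L :: "real \<Rightarrow> real"
  assumes wg: "integrable_weak_gradient U u g"
    and V: "open V" and h: "h > 0" and seg: "\<And>x s. x \<in> V \<Longrightarrow> s \<in> {0..h} \<Longrightarrow> x + s *\<^sub>R e \<in> U"
    and FL: "slope_dominated F L"
  shows "AE x in lborel. x \<in> V \<longrightarrow> ennreal (F (u x)) \<le>
    (\<integral>\<^sup>+t. indicator {0..h} t * (ennreal (1 / h) * ennreal (F (u (x + t *\<^sub>R e)))
       + ennreal (L (u (x + t *\<^sub>R e)) * \<bar>g (x + t *\<^sub>R e) \<bullet> e\<bar>)) \<partial>lborel)"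
proof -
  note u = integrable_weak_gradientD(1)[OF wg] and g = integrable_weak_gradientD(2)[OF wg]
  note L = slope_dominatedD(1)[OF FL] and F [measurable] = slope_dominatedD(3)[OF FL]
    and F0 = slope_dominatedD(4)[OF FL]
  have [measurable]: "u \<in> borel_measurable borel" "g \<in> borel_measurable borel"
    using u g by auto
  have [measurable]: "L \<in> borel_measurable borel"
    using L by (rule borel_measurable_continuous_onI)
  have [measurable]: "V \<in> sets borel" using V by simp
  let ?\<gamma> = "\<lambda>x s. indicator {0..h} s * (g (x + s *\<^sub>R e) \<bullet> e)"
  let ?v = "\<lambda>x t. u x + (LINT s|lborel. indicator {..t} s * ?\<gamma> x s)"
  let ?P = "\<lambda>x t. x \<in> V \<longrightarrow> t \<in> {0..h} \<longrightarrow> u (x + t *\<^sub>R e) = ?v x t"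
  have "AE x in lborel. ?P x t" for t
  proof (cases "t \<in> {0..h}")
    case True
    have eq: "indicator {..t} s * ?\<gamma> x s = indicator {0..t} s * (g (x + s *\<^sub>R e) \<bullet> e)" for x s
      using True by (auto split: split_indicator)
    have "AE x in lborel. x \<in> V \<longrightarrow>
        u (x + t *\<^sub>R e) - u x = (LINT s|lborel. indicator {0..t} s * (g (x + s *\<^sub>R e) \<bullet> e))"
      using True seg by (intro weak_gradient_increment[OF wg V]) auto
    then show ?thesis
    proof (rule eventually_mono)
      fix x assume *: "x \<in> V \<longrightarrow>
        u (x + t *\<^sub>R e) - u x = (LINT s|lborel. indicator {0..t} s * (g (x + s *\<^sub>R e) \<bullet> e))"
      show "?P x t" unfolding eq using * by (simp add: diff_eq_eq)
    qed
  qed auto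
  then have ae: "AE t in lborel. AE x in lborel. ?P x t" by simp
  have [measurable]: "(\<lambda>p :: 'a \<times> real. LINT s|lborel. indicator {..snd p} s * ?\<gamma> (fst p) s)
      \<in> borel_measurable (borel \<Otimes>\<^sub>M borel)"
  proof -
    have "(\<lambda>p :: 'a \<times> real. LINT s|lborel. (if s \<le> snd p then ?\<gamma> (fst p) s else 0))
        \<in> borel_measurable (borel \<Otimes>\<^sub>M borel)"
      by measurable
    moreover have "(if s \<le> snd p then ?\<gamma> (fst p) s else 0) = indicator {..snd p} s * ?\<gamma> (fst p) s"
      for s and p :: "'a \<times> real"
      by (simp add: indicator_def)
    ultimately show ?thesis by simp
  qed
  have "{p \<in> space ((lborel :: 'a measure) \<Otimes>\<^sub>M (lborel :: real measure)). ?P (fst p) (snd p)}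
      \<in> sets (lborel \<Otimes>\<^sub>M lborel)"
    by measurable
  from lborel_pair.AE_commute[OF this] have increments: "AE x in lborel. AE t in lborel. ?P x t"
    using ae by simp
  have integrable: "AE x in lborel. integrable lborel (?\<gamma> x)"
    using lborel_pair.AE_integrable_fst'[OF integrable_along_segments[of "\<lambda>x. g x \<bullet> e" "\<lambda>_. 1" 1 h e]] g
    by simp
  from increments integrable show ?thesis
  proof eventually_elim
    case (elim x)
    show ?case
    proof
      assume x: "x \<in> V"
      have v: "AE t in lborel. t \<in> {0..h} \<longrightarrow> u (x + t *\<^sub>R e) = ?v x t"
        using elim(1) x by (elim eventually_mono) auto
      let ?f = "\<lambda>t. indicator {0..h} t * ennreal (F (u (x + t *\<^sub>R e)))"
      let ?R = "\<integral>\<^sup>+s. ennreal (L (?v x s) * \<bar>?\<gamma> x s\<bar>) \<partial>lborel"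
      let ?S = "\<integral>\<^sup>+s. indicator {0..h} s * ennreal (L (u (x + s *\<^sub>R e)) * \<bar>g (x + s *\<^sub>R e) \<bullet> e\<bar>) \<partial>lborel"
      have R: "?R = ?S"
        using v by (intro nn_integral_cong_AE) (elim eventually_mono, auto split: split_indicator)
      \<comment> \<open>At \<open>-1\<close> the integral in \<open>v\<close> has not started yet, so the left end of the segment needs no separate limit.\<close>
      have v0: "?v x (-1) = u x"
      proof -
        have "(\<lambda>s. indicator {..-1} s * ?\<gamma> x s) = (\<lambda>s. 0)" by (auto split: split_indicator)
        then show ?thesis by (simp only: Bochner_Integration.integral_zero add_0_right)
      qed
      have "ennreal (F (u x)) \<le> ennreal (F (?v x t)) + ?S" if t: "t \<in> {0..h}" for t
      proof -
        have "ennreal \<bar>F (?v x t) - F (?v x (-1))\<bar>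
            \<le> (\<integral>\<^sup>+s. indicator {-1<..t} s * ennreal (L (?v x s) * \<bar>?\<gamma> x s\<bar>) \<partial>lborel)"
          using t by (intro indefinite_integral_chain_estimate[OF elim(2) FL]) auto
        also have "\<dots> \<le> ?S"
          unfolding R[symmetric] by (intro nn_integral_mono) (auto split: split_indicator)
        finally have *: "ennreal \<bar>F (?v x t) - F (u x)\<bar> \<le> ?S" unfolding v0 .
        have "ennreal (F (u x)) \<le> ennreal (F (?v x t) + \<bar>F (?v x t) - F (u x)\<bar>)"
          by (intro ennreal_leI) auto
        also have "\<dots> = ennreal (F (?v x t)) + ennreal \<bar>F (?v x t) - F (u x)\<bar>"
          using F0 by (intro ennreal_plus) auto
        finally show ?thesis using * by (meson add_left_mono order.trans)
      qed
      with v have "AE t in lborel. indicator {0..h} t * ennreal (F (u x))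
          \<le> indicator {0..h} t * (ennreal (F (u (x + t *\<^sub>R e))) + ?S)"
        by (elim eventually_mono) (auto split: split_indicator)
      then have "(\<integral>\<^sup>+t. indicator {0..h} t * ennreal (F (u x)) \<partial>lborel)
          \<le> (\<integral>\<^sup>+t. indicator {0..h} t * (ennreal (F (u (x + t *\<^sub>R e))) + ?S) \<partial>lborel)"
        by (rule nn_integral_mono_AE)
      also have "\<dots> = (\<integral>\<^sup>+t. ?f t + indicator {0..h} t * ?S \<partial>lborel)"
        by (simp add: distrib_left)
      also have "\<dots> = (\<integral>\<^sup>+t. ?f t \<partial>lborel) + ennreal h * ?S"
        using h by (simp add: nn_integral_add nn_integral_multc)
      finally have "ennreal h * ennreal (F (u x)) \<le> \<dots>"
        using h by (simp add: nn_integral_multc)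
      then have "ennreal (1 / h) * (ennreal h * ennreal (F (u x))) \<le> ennreal (1 / h) *
          ((\<integral>\<^sup>+t. ?f t \<partial>lborel) + ennreal h * ?S)"
        by (intro mult_left_mono) auto
      moreover have "ennreal (1 / h) * (ennreal h * z) = z" for z
        using h by (simp flip: mult.assoc ennreal_mult)
      ultimately have "ennreal (F (u x)) \<le> ennreal (1 / h) *
          (\<integral>\<^sup>+t. ?f t \<partial>lborel) + ?S"
        by (simp add: distrib_left)
      also have "\<dots> = (\<integral>\<^sup>+t. indicator {0..h} t * (ennreal (1 / h) * ennreal (F (u (x + t *\<^sub>R e)))
          + ennreal (L (u (x + t *\<^sub>R e)) * \<bar>g (x + t *\<^sub>R e) \<bullet> e\<bar>)) \<partial>lborel)"
        by (simp add: distrib_left nn_integral_add nn_integral_cmult[symmetric] mult.left_commute)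
      finally show "ennreal (F (u x)) \<le> \<dots>" .
    qed
  qed
qed

section \<open>Segments inside a domain with continuously differentiable boundary\<close>

text \<open>The columns of \<open>T\<close> are the directions of the segments, so that \<open>T\<close> can serve directly as a change of variables.\<close>

definition segments_inside :: "'a::euclidean_space set \<Rightarrow> 'a set \<Rightarrow> ('a \<Rightarrow> 'a) \<Rightarrow> real \<Rightarrow> bool" where
  "segments_inside U V T h \<longleftrightarrow> (\<forall>x\<in>V. \<forall>b\<in>Basis. \<forall>t\<in>{0..h}. x + t *\<^sub>R T b \<in> U)"

lemma C1_imp_locally_Lipschitz:
  fixes \<gamma> :: "'a::euclidean_space \<Rightarrow> real"
  assumes "C_k 1 \<gamma>"
  obtains \<Lambda> where "\<Lambda> > 0" "\<And>x y. x \<in> cball z 1 \<Longrightarrow> y \<in> cball z 1 \<Longrightarrow> \<bar>\<gamma> x - \<gamma> y\<bar> \<le> \<Lambda> * norm (x - y)"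
proof -
  let ?D = "\<lambda>x. frechet_derivative \<gamma> (at x)"
  have diff: "(\<gamma> has_derivative ?D x) (at x)" for x
    using assms by (simp add: frechet_derivative_works)
  have cont: "continuous_on UNIV (\<lambda>x. ?D x b)" if "b \<in> Basis" for b
    using assms that by simp
  have "\<exists>B. \<forall>x\<in>cball z 1. \<bar>?D x b\<bar> \<le> B" if b: "b \<in> Basis" for b
  proof -
    have "compact ((\<lambda>x. ?D x b) ` cball z 1)"
      by (intro compact_continuous_image continuous_on_subset[OF cont[OF b]]) auto
    then have "bounded ((\<lambda>x. ?D x b) ` cball z 1)"
      by (rule compact_imp_bounded)
    then show ?thesis
      unfolding bounded_iff by auto
  qed
  then obtain B where B: "\<And>b x. b \<in> Basis \<Longrightarrow> x \<in> cball z 1 \<Longrightarrow> \<bar>?D x b\<bar> \<le> B b"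
    by metis
  let ?L = "\<Sum>b\<in>Basis. \<bar>B b\<bar>"
  have "onorm (?D x) \<le> ?L" if x: "x \<in> cball z 1" for x
  proof (rule onorm_bound)
    show "0 \<le> ?L" by (simp add: sum_nonneg)
    fix v
    have lin: "linear (?D x)" using diff by (rule has_derivative_linear)
    have "?D x v = ?D x (\<Sum>b\<in>Basis. (v \<bullet> b) *\<^sub>R b)" by (simp add: euclidean_representation)
    also have "\<dots> = (\<Sum>b\<in>Basis. (v \<bullet> b) * ?D x b)"
      by (simp add: linear_sum[OF lin] linear_scale[OF lin])
    finally have "norm (?D x v) \<le> (\<Sum>b\<in>Basis. \<bar>v \<bullet> b\<bar> * \<bar>?D x b\<bar>)"
      by (simp add: abs_mult order.trans[OF sum_abs])
    also have "\<dots> \<le> (\<Sum>b\<in>Basis. norm v * \<bar>B b\<bar>)"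
      using B[OF _ x] by (intro sum_mono mult_mono Basis_le_norm) (auto intro: order.trans[OF _ abs_ge_self])
    finally show "norm (?D x v) \<le> ?L * norm v"
      by (simp add: sum_distrib_left mult.commute)
  qed
  then have L: "norm (\<gamma> x - \<gamma> y) \<le> ?L * norm (x - y)" if "x \<in> cball z 1" "y \<in> cball z 1" for x y
    using that diff
    by (intro differentiable_bound[where S="cball z 1" and f'="?D"])
       (auto intro: has_derivative_at_withinI)
  have "\<bar>\<gamma> x - \<gamma> y\<bar> \<le> (?L + 1) * norm (x - y)" if "x \<in> cball z 1" "y \<in> cball z 1" for x y
  proof -
    have "\<bar>\<gamma> x - \<gamma> y\<bar> \<le> ?L * norm (x - y)"
      using L[OF that] by simp
    also have "\<dots> \<le> (?L + 1) * norm (x - y)"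
      by (intro mult_right_mono) auto
    finally show ?thesis .
  qed
  moreover have "?L + 1 > 0"
    by (intro add_nonneg_pos sum_nonneg) auto
  ultimately show thesis by (rule that[rotated])
qed

text \<open>These maps have the columns \<open>e + \<delta> b\<close>. A kernel vector is a multiple of \<open>e\<close>, and the sum of its coordinates is annihilated by
  \<open>\<delta> + (\<Sum>b\<in>Basis. e \<bullet> b)\<close>.\<close>

lemma shear_injective:
  fixes e :: "'a::euclidean_space"
  assumes "\<delta> \<noteq> 0" "\<delta> + (\<Sum>b\<in>Basis. e \<bullet> b) \<noteq> 0"
  defines "T \<equiv> \<lambda>y. \<delta> *\<^sub>R y + (\<Sum>b\<in>Basis. y \<bullet> b) *\<^sub>R e"
  shows "linear T" "inj T"
proof -
  show lin: "linear T"
    unfolding T_def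
    by (intro linearI) (simp_all add: inner_add_left sum.distrib algebra_simps sum_distrib_left)
  show "inj T"
    unfolding linear_injective_0[OF lin]
  proof (intro allI impI)
    fix y assume T0: "T y = 0"
    let ?s = "\<Sum>b\<in>Basis. y \<bullet> b"
    have "(\<Sum>b\<in>Basis. T y \<bullet> b) = \<delta> * ?s + ?s * (\<Sum>b\<in>Basis. e \<bullet> b)"
      by (simp add: T_def inner_add_left sum.distrib flip: sum_distrib_left)
    with T0 have "?s * (\<delta> + (\<Sum>b\<in>Basis. e \<bullet> b)) = 0" by (simp add: algebra_simps)
    with assms(2) have "?s = 0" by simp
    with T0 assms(1) show "y = 0" by (simp add: T_def)
  qed
qed

text \<open>Locally \<open>U\<close> lies above a Lipschitz graph over the hyperplane orthogonal to \<open>e\<close>. Along \<open>e + \<delta> b\<close> the height grows at the rate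
  \<open>1 - \<delta>\<close> at least, and the graph rises at the rate \<open>\<Lambda> \<delta>\<close> at most, so one cannot leave \<open>U\<close> when \<open>\<delta> (\<Lambda> + 1) < 1\<close>.\<close>

lemma segments_inside_near_boundary:
  fixes U :: "'a::euclidean_space set"
  assumes "C1_boundary U" "x0 \<in> frontier U"
  obtains \<rho> h T where "\<rho> > 0" "h > 0" "linear T" "inj T" "segments_inside U (U \<inter> ball x0 \<rho>) T h"
proof -
  obtain R e \<gamma> where R: "R > 0" and e: "norm e = 1" and \<gamma>: "C_k 1 \<gamma>"
    and U: "U \<inter> ball x0 R = {x \<in> ball x0 R. x \<bullet> e > \<gamma> (x - (x \<bullet> e) *\<^sub>R e)}"
    using assms unfolding C1_boundary_def by blast
  define \<pi> where "\<pi> = (\<lambda>x::'a. x - (x \<bullet> e) *\<^sub>R e)"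
  have ee: "e \<bullet> e = 1" using e by (simp add: norm_eq_1)
  have \<pi>_diff: "\<pi> x - \<pi> y = \<pi> (x - y)" for x y
    by (simp add: \<pi>_def inner_diff_left algebra_simps)
  have \<pi>_norm: "norm (\<pi> x) \<le> norm x" for x
  proof -
    have "\<pi> x \<bullet> \<pi> x = x \<bullet> x - (x \<bullet> e)\<^sup>2"
      by (simp add: \<pi>_def inner_diff_left inner_diff_right ee inner_commute power2_eq_square algebra_simps)
    then show ?thesis by (simp add: norm_le)
  qed
  obtain \<Lambda> where \<Lambda>: "\<Lambda> > 0"
    "\<And>x y. x \<in> cball (\<pi> x0) 1 \<Longrightarrow> y \<in> cball (\<pi> x0) 1 \<Longrightarrow> \<bar>\<gamma> x - \<gamma> y\<bar> \<le> \<Lambda> * norm (x - y)"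
    using C1_imp_locally_Lipschitz[OF \<gamma>] by metis
  define s where "s = (\<Sum>b\<in>Basis. e \<bullet> b)"
  \<comment> \<open>Small enough for the graph, and different from \<open>-s\<close>, which keeps the directions independent.\<close>
  define \<delta> where "\<delta> = (if s = 0 then 1 else min 1 (\<bar>s\<bar> / 2)) / (2 * (\<Lambda> + 1))"
  have \<delta>: "\<delta> > 0" "\<delta> * (\<Lambda> + 1) < 1" "\<delta> + s \<noteq> 0" "\<delta> < 1"
  proof -
    show d: "\<delta> > 0" using \<Lambda>(1) by (auto simp: \<delta>_def)
    have "\<delta> \<le> 1 / (2 * (\<Lambda> + 1))"
      unfolding \<delta>_def using \<Lambda>(1) by (intro divide_right_mono) auto
    then show d1: "\<delta> * (\<Lambda> + 1) < 1" using \<Lambda>(1) by (simp add: field_simps)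
    show "\<delta> < 1" using d1 \<Lambda>(1) d by (smt (verit) mult_less_cancel_left_pos mult_cancel_left1)
    have "s \<noteq> 0 \<Longrightarrow> \<delta> < \<bar>s\<bar>"
    proof -
      assume s: "s \<noteq> 0"
      have "\<delta> \<le> (\<bar>s\<bar> / 2) / (2 * (\<Lambda> + 1))"
        unfolding \<delta>_def using s \<Lambda>(1) by (intro divide_right_mono) auto
      also have "\<dots> \<le> (\<bar>s\<bar> / 2) / 1" using \<Lambda>(1) by (intro divide_left_mono) auto
      also have "\<dots> < \<bar>s\<bar>" using s by simp
      finally show ?thesis .
    qed
    then show "\<delta> + s \<noteq> 0" using d by (cases "s = 0") auto
  qed
  define T where "T = (\<lambda>y. \<delta> *\<^sub>R y + (\<Sum>b\<in>Basis. y \<bullet> b) *\<^sub>R e)"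
  have Tb: "T b = \<delta> *\<^sub>R b + e" if "b \<in> Basis" for b
    using that by (simp add: T_def inner_Basis if_distrib sum.delta cong: if_cong)
  have T: "linear T" "inj T"
    using shear_injective[of \<delta> e] \<delta> unfolding T_def s_def by auto
  define h where "h = min R 1 / 4"
  have h: "h > 0" "h \<le> R / 4" "h \<le> 1 / 4" using R by (auto simp: h_def)
  have "segments_inside U (U \<inter> ball x0 h) T h"
    unfolding segments_inside_def
  proof (intro ballI)
    fix x b :: 'a and t assume x: "x \<in> U \<inter> ball x0 h" and b: "b \<in> Basis" and t: "t \<in> {0..h::real}"
    let ?y = "x + t *\<^sub>R T b"
    have "norm (T b) \<le> \<delta> * 1 + 1"
      unfolding Tb[OF b] using b e \<delta>(1) by (intro order.trans[OF norm_triangle_ineq]) simp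
    then have nT: "norm (t *\<^sub>R T b) \<le> h * 2"
      using t \<delta>(4) h(1) by (simp add: mult_mono)
    have dx: "norm (x - x0) < h" using x by (simp add: dist_norm norm_minus_commute)
    have yx: "norm (?y - x0) < 3 * h"
      using norm_triangle_ineq[of "x - x0" "t *\<^sub>R T b"] nT dx by (simp add: algebra_simps)
    have xin: "x \<in> U \<inter> ball x0 R" "?y \<in> ball x0 R"
      using x yx h by (auto simp: dist_norm norm_minus_commute)
    have proj: "\<pi> x \<in> cball (\<pi> x0) 1" "\<pi> ?y \<in> cball (\<pi> x0) 1"
      using \<pi>_norm[of "x0 - x"] \<pi>_norm[of "x0 - ?y"] dx yx h(1,3)
      by (simp_all add: dist_norm norm_minus_commute \<pi>_diff)
    have "\<pi> ?y - \<pi> x = t *\<^sub>R \<pi> (T b)"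
      unfolding \<pi>_diff by (simp add: \<pi>_def algebra_simps)
    also have "\<pi> (T b) = \<delta> *\<^sub>R \<pi> b"
      unfolding Tb[OF b] by (simp add: \<pi>_def inner_add_left ee algebra_simps)
    finally have "norm (\<pi> ?y - \<pi> x) \<le> t * \<delta>"
      using t \<delta>(1) \<pi>_norm[of b] b by (simp add: mult_left_le)
    then have "\<gamma> (\<pi> ?y) \<le> \<gamma> (\<pi> x) + \<Lambda> * (t * \<delta>)"
      using \<Lambda>(2)[OF proj(2,1)] \<Lambda>(1) by (smt (verit) mult_left_mono)
    also have "\<dots> < x \<bullet> e + \<Lambda> * (t * \<delta>)"
      using xin U by (auto simp: \<pi>_def)
    also have "\<dots> \<le> x \<bullet> e + t * (1 - \<delta>)"
    proof -
      have "t * (\<delta> * (\<Lambda> + 1)) \<le> t * 1" using \<delta>(2) t by (intro mult_left_mono) auto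
      then show ?thesis by (simp add: algebra_simps)
    qed
    also have "\<dots> \<le> ?y \<bullet> e"
    proof -
      have "\<bar>b \<bullet> e\<bar> \<le> 1" using Basis_le_norm[OF b, of e] e by (simp add: inner_commute)
      then have "\<delta> * (b \<bullet> e) \<ge> \<delta> * - 1" using \<delta>(1) by (intro mult_left_mono) auto
      then have "t * (1 - \<delta>) \<le> t * (1 + \<delta> * (b \<bullet> e))" using t by (intro mult_left_mono) auto
      then show ?thesis by (simp add: Tb[OF b] inner_add_left ee algebra_simps)
    qed
    finally show "?y \<in> U"
      using xin(2) U by (auto simp: \<pi>_def)
  qed
  with h T show thesis by (intro that) auto
qed

lemma segments_inside_cover:
  fixes U :: "'a::euclidean_space set"
  assumes "open U" "bounded U" "C1_boundary U"
  shows "\<exists>P :: ('a set \<times> ('a \<Rightarrow> 'a) \<times> real) set. finite P \<and> U = (\<Union>(V, T, h)\<in>P. V) \<and>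
    (\<forall>(V, T, h)\<in>P. open V \<and> h > 0 \<and> linear T \<and> inj T \<and> segments_inside U V T h)"
proof -
  have "\<exists>\<rho> h T. \<rho> > 0 \<and> h > 0 \<and> linear T \<and> inj T \<and> segments_inside U (U \<inter> ball x0 \<rho>) T h"
    if x0: "x0 \<in> closure U" for x0
  proof (cases "x0 \<in> U")
    case True
    then obtain R where R: "R > 0" "ball x0 R \<subseteq> U"
      using \<open>open U\<close> openE by blast
    have "segments_inside U (U \<inter> ball x0 (R / 2)) id (R / 4)"
      unfolding segments_inside_def
    proof (intro ballI)
      fix x and b :: 'a and t assume *: "x \<in> U \<inter> ball x0 (R / 2)" "b \<in> Basis" "t \<in> {0..R / 4}"
      have "norm (t *\<^sub>R b) \<le> R / 4" using * by simp
      then have "x + t *\<^sub>R id b \<in> ball x0 R"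
        using *(1) norm_triangle_ineq[of "x - x0" "t *\<^sub>R b"] R(1)
        by (simp add: dist_norm norm_minus_commute[of x0] algebra_simps)
      then show "x + t *\<^sub>R id b \<in> U" using R by blast
    qed
    then show ?thesis
      using R(1) by (intro exI[of _ "R / 2"] exI[of _ "R / 4"] exI[of _ id])
        (auto simp: linear_id)
  next
    case False
    then have "x0 \<in> frontier U"
      using x0 \<open>open U\<close> by (simp add: frontier_def interior_open)
    then show ?thesis
      using segments_inside_near_boundary[OF assms(3)] by metis
  qed
  then obtain \<rho> h T where *: "\<And>x. x \<in> closure U \<Longrightarrow> \<rho> x > 0 \<and> h x > 0 \<and> linear (T x) \<and> inj (T x)
      \<and> segments_inside U (U \<inter> ball x (\<rho> x)) (T x) (h x)"
    by metis
  have "compact (closure U)" using assms(2) by (simp add: compact_closure)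
  then obtain F where F: "F \<subseteq> closure U" "finite F" "closure U \<subseteq> (\<Union>x\<in>F. ball x (\<rho> x))"
  proof (rule compactE_image)
    show "closure U \<subseteq> (\<Union>x\<in>closure U. ball x (\<rho> x))" using * by force
  qed auto
  let ?P = "(\<lambda>x. (U \<inter> ball x (\<rho> x), T x, h x)) ` F"
  have "U = (\<Union>(V, T, h)\<in>?P. V)"
    using F(3) closure_subset[of U] by auto
  moreover have "\<forall>(V, T, h)\<in>?P. open V \<and> h > 0 \<and> linear T \<and> inj T \<and> segments_inside U V T h"
    using F(1) * assms(1) by auto
  ultimately show ?thesis
    using F(2) by (intro exI[of _ ?P]) auto
qed

section \<open>The Sobolev inequality for powers\<close>

lemma truncated_power_increment:
  assumes M: "M \<ge> 1" and N: "N > (0::real)"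
  shows "\<bar>min \<bar>b\<bar> N powr M - min \<bar>a\<bar> N powr M\<bar>
    \<le> max (M * powr_one (min \<bar>a\<bar> N) (M - 1)) (M * powr_one (min \<bar>b\<bar> N) (M - 1)) * \<bar>b - a\<bar>"
proof -
  have up: "B powr M - A powr M \<le> M * powr_one B (M - 1) * (B - A)" if AB: "0 \<le> A" "A < B" for A B
  proof -
    have "\<exists>l z. A < z \<and> z < B \<and> DERIV (\<lambda>x. x powr M) z :> l \<and> B powr M - A powr M = (B - A) * l"
    proof (rule MVT[OF AB(2)])
      show "continuous_on {A..B} (\<lambda>x. x powr M)"
        using AB M by (intro continuous_on_powr') (auto intro: continuous_intros)
      show "(\<lambda>x. x powr M) differentiable (at x)" if "A < x" "x < B" for x
        using has_real_derivative_powr[of x M] that AB by (auto intro: differentiableI simp: real_differentiable_def)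
    qed
    then obtain l z where z: "A < z" "z < B" "DERIV (\<lambda>x. x powr M) z :> l"
      "B powr M - A powr M = (B - A) * l" by blast
    have "l = M * z powr (M - 1)"
      using DERIV_unique[OF z(3) has_real_derivative_powr] z AB by auto
    also have "\<dots> \<le> M * B powr (M - 1)"
      using z AB M by (intro mult_left_mono powr_mono2) auto
    also have "B powr (M - 1) = powr_one B (M - 1)"
      using AB by (simp add: powr_one_def)
    finally show ?thesis using z(4) AB by (simp add: mult.commute mult_left_mono)
  qed
  define A B where "A = min \<bar>a\<bar> N" and "B = min \<bar>b\<bar> N"
  have AB: "A \<ge> 0" "B \<ge> 0" "\<bar>B - A\<bar> \<le> \<bar>b - a\<bar>"
    using N unfolding A_def B_def by (auto simp: min_def abs_if split: if_splits)
  have p0: "0 \<le> powr_one x (M - 1)" for x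
    by (simp add: powr_one_def)
  define m where "m = max (M * powr_one A (M - 1)) (M * powr_one B (M - 1))"
  have m: "M * powr_one A (M - 1) \<le> m" "M * powr_one B (M - 1) \<le> m" "m \<ge> 0"
    using M p0[of A] by (auto simp: m_def le_max_iff_disj)
  consider "A < B" | "B < A" | "A = B" by linarith
  then have "\<bar>B powr M - A powr M\<bar> \<le> m * \<bar>B - A\<bar>"
  proof cases
    case 1
    then have "\<bar>B powr M - A powr M\<bar> = B powr M - A powr M" "\<bar>B - A\<bar> = B - A"
      using AB M powr_mono2[of M A B] by auto
    with order.trans[OF up[of A B] mult_right_mono[OF m(2), of "B - A"]] 1 AB show ?thesis by auto
  next
    case 2
    then have "\<bar>B powr M - A powr M\<bar> = A powr M - B powr M" "\<bar>B - A\<bar> = A - B"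
      using AB M powr_mono2[of M B A] by auto
    with order.trans[OF up[of B A] mult_right_mono[OF m(1), of "A - B"]] 2 AB show ?thesis by auto
  qed auto
  also have "\<dots> \<le> m * \<bar>b - a\<bar>" using AB(3) m(3) by (rule mult_left_mono)
  finally show ?thesis by (simp add: m_def A_def B_def)
qed

lemma truncated_power_slope_continuous:
  assumes "M \<ge> 1" "N > (0::real)"
  shows "continuous_on UNIV (\<lambda>t. M * powr_one (min \<bar>t\<bar> N) (M - 1))"
proof (cases "M = 1")
  case False
  then have eq: "powr_one x (M - 1) = x powr (M - 1)" for x
    by (simp add: powr_one_def)
  show ?thesis
    unfolding eq using assms False
    by (intro continuous_on_mult continuous_on_const continuous_on_powr' continuous_on_min continuous_intros) auto
qed (simp add: powr_one_def)

text \<open>On the patch, \<open>F(u)\<close> is bounded by line integrals over \<open>U\<close> in the directions \<open>T b\<close>; Gagliardo's inequality does the rest.\<close>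

lemma Gagliardo_estimate_patch:
  fixes U :: "'a::euclidean_space set"
  assumes U: "open U" and V: "open V" and h: "h > 0" and T: "linear T" "inj T"
    and seg: "segments_inside U V T h" and dim: "DIM('a) \<ge> 2"
  defines "p \<equiv> real DIM('a) / (real DIM('a) - 1)"
  shows "\<exists>C>0. \<forall>u g F L. integrable_weak_gradient U u g \<longrightarrow> slope_dominated F L \<longrightarrow>
      (\<integral>\<^sup>+x. indicator V x * ennreal (F (u x)) epowr p \<partial>lborel)
        \<le> ennreal C * (\<integral>\<^sup>+x. indicator U x * ennreal (F (u x) + L (u x) * norm (g x)) \<partial>lborel) epowr p"
proof -
  let ?n = "real DIM('a)"
  obtain K :: real where K: "K > 0"
    and gag: "\<forall>(f :: 'a \<Rightarrow> ennreal) H. f \<in> borel_measurable borel \<longrightarrow>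
      (\<forall>b\<in>Basis. H b \<in> borel_measurable borel) \<longrightarrow>
      (AE x in lborel. \<forall>b\<in>Basis. f x \<le> (\<integral>\<^sup>+t. H b (x + t *\<^sub>R T b) \<partial>lborel)) \<longrightarrow>
      (\<integral>\<^sup>+x. f x epowr (?n / (?n - 1)) \<partial>lborel)
        \<le> ennreal K * (\<Prod>b\<in>Basis. (\<integral>\<^sup>+x. H b x \<partial>lborel) epowr (1 / (?n - 1)))"
    using Gagliardo_inequality[OF T dim] by blast
  define B where "B = 1 / h + (\<Sum>b\<in>Basis. norm (T b))"
  have Tb: "norm (T b) \<le> B" if "b \<in> Basis" for b
    unfolding B_def using h member_le_sum[of b Basis "\<lambda>b. norm (T b)"] that
    by (intro add_increasing) auto
  have B: "B > 0" "1 / h \<le> B" unfolding B_def using h by (auto intro!: add_pos_nonneg sum_nonneg)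
  have p: "p > 0" using dim by (simp add: p_def)
  show ?thesis
  proof (rule exI[of _ "K * B powr p"], intro conjI allI impI)
    show "K * B powr p > 0" using K B by simp
    fix u :: "'a \<Rightarrow> real" and g :: "'a \<Rightarrow> 'a" and F L :: "real \<Rightarrow> real"
    assume wg: "integrable_weak_gradient U u g" and FL: "slope_dominated F L"
    note u = integrable_weak_gradientD(1)[OF wg] and g = integrable_weak_gradientD(2)[OF wg]
    note L = slope_dominatedD(1,2)[OF FL] and F [measurable] = slope_dominatedD(3)[OF FL]
      and F0 = slope_dominatedD(4)[OF FL]
    have [measurable]: "u \<in> borel_measurable borel" "g \<in> borel_measurable borel"
      using u g by auto
    have [measurable]: "L \<in> borel_measurable borel"
      using L(1) by (rule borel_measurable_continuous_onI)
    have [measurable]: "V \<in> sets borel" "U \<in> sets borel" using U V by simp_all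
    define Z where "Z = (\<lambda>x. indicator U x * ennreal (F (u x) + L (u x) * norm (g x)))"
    have [measurable]: "Z \<in> borel_measurable borel" unfolding Z_def by measurable
    define f where "f = (\<lambda>x. indicator V x * ennreal (F (u x)))"
    have [measurable]: "f \<in> borel_measurable borel" unfolding f_def by measurable
    have line: "AE x in lborel. f x \<le> (\<integral>\<^sup>+t. ennreal B * Z (x + t *\<^sub>R T b) \<partial>lborel)" if b: "b \<in> Basis" for b
    proof -
      have s: "x + s *\<^sub>R T b \<in> U" if "x \<in> V" "s \<in> {0..h}" for x s
        using seg that b by (simp add: segments_inside_def)
      show ?thesis
        using weak_gradient_line_estimate[OF wg V h s FL]
      proof (rule eventually_mono)
        fix x
        let ?S = "\<integral>\<^sup>+t. indicator {0..h} t * (ennreal (1 / h) * ennreal (F (u (x + t *\<^sub>R T b)))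
           + ennreal (L (u (x + t *\<^sub>R T b)) * \<bar>g (x + t *\<^sub>R T b) \<bullet> T b\<bar>)) \<partial>lborel"
        assume *: "x \<in> V \<longrightarrow> ennreal (F (u x)) \<le>
          ?S"
        show "f x \<le> (\<integral>\<^sup>+t. ennreal B * Z (x + t *\<^sub>R T b) \<partial>lborel)"
        proof (cases "x \<in> V")
          case True
          have "f x \<le> ?S"
            using * True by (simp add: f_def)
          also have "\<dots> \<le> (\<integral>\<^sup>+t. ennreal B * Z (x + t *\<^sub>R T b) \<partial>lborel)"
          proof (intro nn_integral_mono)
            fix t
            let ?y = "x + t *\<^sub>R T b"
            show "indicator {0..h} t * (ennreal (1 / h) * ennreal (F (u ?y))
               + ennreal (L (u ?y) * \<bar>g ?y \<bullet> T b\<bar>)) \<le> ennreal B * Z ?y"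
            proof (cases "t \<in> {0..h}")
              case t: True
              have "\<bar>g ?y \<bullet> T b\<bar> \<le> norm (g ?y) * B"
                using Cauchy_Schwarz_ineq2[of "g ?y" "T b"] Tb[OF b]
                by (meson mult_left_mono norm_ge_zero order.trans)
              then have "L (u ?y) * \<bar>g ?y \<bullet> T b\<bar> \<le> L (u ?y) * (norm (g ?y) * B)"
                using L(2) by (rule mult_left_mono)
              moreover have "1 / h * F (u ?y) \<le> B * F (u ?y)"
                using B(2) F0 by (rule mult_right_mono)
              ultimately have "1 / h * F (u ?y) + L (u ?y) * \<bar>g ?y \<bullet> T b\<bar> \<le> B * (F (u ?y) + L (u ?y) * norm (g ?y))"
                by (simp add: algebra_simps)
              then have "ennreal (1 / h * F (u ?y) + L (u ?y) * \<bar>g ?y \<bullet> T b\<bar>) \<le> ennreal (B * (F (u ?y) + L (u ?y) * norm (g ?y)))"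
                by (rule ennreal_leI)
              then have "ennreal (1 / h) * ennreal (F (u ?y)) + ennreal (L (u ?y) * \<bar>g ?y \<bullet> T b\<bar>)
                  \<le> ennreal B * ennreal (F (u ?y) + L (u ?y) * norm (g ?y))"
                using h B F0 L(2) by (simp add: ennreal_mult[symmetric] ennreal_plus[symmetric] del: ennreal_plus)
              then show ?thesis using t s[OF True t] by (simp add: Z_def)
            qed simp
          qed
          finally show ?thesis .
        qed (simp add: f_def)
      qed
    qed
    have "(\<integral>\<^sup>+x. indicator V x * ennreal (F (u x)) epowr p \<partial>lborel) = (\<integral>\<^sup>+x. f x epowr p \<partial>lborel)"
      by (intro nn_integral_cong) (simp add: f_def split: split_indicator)
    also have "\<dots> \<le> ennreal K * (\<Prod>b\<in>(Basis :: 'a set). (\<integral>\<^sup>+x. ennreal B * Z x \<partial>lborel) epowr (1 / (?n - 1)))"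
      unfolding p_def using line by (intro gag[rule_format]) (auto intro: AE_finite_allI)
    also have "(\<Prod>b\<in>(Basis :: 'a set). (\<integral>\<^sup>+x. ennreal B * Z x \<partial>lborel) epowr (1 / (?n - 1)))
        = (ennreal B * (\<integral>\<^sup>+x. Z x \<partial>lborel)) epowr p"
    proof -
      have "(\<Prod>b\<in>(Basis::'a set). z epowr (1 / (?n - 1))) = z epowr p" for z
        using prod_epowr_const[of "Basis :: 'a set" z "1 / (?n - 1)"] by (simp add: p_def)
      then show ?thesis by (simp add: nn_integral_cmult)
    qed
    also have "\<dots> = ennreal (B powr p) * (\<integral>\<^sup>+x. Z x \<partial>lborel) epowr p"
      using B p by (simp add: epowr_mult)
    finally show "(\<integral>\<^sup>+x. indicator V x * ennreal (F (u x)) epowr p \<partial>lborel) \<le> ennreal (K * B powr p) *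
        (\<integral>\<^sup>+x. indicator U x * ennreal (F (u x) + L (u x) * norm (g x)) \<partial>lborel) epowr p"
      using K by (simp add: Z_def ennreal_mult mult.assoc)
  qed
qed

lemma slope_dominated_truncated_power:
  assumes "M \<ge> 1" "N > (0::real)"
  shows "slope_dominated (\<lambda>t. min \<bar>t\<bar> N powr M) (\<lambda>t. M * powr_one (min \<bar>t\<bar> N) (M - 1))"
  unfolding slope_dominated_def
proof (intro conjI allI)
  show "M * powr_one (min \<bar>x\<bar> N) (M - 1) \<ge> 0" for x
    using assms by (simp add: powr_one_def)
qed (use truncated_power_increment[OF assms] truncated_power_slope_continuous[OF assms] in simp_all)

lemma integrable_if_integrable_powr:
  fixes f :: "'a \<Rightarrow> 'b::euclidean_space"
  assumes "finite_measure M" "q \<ge> 1" and f: "f \<in> borel_measurable M"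
    and int: "integrable M (\<lambda>x. norm (f x) powr q)"
  shows "integrable M f"
proof (rule Bochner_Integration.integrable_bound)
  interpret finite_measure M by fact
  show "integrable M (\<lambda>x. 1 + norm (f x) powr q)" using int by auto
  have "y \<le> 1 + y powr q" if "y \<ge> 0" for y :: real
  proof (cases "y \<ge> 1")
    case True
    then have "y powr 1 \<le> y powr q" using assms(2) by (intro powr_mono) auto
    then show ?thesis using that by simp
  next
    case False
    then show ?thesis using powr_ge_zero[of y q] by linarith
  qed
  then show "AE x in M. norm (f x) \<le> norm (1 + norm (f x) powr q)" by (auto intro!: AE_I2)
qed (rule f)

text \<open>Fubini's theorem for the lines concerns the product Borel sets, so Lebesgue measurable functions are replaced by Borel functions
  that agree with them almost everywhere.\<close>

lemma borel_representative:
  fixes f :: "'a::euclidean_space \<Rightarrow> 'b::euclidean_space"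
  assumes U: "U \<in> sets lebesgue" and f: "integrable (lebesgue_on U) f"
  obtains f' where "f' \<in> borel_measurable borel" "integrable lborel f'"
    "AE x in lborel. f' x = (if x \<in> U then f x else 0)"
proof -
  let ?f = "\<lambda>x. if x \<in> U then f x else 0"
  have int: "integrable lebesgue ?f"
    using f U integrable_restrict_space[of U lebesgue f] by (simp add: indicator_scaleR_eq_if)
  then have "(\<lambda>x. ?f x \<bullet> b) \<in> borel_measurable (completion lborel)" for b by auto
  then have "\<exists>h\<in>borel_measurable lborel. AE x in lborel. ?f x \<bullet> b = h x" for b
    by (rule completion_ex_borel_measurable_real)
  then obtain h where h: "\<And>b. h b \<in> borel_measurable lborel" "\<And>b. AE x in lborel. ?f x \<bullet> b = h b x"
    by metis
  note [measurable] = h(1)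
  define f' where "f' = (\<lambda>x. \<Sum>b\<in>Basis. h b x *\<^sub>R b)"
  have f' [measurable]: "f' \<in> borel_measurable borel" unfolding f'_def by measurable
  have "AE x in lborel. \<forall>b\<in>Basis. ?f x \<bullet> b = h b x"
    using h(2) by (intro AE_finite_allI) auto
  then have ae: "AE x in lborel. f' x = ?f x"
  proof (rule eventually_mono)
    fix x assume *: "\<forall>b\<in>Basis. ?f x \<bullet> b = h b x"
    have "f' x = (\<Sum>b\<in>Basis. (?f x \<bullet> b) *\<^sub>R b)"
      unfolding f'_def using * by (intro sum.cong) auto
    then show "f' x = ?f x" by (simp only: euclidean_representation)
  qed
  have "integrable lebesgue f' \<longleftrightarrow> integrable lebesgue ?f"
    using AE_completion[OF ae] borel_measurable_integrable[OF int] f'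
    by (intro Bochner_Integration.integrable_cong_AE) (simp_all add: measurable_completion)
  then have "integrable lborel f'" using int by (simp add: integrable_completion)
  from f' this ae show thesis by (rule that)
qed

lemma in_W1_borel_representative:
  fixes U :: "'a::euclidean_space set"
  assumes U: "open U" "bounded U" and q: "q \<ge> 1" and W: "in_W1_with_gradient U q u Du"
  obtains u' g' where "integrable_weak_gradient U u' g'"
    "AE x in lborel. x \<in> U \<longrightarrow> u' x = u x \<and> g' x = Du x"
proof -
  have Um [simp, measurable]: "U \<in> sets lebesgue" using U(1) by simp
  have fin: "finite_measure (lebesgue_on U)"
    using U by (intro finite_measure_lebesgue_on lmeasurable_open) auto
  have iu: "integrable (lebesgue_on U) u" and ig: "integrable (lebesgue_on U) Du"
    using W by (auto simp: in_W1_with_gradient_def in_Lq_def intro: integrable_if_integrable_powr[OF fin q])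
  obtain u' where u': "u' \<in> borel_measurable borel" "integrable lborel u'"
    "AE x in lborel. u' x = (if x \<in> U then u x else 0)"
    by (rule borel_representative[OF Um iu])
  obtain g' where g': "g' \<in> borel_measurable borel" "integrable lborel g'"
    "AE x in lborel. g' x = (if x \<in> U then Du x else 0)"
    by (rule borel_representative[OF Um ig])
  note [measurable] = u'(1) g'(1)
  have transfer: "(LINT x|lebesgue_on U. h x) = (LINT x|lborel. h' x)"
    if h: "h \<in> borel_measurable (lebesgue_on U)" and [measurable]: "h' \<in> borel_measurable borel"
      and ae: "AE x in lborel. h' x = (if x \<in> U then h x else 0)" for h h' :: "'a \<Rightarrow> real"
  proof -
    have "(LINT x|lebesgue_on U. h x) = (LINT x|lebesgue. (if x \<in> U then h x else 0))"
      by (auto simp: integral_restrict_space intro!: Bochner_Integration.integral_cong split: split_indicator)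
    also have "\<dots> = (LINT x|lebesgue. h' x)"
    proof (rule integral_cong_AE)
      show "AE x in lebesgue. (if x \<in> U then h x else 0) = h' x"
        using AE_completion[OF ae] by (rule eventually_mono) simp
    qed (use borel_measurable_if_I[OF h Um] in \<open>simp_all add: measurable_completion\<close>)
    also have "\<dots> = (LINT x|lborel. h' x)" by (simp add: integral_completion)
    finally show ?thesis .
  qed
  have "integrable_weak_gradient U u' g'"
    unfolding integrable_weak_gradient_def
  proof (intro conjI allI impI ballI)
    fix \<psi> :: "'a \<Rightarrow> real" and b :: 'a assume \<psi>: "test_function U \<psi>" and b: "b \<in> Basis"
    have [measurable]: "\<psi> \<in> borel_measurable borel" "(\<lambda>x. frechet_derivative \<psi> (at x) b) \<in> borel_measurable borel"
      using test_function_bounded(1)[OF \<psi>] test_function_derivative_continuous[OF \<psi>]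
      by (simp_all add: borel_measurable_continuous_onI)
    have leb: "h \<in> borel_measurable (lebesgue_on U)" if "h \<in> borel_measurable borel" for h :: "'a \<Rightarrow> real"
      using that by (intro measurable_restrict_space1 measurable_completion) auto
    have [measurable]: "u \<in> borel_measurable (lebesgue_on U)" "Du \<in> borel_measurable (lebesgue_on U)"
      using iu ig by auto
    have [measurable]: "\<psi> \<in> borel_measurable (lebesgue_on U)"
      "(\<lambda>x. frechet_derivative \<psi> (at x) b) \<in> borel_measurable (lebesgue_on U)"
      by (intro leb; measurable)+
    have "(LINT x|lborel. u' x * frechet_derivative \<psi> (at x) b) = (LINT x|lebesgue_on U. u x * frechet_derivative \<psi> (at x) b)"
    proof (rule transfer[symmetric])
      show "AE x in lborel. u' x * frechet_derivative \<psi> (at x) b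
          = (if x \<in> U then u x * frechet_derivative \<psi> (at x) b else 0)"
        using u'(3) by (rule eventually_mono) simp
    qed measurable
    also have "\<dots> = - (LINT x|lebesgue_on U. (Du x \<bullet> b) * \<psi> x)"
      using W \<psi> b by (auto simp: in_W1_with_gradient_def has_weak_gradient_def)
    also have "(LINT x|lebesgue_on U. (Du x \<bullet> b) * \<psi> x) = (LINT x|lborel. (g' x \<bullet> b) * \<psi> x)"
    proof (rule transfer)
      show "AE x in lborel. (g' x \<bullet> b) * \<psi> x = (if x \<in> U then (Du x \<bullet> b) * \<psi> x else 0)"
        using g'(3) by (rule eventually_mono) simp
    qed measurable
    finally show "(LINT x|lborel. u' x * frechet_derivative \<psi> (at x) b) = - (LINT x|lborel. (g' x \<bullet> b) * \<psi> x)" .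
  qed (use u' g' in auto)
  moreover have "AE x in lborel. x \<in> U \<longrightarrow> u' x = u x \<and> g' x = Du x"
    using u'(3) g'(3) by eventually_elim auto
  ultimately show thesis by (rule that)
qed

lemma Gagliardo_estimate_domain:
  fixes U :: "'a::euclidean_space set"
  assumes U: "open U" "bounded U" "C1_boundary U" and dim: "DIM('a) \<ge> 2"
  defines "p \<equiv> real DIM('a) / (real DIM('a) - 1)"
  shows "\<exists>C>0. \<forall>q u Du F L. q \<ge> 1 \<longrightarrow> in_W1_with_gradient U q u Du \<longrightarrow> slope_dominated F L \<longrightarrow>
    (\<integral>\<^sup>+x. ennreal (F (u x)) epowr p \<partial>lebesgue_on U)
      \<le> ennreal C * (\<integral>\<^sup>+x. ennreal (F (u x) + L (u x) * norm (Du x)) \<partial>lebesgue_on U) epowr p"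
proof -
  obtain P :: "('a set \<times> ('a \<Rightarrow> 'a) \<times> real) set" where P: "finite P" "U = (\<Union>(V, T, h)\<in>P. V)"
    "\<forall>(V, T, h)\<in>P. open V \<and> h > 0 \<and> linear T \<and> inj T \<and> segments_inside U V T h"
    using segments_inside_cover[OF U] by blast
  define bound where "bound = (\<lambda>V C. \<forall>(u :: 'a \<Rightarrow> real) (g :: 'a \<Rightarrow> 'a) F L.
      integrable_weak_gradient U u g \<longrightarrow> slope_dominated F L \<longrightarrow>
      (\<integral>\<^sup>+x. indicator V x * ennreal (F (u x)) epowr p \<partial>lborel)
        \<le> ennreal C * (\<integral>\<^sup>+x. indicator U x * ennreal (F (u x) + L (u x) * norm (g x)) \<partial>lborel) epowr p)"
  have "\<exists>C. C > 0 \<and> bound (fst i) C" if "i \<in> P" for i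
    using P(3) that dim U(1) unfolding p_def bound_def
    by (intro Gagliardo_estimate_patch[of U "fst i" "snd (snd i)" "fst (snd i)"]) (auto simp: split_beta')
  then obtain C where C_all: "\<forall>i\<in>P. C i > 0 \<and> bound (fst i) (C i)"
    by (metis (no_types))
  have C: "\<And>i. i \<in> P \<Longrightarrow> C i > 0"
    "\<And>i u g F L. i \<in> P \<Longrightarrow> integrable_weak_gradient U u g \<Longrightarrow> slope_dominated F L \<Longrightarrow>
      (\<integral>\<^sup>+x. indicator (fst i) x * ennreal (F (u x)) epowr p \<partial>lborel)
        \<le> ennreal (C i) * (\<integral>\<^sup>+x. indicator U x * ennreal (F (u x) + L (u x) * norm (g x)) \<partial>lborel) epowr p"
    using C_all unfolding bound_def by simp_all
  have Um [simp, measurable]: "U \<in> sets lebesgue" using U(1) by simp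
  show ?thesis
  proof (rule exI[of _ "1 + sum C P"], intro conjI allI impI)
    show "1 + sum C P > 0" using C(1) by (intro add_pos_nonneg sum_nonneg) (auto intro: less_imp_le)
    fix q u Du F L
    assume q: "q \<ge> 1" and W: "in_W1_with_gradient U q u Du" and FL: "slope_dominated F L"
    obtain u' g' where wg: "integrable_weak_gradient U u' g'"
      and ae: "AE x in lborel. x \<in> U \<longrightarrow> u' x = u x \<and> g' x = Du x"
      by (rule in_W1_borel_representative[OF U(1,2) q W])
    have [measurable]: "u' \<in> borel_measurable borel" "F \<in> borel_measurable borel"
      using wg FL by (auto simp: integrable_weak_gradient_def slope_dominated_def)
    have transfer: "(\<integral>\<^sup>+x. h (u x) (Du x) \<partial>lebesgue_on U) = (\<integral>\<^sup>+x. indicator U x * h (u' x) (g' x) \<partial>lborel)"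
      for h :: "real \<Rightarrow> 'a \<Rightarrow> ennreal"
    proof -
      have "(\<integral>\<^sup>+x. h (u x) (Du x) \<partial>lebesgue_on U) = (\<integral>\<^sup>+x. h (u x) (Du x) * indicator U x \<partial>lborel)"
        by (simp add: nn_integral_restrict_space nn_integral_completion)
      also have "\<dots> = (\<integral>\<^sup>+x. indicator U x * h (u' x) (g' x) \<partial>lborel)"
        using ae by (intro nn_integral_cong_AE) (auto elim!: eventually_mono split: split_indicator)
      finally show ?thesis .
    qed
    let ?h = "\<lambda>i x. indicator (fst i) x * ennreal (F (u' x)) epowr p"
    let ?Z = "(\<integral>\<^sup>+x. indicator U x * ennreal (F (u' x) + L (u' x) * norm (g' x)) \<partial>lborel) epowr p"
    have "(\<integral>\<^sup>+x. ennreal (F (u x)) epowr p \<partial>lebesgue_on U) = (\<integral>\<^sup>+x. indicator U x * ennreal (F (u' x)) epowr p \<partial>lborel)"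
      by (rule transfer)
    also have "\<dots> \<le> (\<integral>\<^sup>+x. (\<Sum>i\<in>P. ?h i x) \<partial>lborel)"
    proof (intro nn_integral_mono)
      fix x
      show "indicator U x * ennreal (F (u' x)) epowr p \<le> (\<Sum>i\<in>P. ?h i x)"
      proof (cases "x \<in> U")
        case True
        then obtain i where i: "i \<in> P" "x \<in> fst i" using P(2) by force
        then have "indicator U x * ennreal (F (u' x)) epowr p = ?h i x"
          using True by simp
        also have "\<dots> \<le> (\<Sum>i\<in>P. ?h i x)"
          using i P(1) by (intro member_le_sum) auto
        finally show ?thesis .
      qed simp
    qed
    also have "\<dots> = (\<Sum>i\<in>P. \<integral>\<^sup>+x. ?h i x \<partial>lborel)"
    proof (rule nn_integral_sum)
      fix i assume "i \<in> P"
      then have [measurable]: "fst i \<in> sets borel"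
        using P(3) by (auto simp: split_beta')
      show "(\<lambda>x. ?h i x) \<in> borel_measurable lborel" by measurable
    qed
    also have "\<dots> \<le> (\<Sum>i\<in>P. ennreal (C i) * ?Z)"
      using C(2)[OF _ wg FL] by (intro sum_mono) auto
    also have "\<dots> = ennreal (sum C P) * ?Z"
      using C(1) by (simp add: sum_ennreal less_imp_le flip: sum_distrib_right)
    also have "\<dots> \<le> ennreal (1 + sum C P) * ?Z"
      by (intro mult_right_mono ennreal_leI) auto
    finally show "(\<integral>\<^sup>+x. ennreal (F (u x)) epowr p \<partial>lebesgue_on U)
      \<le> ennreal (1 + sum C P) * (\<integral>\<^sup>+x. ennreal (F (u x) + L (u x) * norm (Du x)) \<partial>lebesgue_on U) epowr p"
      by (simp add: transfer[of "\<lambda>t d. ennreal (F t + L t * norm d)"])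
  qed
qed

text \<open>After division by \<open>X powr k\<close> at least one of the two terms on the right is \<open>1 / 2\<close> or more, and this bounds \<open>X\<close> by a multiple of
  \<open>Y\<close> or of \<open>Z\<close>. Finiteness of \<open>X\<close> is essential.\<close>

lemma absorb_powers:
  fixes X Y Z :: ennreal
  assumes X: "X \<noteq> top" and D: "D > 0" and k: "0 < c" "c \<le> k" "1 \<le> k"
    and le: "X epowr k \<le> ennreal D * (Y epowr c * X epowr (k - c) + Z * X epowr (k - 1))"
  shows "X \<le> ennreal (max ((2 * D) powr (1 / c)) (2 * D)) * (Y + Z)"
proof (cases "X = 0 \<or> Y = top \<or> Z = top")
  case True
  then show ?thesis using D by (auto simp: ennreal_mult_top)
next
  case False
  then obtain x y z where xyz: "X = ennreal x" "Y = ennreal y" "Z = ennreal z" "x > 0" "y \<ge> 0" "z \<ge> 0"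
    using X by (cases X; cases Y; cases Z) (auto simp: less_le)
  have "x powr k \<le> D * (y powr c * x powr (k - c) + z * x powr (k - 1))"
    using le xyz D by (simp add: ennreal_mult[symmetric] ennreal_plus[symmetric] del: ennreal_plus)
  moreover have split: "x powr (k - d) = x powr k * x powr (- d)" for d
    by (simp add: powr_diff powr_minus divide_inverse)
  ultimately have "x powr k * 1 \<le> D * (y powr c * (x powr k * x powr (- c)) + z * (x powr k * x powr (- 1)))"
    by (simp only: split mult_1_right)
  also have "\<dots> = x powr k * (D * (y powr c * x powr (- c)) + D * (z * x powr (- 1)))"
    by (simp only: distrib_left mult.left_commute)
  finally have "x powr k * 1 \<le> x powr k * (D * (y powr c * x powr (- c)) + D * (z * x powr (- 1)))" .
  then have le1: "1 \<le> D * (y powr c * x powr (- c)) + D * (z * x powr (- 1))"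
    using xyz(4) by (subst (asm) mult_le_cancel_left_pos) auto
  have "x \<le> max ((2 * D) powr (1 / c)) (2 * D) * (y + z)"
  proof (cases "D * (y powr c * x powr (- c)) \<ge> 1 / 2")
    case True
    then have "x powr c \<le> 2 * D * y powr c"
      using xyz(4) by (simp add: powr_minus field_simps)
    then have "(x powr c) powr (1 / c) \<le> (2 * D * y powr c) powr (1 / c)"
      using k(1) by (intro powr_mono2) auto
    then have "x \<le> (2 * D) powr (1 / c) * y"
      using xyz k(1) D by (simp add: powr_mult powr_powr)
    also have "\<dots> \<le> max ((2 * D) powr (1 / c)) (2 * D) * (y + z)"
      using xyz D by (intro mult_mono) auto
    finally show ?thesis .
  next
    case False
    then have "D * (z * x powr (- 1)) \<ge> 1 / 2" using le1 by linarith
    then have "x \<le> 2 * D * z"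
      using xyz(4) by (simp add: powr_minus field_simps)
    also have "\<dots> \<le> max ((2 * D) powr (1 / c)) (2 * D) * (y + z)"
      using xyz D by (intro mult_mono) auto
    finally show ?thesis .
  qed
  then show ?thesis
    using xyz D by (simp add: ennreal_mult[symmetric] ennreal_plus[symmetric] ennreal_leI del: ennreal_plus)
qed

text \<open>The step from \<open>q = 1\<close> to general \<open>q\<close>. Let \<open>v\<close> be the \<open>m\<close>-th power of \<open>|u|\<close> truncated at \<open>N\<close>, and \<open>X\<close> its \<open>qs\<close>-norm, which is
  finite by the truncation. The assumption \<open>gag\<close> bounds the norm of \<open>v powr k\<close>, that is \<open>X powr k\<close>, by the integrals of \<open>v powr k\<close> and of
  \<open>v powr (k - 1)\<close> times the gradient. Hoelder's inequality interpolates the first one between the exponents 1 and \<open>qs\<close> and extracts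
  \<open>X powr (k - 1)\<close> from the second one, because \<open>(k - 1) q / (q - 1) = qs\<close> for \<open>q > 1\<close>. Now \<open>absorb_powers\<close> applies. The value of \<open>C\<close> is
  given explicitly to show that it depends neither on \<open>m\<close> nor on \<open>N\<close>.\<close>

lemma Sobolev_power_truncated:
  fixes M :: "'a measure" and u d :: "'a \<Rightarrow> real" and n q m N :: real
  assumes n: "n \<ge> 2" and q: "1 \<le> q" "q < n" and m: "m \<ge> 1" and N: "N > 0"
    and M: "finite_measure M" and [measurable]: "u \<in> borel_measurable M" "d \<in> borel_measurable M"
    and d: "\<And>x. d x \<ge> 0" and D: "D > 0"
  defines "p \<equiv> n / (n - 1)" and "k \<equiv> q * (n - 1) / (n - q)" and "qs \<equiv> n * q / (n - q)"
  assumes nonzero: "(\<integral>\<^sup>+x. ennreal (min \<bar>u x\<bar> N powr (m * qs)) \<partial>M) \<noteq> 0"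
    and gag: "(\<integral>\<^sup>+x. ennreal (min \<bar>u x\<bar> N powr (m * k)) epowr p \<partial>M)
      \<le> ennreal D * (\<integral>\<^sup>+x. ennreal (min \<bar>u x\<bar> N powr (m * k)
          + m * k * powr_one (min \<bar>u x\<bar> N) (m * k - 1) * d x) \<partial>M) epowr p"
  defines "C \<equiv> (let D' = D powr (1 / p); c = 1 - (k - 1) / (qs - 1) in k * max ((2 * D') powr (1 / c)) (2 * D'))"
  shows "(\<integral>\<^sup>+x. ennreal (min \<bar>u x\<bar> N powr (m * qs)) \<partial>M) epowr (1 / qs)
    \<le> ennreal C * ((\<integral>\<^sup>+x. ennreal (\<bar>u x\<bar> powr m) \<partial>M)
        + ennreal m * (\<integral>\<^sup>+x. ennreal ((powr_one \<bar>u x\<bar> (m - 1) * d x) powr q) \<partial>M) epowr (1 / q))"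
proof -
  interpret finite_measure M by fact
  define v where "v = (\<lambda>x. min \<bar>u x\<bar> N powr m)"
  define a where "a = (\<lambda>x. powr_one \<bar>u x\<bar> (m - 1) * d x)"
  have a0: "a x \<ge> 0" and v0: "v x \<ge> 0" for x using d by (simp_all add: a_def v_def powr_one_def)
  have [measurable]: "v \<in> borel_measurable M" "a \<in> borel_measurable M"
    unfolding v_def a_def powr_one_def by measurable
  have nq: "n - q > 0" "n - 1 > 0" using q n by auto
  have p: "p > 1" using n by (simp add: p_def)
  have k: "k \<ge> 1" using q n by (simp add: k_def field_simps)
  have kp: "k * p = qs" unfolding k_def p_def qs_def using nq by simp
  have qs: "qs > k" "qs > 1" using p k kp by (smt (verit) mult_less_cancel_left1)+
  define c where "c = 1 - (k - 1) / (qs - 1)"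
  have c: "0 < c" "c \<le> 1" using k qs by (auto simp: c_def divide_less_eq)
  with k have ck: "c \<le> k" by linarith
  have "(1 - c) * (qs - 1) = k - 1" using qs by (simp add: c_def)
  then have cq: "qs * (1 - c) = k - c" by (simp add: algebra_simps)
  define Y where "Y = (\<integral>\<^sup>+x. ennreal (v x) \<partial>M)"
  define A where "A = (\<integral>\<^sup>+x. ennreal (a x powr q) \<partial>M) epowr (1 / q)"
  define I where "I = (\<integral>\<^sup>+x. ennreal (v x powr qs) \<partial>M)"
  define X where "X = I epowr (1 / qs)"
  have X_pow: "X epowr e = I epowr (e / qs)" for e by (simp add: X_def epowr_epowr)
  have I_fin: "I < top"
  proof -
    have "I \<le> (\<integral>\<^sup>+x. ennreal ((N powr m) powr qs) \<partial>M)"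
      unfolding I_def v_def using N m qs by (intro nn_integral_mono ennreal_leI powr_mono2) auto
    also have "\<dots> < top"
      by (simp add: emeasure_eq_measure ennreal_mult_less_top)
    finally show ?thesis .
  qed
  then have X_fin: "X \<noteq> top" by (simp add: X_def less_top)
  have "I \<noteq> 0"
    using nonzero by (simp add: I_def v_def powr_powr)
  \<comment> \<open>For \<open>k = 1\<close> the power \<open>X powr 0\<close> occurs, which would be 0 for \<open>X = 0\<close>.\<close>
  then have X_pow_0: "X epowr 0 = 1"
    using X_fin by (cases X) (auto simp: X_def)
  have hoelder_v: "(\<integral>\<^sup>+x. ennreal (v x powr k) \<partial>M) \<le> Y epowr c * X epowr (k - c)"
  proof (cases "k = 1")
    case True
    then show ?thesis
      using v0 by (simp add: Y_def c_def X_pow_0)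
  next
    case False
    have "(\<integral>\<^sup>+x. ennreal (v x powr k) \<partial>M) = (\<integral>\<^sup>+x. ennreal (v x) epowr c * ennreal (v x powr qs) epowr (1 - c) \<partial>M)"
    proof (rule nn_integral_cong)
      fix x
      have "c + qs * (1 - c) = k" using cq by simp
      then show "ennreal (v x powr k) = ennreal (v x) epowr c * ennreal (v x powr qs) epowr (1 - c)"
        using v0[of x] by (simp add: powr_powr ennreal_mult[symmetric] powr_add[symmetric])
    qed
    also have "\<dots> \<le> Y epowr c * I epowr (1 - c)"
      unfolding Y_def I_def using c False k qs
      by (intro nn_integral_Holder_pair) (auto simp: c_def)
    also have "I epowr (1 - c) = X epowr (k - c)"
      unfolding X_pow using qs cq by (intro arg_cong[where f="\<lambda>e. I epowr e"]) (simp add: field_simps)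
    finally show ?thesis .
  qed
  have hoelder_a: "(\<integral>\<^sup>+x. ennreal (powr_one (v x) (k - 1) * a x) \<partial>M) \<le> X epowr (k - 1) * A"
  proof (cases "q = 1")
    case True
    then have k1: "k = 1" using n by (simp add: k_def)
    then show ?thesis
      using True a0 by (simp add: A_def powr_one_def X_pow_0)
  next
    case False
    then have k1: "k \<noteq> 1" using q nq by (simp add: k_def divide_eq_1_iff) (simp add: algebra_simps)
    have kq: "qs * (1 - 1 / q) = k - 1"
    proof -
      have "qs * (1 - 1 / q) = n * (q - 1) / (n - q)"
        using q by (simp add: qs_def field_simps)
      also have "\<dots> = k - 1"
      proof -
        have "k * (n - q) = q * (n - 1)" using nq by (simp add: k_def)
        then have "n * (q - 1) = (k - 1) * (n - q)" by (simp add: algebra_simps)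
        then show ?thesis using nq by simp
      qed
      finally show ?thesis .
    qed
    have "(\<integral>\<^sup>+x. ennreal (powr_one (v x) (k - 1) * a x) \<partial>M)
        = (\<integral>\<^sup>+x. ennreal (v x powr qs) epowr (1 - 1 / q) * ennreal (a x powr q) epowr (1 / q) \<partial>M)"
    proof (rule nn_integral_cong)
      fix x
      show "ennreal (powr_one (v x) (k - 1) * a x) = ennreal (v x powr qs) epowr (1 - 1 / q) * ennreal (a x powr q) epowr (1 / q)"
        using v0[of x] a0[of x] q k1 by (simp add: powr_one_def powr_powr kq ennreal_mult)
    qed
    also have "\<dots> \<le> I epowr (1 - 1 / q) * (\<integral>\<^sup>+x. ennreal (a x powr q) \<partial>M) epowr (1 / q)"
      unfolding I_def using q False by (intro nn_integral_Holder_pair) auto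
    also have "I epowr (1 - 1 / q) = X epowr (k - 1)"
      unfolding X_pow using qs kq by (intro arg_cong[where f="\<lambda>e. I epowr e"]) (simp add: field_simps)
    finally show ?thesis by (simp add: A_def)
  qed
  have slope: "powr_one (min \<bar>u x\<bar> N) (m * k - 1) * d x \<le> powr_one (v x) (k - 1) * a x" for x
  proof -
    let ?t = "min \<bar>u x\<bar> N"
    have t: "0 \<le> ?t" "?t \<le> \<bar>u x\<bar>" using N by auto
    have "powr_one ?t (m * k - 1) = powr_one (v x) (k - 1) * powr_one ?t (m - 1)"
    proof (cases "k = 1 \<or> m = 1")
      case True
      then show ?thesis using t(1) by (auto simp: powr_one_def v_def abs_of_nonneg)
    next
      case False
      then have "m * k - 1 > 0" using m k by (smt (verit) mult_less_cancel_left1)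
      moreover have eq: "m * k - 1 = m * (k - 1) + (m - 1)" by (simp add: algebra_simps)
      have "?t powr (m * k - 1) = ?t powr (m * (k - 1)) * ?t powr (m - 1)"
        unfolding eq by (rule powr_add)
      ultimately show ?thesis
        using False by (simp add: powr_one_def v_def powr_powr)
    qed
    also have "\<dots> \<le> powr_one (v x) (k - 1) * powr_one \<bar>u x\<bar> (m - 1)"
      using t m by (intro mult_left_mono) (auto simp: powr_one_def intro!: powr_mono2)
    finally show ?thesis using d by (simp add: a_def mult_right_mono flip: mult.assoc)
  qed
  let ?w = "\<lambda>x. min \<bar>u x\<bar> N powr (m * k) + m * k * powr_one (min \<bar>u x\<bar> N) (m * k - 1) * d x"
  let ?D = "D powr (1 / p)"
  have "X epowr k = I epowr (1 / p)"
    unfolding X_pow using kp k p by (intro arg_cong[where f="\<lambda>e. I epowr e"]) (auto simp: field_simps)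
  also have "I = (\<integral>\<^sup>+x. ennreal (min \<bar>u x\<bar> N powr (m * k)) epowr p \<partial>M)"
    unfolding I_def by (intro nn_integral_cong) (simp add: v_def powr_powr kp mult.assoc)
  also have "\<dots> epowr (1 / p) \<le> (ennreal D * (\<integral>\<^sup>+x. ennreal (?w x) \<partial>M) epowr p) epowr (1 / p)"
    using p by (intro epowr_mono gag) auto
  also have "\<dots> = ennreal ?D * (\<integral>\<^sup>+x. ennreal (?w x) \<partial>M)"
    using p D by (simp add: epowr_mult epowr_epowr)
  also have "\<dots> \<le> ennreal ?D * (\<integral>\<^sup>+x. ennreal (v x powr k) + ennreal (m * k) * ennreal (powr_one (v x) (k - 1) * a x) \<partial>M)"
  proof (intro mult_left_mono nn_integral_mono)
    fix x
    have "?w x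
        \<le> v x powr k + m * k * (powr_one (v x) (k - 1) * a x)"
      using slope[of x] m k by (simp add: v_def powr_powr mult.assoc)
    then have "ennreal (?w x)
        \<le> ennreal (v x powr k + m * k * (powr_one (v x) (k - 1) * a x))"
      by (rule ennreal_leI)
    also have "\<dots> = ennreal (v x powr k) + ennreal (m * k) * ennreal (powr_one (v x) (k - 1) * a x)"
      using m k a0[of x] by (subst ennreal_plus) (auto simp: ennreal_mult powr_one_def)
    finally show "ennreal (?w x) \<le> \<dots>" .
  qed auto
  also have "\<dots> = ennreal ?D * ((\<integral>\<^sup>+x. ennreal (v x powr k) \<partial>M)
      + ennreal (m * k) * (\<integral>\<^sup>+x. ennreal (powr_one (v x) (k - 1) * a x) \<partial>M))"
    by (subst nn_integral_add) (auto simp: nn_integral_cmult powr_one_def)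
  also have "\<dots> \<le> ennreal ?D * (Y epowr c * X epowr (k - c) + ennreal (m * k) * (X epowr (k - 1) * A))"
    by (intro mult_left_mono add_mono hoelder_v hoelder_a) auto
  finally have "X epowr k \<le> ennreal ?D * (Y epowr c * X epowr (k - c) + (ennreal (m * k) * A) * X epowr (k - 1))"
    by (simp add: mult_ac)
  then have "X \<le> ennreal (max ((2 * ?D) powr (1 / c)) (2 * ?D)) * (Y + ennreal (m * k) * A)"
    using X_fin D c ck k by (intro absorb_powers) auto
  also have "\<dots> \<le> ennreal (max ((2 * ?D) powr (1 / c)) (2 * ?D)) * (ennreal k * (Y + ennreal m * A))"
  proof (intro mult_left_mono)
    have "1 * Y \<le> ennreal k * Y" using k by (intro mult_right_mono) auto
    then show "Y + ennreal (m * k) * A \<le> ennreal k * (Y + ennreal m * A)"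
      using m k by (simp add: distrib_left ennreal_mult mult_ac)
  qed auto
  also have "\<dots> = ennreal C * (Y + ennreal m * A)"
  proof -
    have "ennreal C = ennreal (max ((2 * ?D) powr (1 / c)) (2 * ?D)) * ennreal k"
      using k D by (simp add: C_def Let_def c_def[symmetric] ennreal_mult le_max_iff_disj mult.commute)
    then show ?thesis by (simp only: mult.assoc)
  qed
  also have "\<dots> \<le> ennreal C * ((\<integral>\<^sup>+x. ennreal (\<bar>u x\<bar> powr m) \<partial>M) + ennreal m * A)"
    unfolding Y_def v_def using N m
    by (intro mult_left_mono add_right_mono nn_integral_mono ennreal_leI powr_mono2) auto
  finally show ?thesis
    unfolding X_def I_def A_def a_def v_def by (simp add: powr_powr)
qed

text \<open>The bounds for the truncations at \<open>N\<close> are uniform, and \<open>N \<rightarrow> \<infinity>\<close> is a monotone limit.\<close>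

lemma Sobolev_power_inequality:
  fixes U :: "'a::euclidean_space set"
  assumes U: "open U" "bounded U" "C1_boundary U" and dim: "DIM('a) \<ge> 2"
  defines "n \<equiv> real DIM('a)"
  assumes q: "1 \<le> q" "q < n"
  defines "qs \<equiv> n * q / (n - q)"
  shows "\<exists>C>0. \<forall>m u Du. m \<ge> 1 \<longrightarrow> in_W1_with_gradient U (q * m) u Du \<longrightarrow>
    integral_on U (\<lambda>x. \<bar>u x\<bar> powr (m * qs)) epowr (1 / qs)
    \<le> ennreal C * (integral_on U (\<lambda>x. \<bar>u x\<bar> powr m) +
        ennreal m * integral_on U (\<lambda>x. (powr_one \<bar>u x\<bar> (m - 1) * norm (Du x)) powr q) epowr (1 / q))"
proof -
  have n: "n \<ge> 2" using dim by (simp add: n_def)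
  define p where "p = n / (n - 1)"
  define k where "k = q * (n - 1) / (n - q)"
  have k: "k \<ge> 1" using q n by (simp add: k_def field_simps)
  have qs: "qs > 0" using q n by (simp add: qs_def)
  obtain D where D: "D > 0" and gag: "\<And>q' u Du F L. q' \<ge> 1 \<Longrightarrow> in_W1_with_gradient U q' u Du \<Longrightarrow> slope_dominated F L \<Longrightarrow>
    (\<integral>\<^sup>+x. ennreal (F (u x)) epowr p \<partial>lebesgue_on U)
      \<le> ennreal D * (\<integral>\<^sup>+x. ennreal (F (u x) + L (u x) * norm (Du x)) \<partial>lebesgue_on U) epowr p"
    using Gagliardo_estimate_domain[OF U dim] unfolding p_def n_def by blast
  define C where "C = (let D' = D powr (1 / p); c = 1 - (k - 1) / (qs - 1) in k * max ((2 * D') powr (1 / c)) (2 * D'))"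
  have fin: "finite_measure (lebesgue_on U)"
    using U by (intro finite_measure_lebesgue_on lmeasurable_open) auto
  show ?thesis
  proof (rule exI[of _ C], intro conjI allI impI)
    show "C > 0" using D k by (simp add: C_def Let_def less_max_iff_disj)
    fix m u Du assume m: "m \<ge> 1" and W: "in_W1_with_gradient U (q * m) u Du"
    have [measurable]: "u \<in> borel_measurable (lebesgue_on U)" "Du \<in> borel_measurable (lebesgue_on U)"
      using W by (auto simp: in_W1_with_gradient_def in_Lq_def)
    let ?R = "ennreal C * (integral_on U (\<lambda>x. \<bar>u x\<bar> powr m) +
        ennreal m * integral_on U (\<lambda>x. (powr_one \<bar>u x\<bar> (m - 1) * norm (Du x)) powr q) epowr (1 / q))"
    let ?f = "\<lambda>N x. ennreal (min \<bar>u x\<bar> (real N) powr (m * qs))"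
    have "(\<integral>\<^sup>+x. ?f N x \<partial>lebesgue_on U) \<le> ?R epowr qs" for N :: nat
    proof (cases "N = 0 \<or> (\<integral>\<^sup>+x. ?f N x \<partial>lebesgue_on U) = 0")
      case True
      then show ?thesis using m qs by auto
    next
      case False
      have mk: "m * k \<ge> 1" using m k by (smt (verit) mult_le_cancel_left1)
      have "q * m \<ge> 1" using q m by (smt (verit) mult_le_cancel_left1)
      from gag[OF this W slope_dominated_truncated_power[OF mk, of "real N"], unfolded k_def p_def] False
      have "(\<integral>\<^sup>+x. ?f N x \<partial>lebesgue_on U) epowr (1 / qs) \<le> ?R"
        unfolding C_def qs_def p_def k_def integral_on_def
        by (intro Sobolev_power_truncated[OF n q m _ fin _ _ _ D, where N="real N" and d="\<lambda>x. norm (Du x)"])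
           (auto simp: qs_def)
      then have "((\<integral>\<^sup>+x. ?f N x \<partial>lebesgue_on U) epowr (1 / qs)) epowr qs \<le> ?R epowr qs"
        using qs by (rule epowr_mono[rotated])
      then show ?thesis using qs by (simp add: epowr_epowr)
    qed
    moreover have "(\<lambda>N. \<integral>\<^sup>+x. ?f N x \<partial>lebesgue_on U) \<longlonglongrightarrow> integral_on U (\<lambda>x. \<bar>u x\<bar> powr (m * qs))"
      unfolding integral_on_def
    proof (rule nn_integral_LIMSEQ)
      show "incseq ?f"
        using m qs by (auto simp: incseq_def le_fun_def intro!: ennreal_leI powr_mono2)
      show "(\<lambda>N. ?f N x) \<longlonglongrightarrow> ennreal (\<bar>u x\<bar> powr (m * qs))" for x
      proof (rule tendsto_eventually)
        obtain N0 where "\<bar>u x\<bar> \<le> real N0" using real_arch_simple by blast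
        then show "\<forall>\<^sub>F N in sequentially. ?f N x = ennreal (\<bar>u x\<bar> powr (m * qs))"
          by (intro eventually_sequentiallyI[of N0]) (auto simp: min_def)
      qed
    qed auto
    ultimately have "integral_on U (\<lambda>x. \<bar>u x\<bar> powr (m * qs)) \<le> ?R epowr qs"
      by (intro LIMSEQ_le_const2) auto
    then have "integral_on U (\<lambda>x. \<bar>u x\<bar> powr (m * qs)) epowr (1 / qs) \<le> (?R epowr qs) epowr (1 / qs)"
      using qs by (intro epowr_mono) auto
    then show "integral_on U (\<lambda>x. \<bar>u x\<bar> powr (m * qs)) epowr (1 / qs) \<le> ?R"
      using qs by (simp add: epowr_epowr)
  qed
qed

section \<open>Weighted Hoelder estimates and the interpolation inequality\<close>

lemma nn_integral_Holder_triple: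
  assumes "a > 0" "b > 0" "c > 0" "a + b + c = (1::real)"
    and "f \<in> borel_measurable M" "g \<in> borel_measurable M" "h \<in> borel_measurable M"
  shows "(\<integral>\<^sup>+x. f x epowr a * (g x epowr b * h x epowr c) \<partial>M)
    \<le> (\<integral>\<^sup>+x. f x \<partial>M) epowr a * ((\<integral>\<^sup>+x. g x \<partial>M) epowr b * (\<integral>\<^sup>+x. h x \<partial>M) epowr c)"
proof -
  have "(\<integral>\<^sup>+x. (\<Prod>i\<in>{0, 1, 2 :: nat}. ([f, g, h] ! i) x epowr ([a, b, c] ! i)) \<partial>M)
      \<le> (\<Prod>i\<in>{0, 1, 2 :: nat}. (\<integral>\<^sup>+x. ([f, g, h] ! i) x \<partial>M) epowr ([a, b, c] ! i))"
    by (rule nn_integral_Holder) (use assms in \<open>auto simp: add.assoc\<close>)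
  then show ?thesis by simp
qed

lemma epowr_sum_le:
  fixes x y :: ennreal
  assumes "s > 0"
  shows "(x + y) epowr s \<le> ennreal (2 powr s) * (x epowr s + y epowr s)"
proof -
  have *: "(x + y) epowr s \<le> ennreal (2 powr s) * (x epowr s + y epowr s)" if "y \<le> x" for x y
  proof -
    have "x + y \<le> ennreal 2 * x" using add_left_mono[OF that, of x] by (simp add: mult_2)
    then have "(x + y) epowr s \<le> (ennreal 2 * x) epowr s" using assms by (rule epowr_mono[rotated])
    also have "\<dots> = ennreal (2 powr s) * x epowr s"
      using epowr_ennreal[of 2 s] by (simp only: epowr_mult[OF assms])
    also have "\<dots> \<le> ennreal (2 powr s) * (x epowr s + y epowr s)" by (intro mult_left_mono) auto
    finally show ?thesis .
  qed
  show ?thesis using *[of y x] *[of x y] by (cases "y \<le> x") (auto simp: add.commute)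
qed

lemma epowr_le_sum:
  assumes "0 < a" "a \<le> b" "b \<le> c"
  shows "x epowr b \<le> x epowr a + x epowr c"
proof (cases x)
  case (real t)
  have "t powr b \<le> t powr a + t powr c"
  proof (cases "t \<ge> 1")
    case True
    then have "t powr b \<le> t powr c" using assms by (intro powr_mono) auto
    then show ?thesis by (simp add: add_increasing)
  next
    case False
    then have "t powr b \<le> t powr a" using assms real by (intro powr_mono') auto
    then show ?thesis by (simp add: add_increasing2)
  qed
  then show ?thesis using real by (simp add: ennreal_leI flip: ennreal_plus)
qed simp

lemma epowr_le_epowr_ge_1:
  assumes "0 < a" "a \<le> b" "1 \<le> x" shows "x epowr a \<le> x epowr b"
  using assms by (cases x) (auto intro!: ennreal_leI powr_mono simp: ennreal_le_iff2 simp flip: ennreal_1)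

lemma Young_epowr_le_sum:
  fixes x y :: ennreal
  assumes "0 < t" "t < 1" shows "x epowr t * y epowr (1 - t) \<le> x + y"
proof -
  have "x epowr t * y epowr (1 - t) \<le> (x + y) epowr t * (x + y) epowr (1 - t)"
    using assms by (intro mult_mono epowr_mono) auto
  then show ?thesis by (simp add: epowr_add)
qed

lemma Young_epowr_epsilon:
  fixes x y :: ennreal
  assumes t: "0 < t" "t < 1" and e: "e > 0"
  shows "x epowr t * y epowr (1 - t) \<le> ennreal e * x + ennreal (e powr (- (t / (1 - t)))) * y"
proof -
  have "x epowr t * y epowr (1 - t)
      = (ennreal e * x) epowr t * (ennreal (e powr (- (t / (1 - t)))) * y) epowr (1 - t)"
  proof -
    have "e powr t * (e powr (- (t / (1 - t)))) powr (1 - t) = 1"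
      using t e by (simp add: powr_powr flip: powr_add)
    then have "ennreal (e powr t) * ennreal ((e powr (- (t / (1 - t)))) powr (1 - t)) = 1"
      by (simp flip: ennreal_mult)
    moreover have "(ennreal e * x) epowr t * (ennreal (e powr (- (t / (1 - t)))) * y) epowr (1 - t)
      = (ennreal (e powr t) * ennreal ((e powr (- (t / (1 - t)))) powr (1 - t))) * (x epowr t * y epowr (1 - t))"
      using t e by (simp add: epowr_mult mult_ac)
    ultimately show ?thesis by simp
  qed
  also have "\<dots> \<le> ennreal e * x + ennreal (e powr (- (t / (1 - t)))) * y"
    by (rule Young_epowr_le_sum[OF t])
  finally show ?thesis .
qed

lemma weighted_interpolation:
  fixes u \<phi> \<omega> :: "'a \<Rightarrow> real"
  assumes [measurable]: "u \<in> borel_measurable M" "\<phi> \<in> borel_measurable M" "\<omega> \<in> borel_measurable M"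
    and pos: "\<And>x. x \<in> space M \<Longrightarrow> \<phi> x > 0" "\<And>x. x \<in> space M \<Longrightarrow> \<omega> x \<ge> 0"
    and \<kappa>: "\<kappa> > 0" and \<tau>: "\<tau> > 0" "\<tau> + \<kappa> + \<kappa> = 1" and e: "e = l * \<tau> + \<alpha> * \<kappa>"
  shows "(\<integral>\<^sup>+x. ennreal (\<bar>u x\<bar> powr e * \<omega> x) \<partial>M)
    \<le> (\<integral>\<^sup>+x. ennreal (\<bar>u x\<bar> powr l) \<partial>M) epowr \<tau> *
      ((\<integral>\<^sup>+x. ennreal (\<bar>u x\<bar> powr \<alpha> * \<phi> x) \<partial>M) epowr \<kappa> *
       (\<integral>\<^sup>+x. ennreal (inverse (\<phi> x) * \<omega> x powr (1 / \<kappa>)) \<partial>M) epowr \<kappa>)" (is "?L \<le> ?R")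
proof -
  have "?L =
    (\<integral>\<^sup>+x. ennreal (\<bar>u x\<bar> powr l) epowr \<tau> * (ennreal (\<bar>u x\<bar> powr \<alpha> * \<phi> x) epowr \<kappa>
       * ennreal (inverse (\<phi> x) * \<omega> x powr (1 / \<kappa>)) epowr \<kappa>) \<partial>M)"
  proof (rule nn_integral_cong)
    fix x assume x: "x \<in> space M"
    have "\<phi> x powr \<kappa> * inverse (\<phi> x) powr \<kappa> = 1"
      using pos(1)[OF x] by (simp flip: powr_mult)
    moreover have "(\<omega> x powr (1 / \<kappa>)) powr \<kappa> = \<omega> x"
      using pos(2)[OF x] \<kappa> by (simp add: powr_powr)
    ultimately have "(\<bar>u x\<bar> powr l) powr \<tau> * ((\<bar>u x\<bar> powr \<alpha> * \<phi> x) powr \<kappa> * (inverse (\<phi> x) * \<omega> x powr (1 / \<kappa>)) powr \<kappa>)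
      = \<bar>u x\<bar> powr e * \<omega> x"
      using pos(1)[OF x] by (simp add: powr_mult powr_powr e powr_add)
    then show "ennreal (\<bar>u x\<bar> powr e * \<omega> x) = ennreal (\<bar>u x\<bar> powr l) epowr \<tau> *
       (ennreal (\<bar>u x\<bar> powr \<alpha> * \<phi> x) epowr \<kappa> * ennreal (inverse (\<phi> x) * \<omega> x powr (1 / \<kappa>)) epowr \<kappa>)"
      using pos(1)[OF x] by (simp flip: ennreal_mult)
  qed
  also have "\<dots> \<le> ?R"
    by (rule nn_integral_Holder_triple) (use \<kappa> \<tau> in auto)
  finally show ?thesis .
qed

lemma weighted_lower_power:
  fixes u \<phi> :: "'a \<Rightarrow> real"
  assumes [measurable]: "u \<in> borel_measurable M" "\<phi> \<in> borel_measurable M"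
    and pos: "\<And>x. x \<in> space M \<Longrightarrow> \<phi> x > 0" and m: "0 < m" "m < \<alpha>"
  shows "(\<integral>\<^sup>+x. ennreal (\<bar>u x\<bar> powr m) \<partial>M)
    \<le> (\<integral>\<^sup>+x. ennreal (\<bar>u x\<bar> powr \<alpha> * \<phi> x) \<partial>M) epowr (m / \<alpha>) *
      (\<integral>\<^sup>+x. ennreal (\<phi> x powr (- (m / (\<alpha> - m)))) \<partial>M) epowr (1 - m / \<alpha>)" (is "?L \<le> ?R")
proof -
  have "?L = (\<integral>\<^sup>+x. ennreal (\<bar>u x\<bar> powr \<alpha> * \<phi> x) epowr (m / \<alpha>) *
      ennreal (\<phi> x powr (- (m / (\<alpha> - m)))) epowr (1 - m / \<alpha>) \<partial>M)"
  proof (rule nn_integral_cong)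
    fix x assume x: "x \<in> space M"
    have e: "- (m / (\<alpha> - m)) * (1 - m / \<alpha>) = - (m / \<alpha>)" using m by (simp add: field_simps)
    have "\<phi> x powr (m / \<alpha>) * (\<phi> x powr (- (m / (\<alpha> - m)))) powr (1 - m / \<alpha>) = 1"
      using pos[OF x] unfolding powr_powr e by (simp flip: powr_add)
    then have "(\<bar>u x\<bar> powr \<alpha> * \<phi> x) powr (m / \<alpha>) * (\<phi> x powr (- (m / (\<alpha> - m)))) powr (1 - m / \<alpha>) = \<bar>u x\<bar> powr m"
      using pos[OF x] m by (simp add: powr_mult powr_powr mult.assoc)
    then show "ennreal (\<bar>u x\<bar> powr m) = ennreal (\<bar>u x\<bar> powr \<alpha> * \<phi> x) epowr (m / \<alpha>) *
      ennreal (\<phi> x powr (- (m / (\<alpha> - m)))) epowr (1 - m / \<alpha>)"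
      using pos[OF x] by (simp flip: ennreal_mult)
  qed
  also have "\<dots> \<le> ?R"
    using m by (intro nn_integral_Holder_pair) (auto simp: field_simps)
  finally show ?thesis .
qed

text \<open>The weights are inserted by the factorization
  \<open>1 = (1 + |u|) powr (- r \<beta>) \<cdot> (1 + |u|) powr (r \<beta>) \<cdot> \<phi> powr (r \<beta> / \<alpha>) \<cdot> \<phi> powr (- r \<beta> / \<alpha>) \<cdot> W powr r \<cdot> W powr (- r)\<close>.
  Grouped suitably, it leaves three factors with the exponents \<open>r\<close>, \<open>r \<beta> / \<alpha>\<close> and \<open>D / \<alpha>\<close>, whose sum is 1.\<close>

lemma weighted_gradient_power:
  fixes u d \<phi> W :: "'a \<Rightarrow> real"
  assumes [measurable]: "u \<in> borel_measurable M" "\<phi> \<in> borel_measurable M" "W \<in> borel_measurable M"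
      "d \<in> borel_measurable M"
    and pos: "\<And>x. x \<in> space M \<Longrightarrow> \<phi> x > 0" "\<And>x. x \<in> space M \<Longrightarrow> W x > 0" "\<And>x. d x \<ge> 0"
    and p: "p > 1" and r: "0 < r" "r < 1" and \<alpha>: "\<alpha> > 0" "\<beta> > 0" "\<alpha> * (1 - r) - r * \<beta> > 0" "\<alpha> \<ge> s"
  defines "m \<equiv> (\<alpha> - s + p) / p" and "D \<equiv> \<alpha> * (1 - r) - r * \<beta>"
  shows "(\<integral>\<^sup>+x. ennreal ((powr_one \<bar>u x\<bar> (m - 1) * d x) powr (r * p)) \<partial>M) epowr (1 / r)
    \<le> (\<integral>\<^sup>+x. ennreal (powr_one \<bar>u x\<bar> (\<alpha> - s) / (1 + \<bar>u x\<bar>) powr \<beta> * d x powr p * W x) \<partial>M) *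
      ((\<integral>\<^sup>+x. ennreal ((1 + \<bar>u x\<bar>) powr \<alpha> * \<phi> x) \<partial>M) epowr (\<beta> / \<alpha>) *
       (\<integral>\<^sup>+x. ennreal (\<phi> x powr (- (r * \<beta> / D)) * W x powr (- (r * \<alpha> / D))) \<partial>M) epowr (D / (\<alpha> * r)))"
    (is "_ \<le> ?K * (?J epowr _ * ?G epowr _)")
proof -
  let ?l = "\<lambda>x. (powr_one \<bar>u x\<bar> (m - 1) * d x) powr (r * p)"
    and ?k = "\<lambda>x. powr_one \<bar>u x\<bar> (\<alpha> - s) / (1 + \<bar>u x\<bar>) powr \<beta> * d x powr p * W x"
    and ?j = "\<lambda>x. (1 + \<bar>u x\<bar>) powr \<alpha> * \<phi> x"
    and ?g = "\<lambda>x. \<phi> x powr (- (r * \<beta> / D)) * W x powr (- (r * \<alpha> / D))"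
  have D: "D > 0" using \<alpha> by (simp add: D_def)
  have sum1: "r + r * \<beta> / \<alpha> + D / \<alpha> = 1" using \<alpha> by (simp add: D_def field_simps)
  have [measurable]: "(\<lambda>x. powr_one \<bar>u x\<bar> e) \<in> borel_measurable M" for e
    unfolding powr_one_def by measurable
  have "(\<integral>\<^sup>+x. ennreal (?l x) \<partial>M)
      = (\<integral>\<^sup>+x. ennreal (?k x) epowr r *
      (ennreal (?j x) epowr (r * \<beta> / \<alpha>) *
       ennreal (?g x) epowr (D / \<alpha>)) \<partial>M)"
  proof (rule nn_integral_cong)
    fix x assume x: "x \<in> space M"
    have u1: "1 + \<bar>u x\<bar> > 0" by simp
    have one: "powr_one \<bar>u x\<bar> (m - 1) powr (r * p) = powr_one \<bar>u x\<bar> (\<alpha> - s) powr r"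
    proof -
      have "(m - 1) * p = \<alpha> - s" using p by (simp add: m_def field_simps)
      then have e: "(m - 1) * (r * p) = (\<alpha> - s) * r" and z: "m - 1 = 0 \<longleftrightarrow> \<alpha> - s = 0"
        using p by (simp add: mult.left_commute[of _ r], auto)
      show ?thesis
      proof (cases "m - 1 = 0")
        case False
        have "powr_one \<bar>u x\<bar> (m - 1) powr (r * p) = \<bar>u x\<bar> powr ((m - 1) * (r * p))"
          using False by (simp add: powr_one_def powr_powr)
        also have "\<dots> = powr_one \<bar>u x\<bar> (\<alpha> - s) powr r"
          unfolding e using False z by (simp add: powr_one_def powr_powr)
        finally show ?thesis .
      qed (use z in \<open>simp add: powr_one_def\<close>)
    qed
    have k1: "powr_one \<bar>u x\<bar> e \<ge> 0" for e by (simp add: powr_one_def)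
    have f: "(?k x) powr r
        = powr_one \<bar>u x\<bar> (\<alpha> - s) powr r * (1 + \<bar>u x\<bar>) powr (- (r * \<beta>)) * d x powr (r * p) * W x powr r"
    proof -
      have "y / (1 + \<bar>u x\<bar>) powr \<beta> = y * (1 + \<bar>u x\<bar>) powr (- \<beta>)" for y
        by (simp add: powr_minus divide_inverse)
      then show ?thesis
        using k1 pos(2)[OF x] by (simp add: powr_mult powr_powr mult.commute[of r])
    qed
    have g: "(?j x) powr (r * \<beta> / \<alpha>) = (1 + \<bar>u x\<bar>) powr (r * \<beta>) * \<phi> x powr (r * \<beta> / \<alpha>)"
      using \<alpha> pos(1)[OF x] by (simp add: powr_mult powr_powr)
    have h: "(?g x) powr (D / \<alpha>) = \<phi> x powr (- (r * \<beta> / \<alpha>)) * W x powr (- r)"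
      using D \<alpha> by (simp add: powr_mult powr_powr)
    have cancel: "y powr (- e) * y powr e = 1" if "y > 0" for y e :: real
      using that by (simp flip: powr_add)
    have "?l x = powr_one \<bar>u x\<bar> (\<alpha> - s) powr r * d x powr (r * p)"
      using k1 pos(3) by (simp add: powr_mult one)
    also have "\<dots> = (powr_one \<bar>u x\<bar> (\<alpha> - s) powr r * d x powr (r * p)) *
        ((1 + \<bar>u x\<bar>) powr (- (r * \<beta>)) * (1 + \<bar>u x\<bar>) powr (r * \<beta>)) *
        (\<phi> x powr (- (r * \<beta> / \<alpha>)) * \<phi> x powr (r * \<beta> / \<alpha>)) * (W x powr (- r) * W x powr r)"
      using cancel[OF u1] cancel[OF pos(1)[OF x]] cancel[OF pos(2)[OF x]] by simp
    also have "\<dots> = (?k x) powr r *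
      ((?j x) powr (r * \<beta> / \<alpha>) *
       (?g x) powr (D / \<alpha>))"
      unfolding f g h by (simp only: mult_ac)
    finally show "ennreal (?l x)
      = ennreal (?k x) epowr r *
      (ennreal (?j x) epowr (r * \<beta> / \<alpha>) *
       ennreal (?g x) epowr (D / \<alpha>))"
      using k1 pos(1)[OF x] pos(2)[OF x] by (simp flip: ennreal_mult)
  qed
  also have "\<dots> \<le> ?K epowr r * (?J epowr (r * \<beta> / \<alpha>) * ?G epowr (D / \<alpha>))"
    using r \<alpha> D sum1 by (intro nn_integral_Holder_triple) auto
  finally have "(\<integral>\<^sup>+x. ennreal (?l x) \<partial>M) epowr (1 / r)
      \<le> (?K epowr r * (?J epowr (r * \<beta> / \<alpha>) * ?G epowr (D / \<alpha>))) epowr (1 / r)"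
    using r by (intro epowr_mono) auto
  also have "\<dots> = ?K * (?J epowr (\<beta> / \<alpha>) * ?G epowr (D / (\<alpha> * r)))"
    using r by (simp add: epowr_mult epowr_epowr)
  finally show ?thesis .
qed

lemma shifted_power_integral_le:
  fixes u \<phi> :: "'a \<Rightarrow> real"
  assumes [measurable]: "u \<in> borel_measurable M" "\<phi> \<in> borel_measurable M"
    and pos: "\<And>x. x \<in> space M \<Longrightarrow> \<phi> x > 0" and \<alpha>: "\<alpha> > 0"
  shows "(\<integral>\<^sup>+x. ennreal ((1 + \<bar>u x\<bar>) powr \<alpha> * \<phi> x) \<partial>M)
    \<le> ennreal (2 powr \<alpha>) * ((1 + (\<integral>\<^sup>+x. ennreal (\<phi> x) \<partial>M)) * (1 + (\<integral>\<^sup>+x. ennreal (\<bar>u x\<bar> powr \<alpha> * \<phi> x) \<partial>M)))"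
proof -
  let ?A = "\<integral>\<^sup>+x. ennreal (\<phi> x) \<partial>M" and ?B = "\<integral>\<^sup>+x. ennreal (\<bar>u x\<bar> powr \<alpha> * \<phi> x) \<partial>M"
  have elem: "(1 + t) powr \<alpha> \<le> 2 powr \<alpha> * (1 + t powr \<alpha>)" if "t \<ge> 0" for t
  proof (cases "t \<le> 1")
    case True
    then have "(1 + t) powr \<alpha> \<le> 2 powr \<alpha>" using that \<alpha> by (intro powr_mono2) auto
    also have "\<dots> \<le> 2 powr \<alpha> * (1 + t powr \<alpha>)" by simp
    finally show ?thesis .
  next
    case False
    then have "(1 + t) powr \<alpha> \<le> (2 * t) powr \<alpha>" using \<alpha> by (intro powr_mono2) auto
    also have "\<dots> = 2 powr \<alpha> * t powr \<alpha>" using that by (simp add: powr_mult)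
    also have "\<dots> \<le> 2 powr \<alpha> * (1 + t powr \<alpha>)" by (intro mult_left_mono) auto
    finally show ?thesis .
  qed
  have pt: "(1 + \<bar>u x\<bar>) powr \<alpha> * \<phi> x \<le> 2 powr \<alpha> * (\<phi> x + \<bar>u x\<bar> powr \<alpha> * \<phi> x)" if "x \<in> space M" for x
    using mult_right_mono[OF elem[OF abs_ge_zero, of "u x"], of "\<phi> x"] pos[OF that]
    by (simp add: algebra_simps)
  have "(\<integral>\<^sup>+x. ennreal ((1 + \<bar>u x\<bar>) powr \<alpha> * \<phi> x) \<partial>M)
      \<le> (\<integral>\<^sup>+x. ennreal (2 powr \<alpha>) * (ennreal (\<phi> x) + ennreal (\<bar>u x\<bar> powr \<alpha> * \<phi> x)) \<partial>M)"
  proof (rule nn_integral_mono)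
    fix x assume x: "x \<in> space M"
    have "ennreal (2 powr \<alpha>) * (ennreal (\<phi> x) + ennreal (\<bar>u x\<bar> powr \<alpha> * \<phi> x))
        = ennreal (2 powr \<alpha> * (\<phi> x + \<bar>u x\<bar> powr \<alpha> * \<phi> x))"
      using pos[OF x] by (simp add: ennreal_mult ennreal_plus)
    then show "ennreal ((1 + \<bar>u x\<bar>) powr \<alpha> * \<phi> x)
        \<le> ennreal (2 powr \<alpha>) * (ennreal (\<phi> x) + ennreal (\<bar>u x\<bar> powr \<alpha> * \<phi> x))"
      using ennreal_leI[OF pt[OF x]] by simp
  qed
  also have "\<dots> = ennreal (2 powr \<alpha>) * (?A + ?B)"
    by (simp add: nn_integral_cmult nn_integral_add)
  also have "\<dots> \<le> ennreal (2 powr \<alpha>) * ((1 + ?A) * (1 + ?B))"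
  proof (intro mult_left_mono)
    have "a + b \<le> (1 + a) * (1 + b)" for a b :: ennreal
    proof -
      have "(a + b) + 0 \<le> (a + b) + (1 + a * b)" by (intro add_left_mono) simp
      also have "\<dots> = (1 + a) * (1 + b)" by (simp add: distrib_left distrib_right ac_simps)
      finally show ?thesis by simp
    qed
    then show "?A + ?B
      \<le> (1 + ?A) * (1 + ?B)" .
  qed auto
  finally show ?thesis .
qed

text \<open>Expanding \<open>(1 + J) powr g\<close> leaves the powers \<open>a\<close> and \<open>a + g\<close> of \<open>J\<close>; both lie between \<open>lo\<close> and \<open>hi\<close>, which costs the second factor 2.\<close>

lemma power_product_le_min:
  fixes J :: ennreal
  assumes "0 < lo" "lo \<le> a" "g > 0" "a + g \<le> hi"
  shows "(1 + J) epowr g * J epowr a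
    \<le> ennreal (2 powr (1 + g)) * min (J epowr lo + J epowr hi) ((1 + J) epowr hi)"
proof -
  let ?S = "J epowr lo + J epowr hi"
  have "(1 + J) epowr g * J epowr a \<le> ennreal (2 powr g) * (1 epowr g + J epowr g) * J epowr a"
    using assms by (intro mult_right_mono epowr_sum_le) auto
  also have "\<dots> = ennreal (2 powr g) * (J epowr a + J epowr (a + g))"
    by (simp add: distrib_left distrib_right mult.assoc epowr_add add.commute)
  also have "\<dots> \<le> ennreal (2 powr g) * (?S + ?S)"
    using assms by (intro mult_left_mono add_mono epowr_le_sum) auto
  also have "\<dots> = ennreal (2 powr (1 + g)) * ?S"
  proof -
    have "ennreal (2 powr (1 + g)) = ennreal (2 powr g) * 2"
      by (simp add: powr_add ennreal_mult mult.commute)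
    then show ?thesis by (simp only: mult_2[symmetric] mult.assoc)
  qed
  finally have 1: "(1 + J) epowr g * J epowr a \<le> ennreal (2 powr (1 + g)) * ?S" .
  have "(1 + J) epowr g * J epowr a \<le> (1 + J) epowr g * (1 + J) epowr a"
    using assms by (intro mult_left_mono epowr_mono) auto
  also have "\<dots> = (1 + J) epowr (a + g)" by (simp add: epowr_add add.commute)
  also have "\<dots> \<le> (1 + J) epowr hi" using assms by (intro epowr_le_epowr_ge_1) auto
  also have "\<dots> \<le> ennreal (2 powr (1 + g)) * (1 + J) epowr hi"
  proof -
    have "ennreal 1 \<le> ennreal (2 powr (1 + g))"
      using assms by (intro ennreal_leI) (simp add: ge_one_powr_ge_zero)
    then show ?thesis using mult_right_mono[of 1 "ennreal (2 powr (1 + g))" "(1 + J) epowr hi"] by simp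
  qed
  finally have 2: "(1 + J) epowr g * J epowr a \<le> ennreal (2 powr (1 + g)) * (1 + J) epowr hi" .
  show ?thesis using 1 2 by (simp add: min_def)
qed

lemma power_le_min:
  fixes J :: ennreal
  assumes "0 < lo" "lo \<le> a" "a \<le> hi"
  shows "J epowr a \<le> min (J epowr lo + J epowr hi) ((1 + J) epowr hi)"
proof -
  have "J epowr a \<le> (1 + J) epowr a" using assms by (intro epowr_mono) auto
  also have "\<dots> \<le> (1 + J) epowr hi" using assms by (intro epowr_le_epowr_ge_1) auto
  finally show ?thesis using assms by (simp add: epowr_le_sum)
qed

text \<open>The algebra that follows the Sobolev inequality, for one fixed function. The function enters only through
  the inequality \<open>Sobolev\<close>. The factor \<open>2 powr m\<close> inside \<open>D1\<close> and \<open>D2\<close> absorbs the factor 2 that is lost when the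
  power \<open>p \<theta>\<close> of a sum is split.\<close>

lemma interpolation_from_Sobolev:
  fixes U :: "'a::euclidean_space set" and Du :: "'a \<Rightarrow> 'a" and n p r1 r s \<alpha> \<beta> \<epsilon> C :: real
  assumes n: "n > 0" and p: "p > 1" and r1: "n / (n + p) < r1" "r1 < 1" "r1 * p < n"
    and r0: "r \<ge> 0" and \<beta>: "\<beta> > 0" and \<alpha>s: "\<alpha> \<ge> s"
    and \<alpha>: "\<alpha> > (p - s) / (p - 1)" "\<alpha> > 2 * (r + s - p) / r_star n p r1" "\<alpha> > r1 * \<beta> / (1 - r1)"
    and [measurable]: "\<phi> \<in> borel_measurable (lebesgue_on U)" "W \<in> borel_measurable (lebesgue_on U)"
      "\<omega> \<in> borel_measurable (lebesgue_on U)"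
    and weights: "\<forall>x\<in>U. \<phi> x > 0 \<and> W x > 0 \<and> \<omega> x \<ge> 0"
    and [measurable]: "u \<in> borel_measurable (lebesgue_on U)" "Du \<in> borel_measurable (lebesgue_on U)"
    and \<epsilon>: "\<epsilon> > 0" and C: "C > 0"
  defines "m \<equiv> m_exp p s \<alpha>" and "\<theta> \<equiv> theta n p r1 r s \<alpha>"
  defines "\<mu> \<equiv> mu1 p r s \<theta>" and "q \<equiv> r1 * p"
  defines "qs \<equiv> n * q / (n - q)"
  defines "lo \<equiv> 1 + mu2_hat r \<mu> / \<alpha>" and "hi \<equiv> 1 + mu3_hat r \<beta> \<theta> \<mu> / \<alpha>"
  defines "J \<equiv> integral_on U (\<lambda>x. \<bar>u x\<bar> powr \<alpha> * \<phi> x)"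
  assumes Sobolev: "integral_on U (\<lambda>x. \<bar>u x\<bar> powr (m * qs)) epowr (1 / qs)
      \<le> ennreal C * (integral_on U (\<lambda>x. \<bar>u x\<bar> powr m) +
          ennreal m * integral_on U (\<lambda>x. (powr_one \<bar>u x\<bar> (m - 1) * norm (Du x)) powr q) epowr (1 / q))"
  shows "integral_on U (\<lambda>x. \<bar>u x\<bar> powr (\<alpha> + r) * \<omega> x)
    \<le> ennreal \<epsilon> * integral_on U (\<lambda>x. powr_one \<bar>u x\<bar> (\<alpha> - s) / (1 + \<bar>u x\<bar>) powr \<beta> * norm (Du x) powr p * W x)
      + (ennreal (D1 C p m \<theta>) * Phi1 U p s \<alpha> \<theta> \<mu> \<phi> \<omega>
         + ennreal (2 powr (1 + beta1_hat \<alpha> \<beta> \<theta>) * \<epsilon> powr (- (\<theta> / (1 - \<theta>))) * D2 C p m \<theta>)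
           * Phi2_tilde U r1 \<alpha> \<beta> \<theta> \<mu> \<phi> W \<omega>)
        * min (J epowr lo + J epowr hi) ((1 + J) epowr hi)"
proof -
  have rng: "1 \<le> m" "m < \<alpha>" "0 < \<theta>" "\<theta> < 1" "\<mu> > - \<alpha>" "\<alpha> > 0" "\<alpha> * (p - 1) + s - p > 0"
    "\<alpha> * (1 - r1) - r1 * \<beta> > 0" "0 < r_star n p r1" "r_star n p r1 < 1"
    using exponent_ranges[OF n p r1 r0 \<beta> \<alpha>s \<alpha>] by (simp_all add: m_def \<theta>_def \<mu>_def)
  have r1_pos: "0 < r1"
    using r1(1) n p by (intro order.strict_trans[OF _ r1(1)]) simp
  have mp: "m * p = \<alpha> - s + p" using p by (simp add: m_def m_exp_def)
  define \<kappa> where "\<kappa> = (1 - \<theta>) * (1 + \<mu> / \<alpha>)"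
  define \<gamma> where "\<gamma> = \<beta> * \<theta> / (1 - \<theta>)"
  have "1 + \<mu> / \<alpha> > 0" using rng(5,6) by (simp add: field_simps)
  then have \<kappa>: "\<kappa> > 0" using rng(4) by (simp add: \<kappa>_def)
  have \<gamma>: "\<gamma> > 0" using rng \<beta> by (simp add: \<gamma>_def)
  have qs: "qs > 0" using r1_pos p r1(3) n by (simp add: qs_def q_def)
  have pqs: "p / qs = 1 - r_star n p r1"
    using n p r1_pos r1(3) by (simp add: qs_def q_def r_star_def field_simps)
  have \<mu>_eq: "(1 - \<theta>) * \<mu> = r + \<theta> * (s - p)" using rng by (simp add: \<mu>_def mu1_def)
  have \<alpha>\<kappa>: "\<alpha> * \<kappa> = (1 - \<theta>) * \<alpha> + r + \<theta> * (s - p)"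
  proof -
    have "\<alpha> * \<kappa> = (1 - \<theta>) * \<alpha> + (1 - \<theta>) * \<mu>" using rng by (simp add: \<kappa>_def field_simps)
    then show ?thesis using \<mu>_eq by simp
  qed
  have \<theta>_eq: "\<theta> * (\<alpha> * (1 + r_star n p r1) + 2 * (p - s)) = \<alpha> + 2 * r"
    using rng(3) by (auto simp: \<theta>_def theta_def)
  \<comment> \<open>The number \<open>\<theta>\<close> is defined by the requirement that these exponents add up to 1.\<close>
  have exps: "p * \<theta> / qs + \<kappa> + \<kappa> = 1"
  proof -
    have "\<alpha> * (p * \<theta> / qs + \<kappa> + \<kappa>) = \<alpha> * \<theta> * (p / qs) + 2 * (\<alpha> * \<kappa>)" by (simp add: algebra_simps)
    also have "\<dots> = \<alpha>" unfolding pqs \<alpha>\<kappa> using \<theta>_eq by (simp add: algebra_simps)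
    finally show ?thesis using rng by simp
  qed
  have e_eq: "\<alpha> + r = (m * qs) * (p * \<theta> / qs) + \<alpha> * \<kappa>"
  proof -
    have "(m * qs) * (p * \<theta> / qs) = (m * p) * \<theta>" using qs by simp
    then show ?thesis unfolding \<alpha>\<kappa> mp by (simp add: algebra_simps)
  qed
  have pos: "\<And>x. x \<in> space (lebesgue_on U) \<Longrightarrow> \<phi> x > 0" "\<And>x. x \<in> space (lebesgue_on U) \<Longrightarrow> W x > 0"
    "\<And>x. x \<in> space (lebesgue_on U) \<Longrightarrow> \<omega> x \<ge> 0"
    using weights by (auto simp: space_restrict_space)
  define K where "K = integral_on U (\<lambda>x. powr_one \<bar>u x\<bar> (\<alpha> - s) / (1 + \<bar>u x\<bar>) powr \<beta> * norm (Du x) powr p * W x)"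
  define X where "X = integral_on U (\<lambda>x. \<bar>u x\<bar> powr (m * qs)) epowr (1 / qs)"
  define Y where "Y = integral_on U (\<lambda>x. \<bar>u x\<bar> powr m)"
  define A where "A = integral_on U (\<lambda>x. (powr_one \<bar>u x\<bar> (m - 1) * norm (Du x)) powr q) epowr (1 / q)"
  define S where "S = min (J epowr lo + J epowr hi) ((1 + J) epowr hi)"
  let ?I = "integral_on U (\<lambda>x. \<bar>u x\<bar> powr (\<alpha> + r) * \<omega> x)" and ?\<eta> = "\<epsilon> powr (- (\<theta> / (1 - \<theta>)))"
    and ?\<Phi>1 = "Phi1 U p s \<alpha> \<theta> \<mu> \<phi> \<omega>" and ?\<Phi>2 = "Phi2_tilde U r1 \<alpha> \<beta> \<theta> \<mu> \<phi> W \<omega>"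
  let ?c1 = "ennreal (D1 C p m \<theta>)"
    and ?c2 = "ennreal (2 powr (1 + beta1_hat \<alpha> \<beta> \<theta>) * ?\<eta> * D2 C p m \<theta>)"
  let ?G1 = "G1 U p s \<alpha> \<phi>" and ?G2 = "G2_tilde U r1 \<alpha> \<beta> \<phi> W" and ?G3 = "G3 U \<alpha> \<theta> \<mu> \<phi> \<omega>"
    and ?E = "E1 U \<phi>"
  let ?D = "(C * 2 powr m) powr (\<theta> * p)"
  have X_le: "X \<le> ennreal C * (Y + ennreal m * A)"
    unfolding X_def Y_def A_def by (rule Sobolev)
  have interp: "?I \<le> X epowr (p * \<theta>) * (J epowr \<kappa> * ?G3 epowr (1 - \<theta>))"
  proof -
    have "?I \<le>
      integral_on U (\<lambda>x. \<bar>u x\<bar> powr (m * qs)) epowr (p * \<theta> / qs) *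
        (J epowr \<kappa> * integral_on U (\<lambda>x. inverse (\<phi> x) * \<omega> x powr (1 / \<kappa>)) epowr \<kappa>)"
      unfolding integral_on_def J_def
      using pos \<kappa> exps e_eq p rng qs by (intro weighted_interpolation) auto
    moreover have "?G3 epowr (1 - \<theta>) = integral_on U (\<lambda>x. inverse (\<phi> x) * \<omega> x powr (1 / \<kappa>)) epowr \<kappa>"
      by (simp add: G3_def \<kappa>_def epowr_epowr mult.commute)
    moreover have "X epowr (p * \<theta>) = integral_on U (\<lambda>x. \<bar>u x\<bar> powr (m * qs)) epowr (p * \<theta> / qs)"
      by (simp add: X_def epowr_epowr)
    ultimately show ?thesis by simp
  qed
  have Y_le: "Y epowr p \<le> J epowr (p * m / \<alpha>) * ?G1"
  proof -
    let ?Q = "integral_on U (\<lambda>x. \<phi> x powr (- (m / (\<alpha> - m))))"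
    have "Y \<le> J epowr (m / \<alpha>) * ?Q epowr (1 - m / \<alpha>)"
      unfolding Y_def J_def integral_on_def using pos rng by (intro weighted_lower_power) auto
    then have "Y epowr p \<le> (J epowr (m / \<alpha>) * ?Q epowr (1 - m / \<alpha>)) epowr p"
      using p by (intro epowr_mono) auto
    also have "\<dots> = J epowr (p * m / \<alpha>) * ?Q epowr (p * (1 - m / \<alpha>))"
      using p by (simp add: epowr_mult epowr_epowr mult.commute)
    also have "p * (1 - m / \<alpha>) = (\<alpha> * (p - 1) + s - p) / \<alpha>"
    proof -
      have "p * (1 - m / \<alpha>) = (p * \<alpha> - m * p) / \<alpha>" using rng by (simp add: field_simps)
      then show ?thesis unfolding mp by (simp add: algebra_simps)
    qed
    also have "m / (\<alpha> - m) = (\<alpha> - s + p) / (\<alpha> * (p - 1) + s - p)"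
    proof -
      have "m / (\<alpha> - m) = (m * p) / (\<alpha> * p - m * p)" using p rng by (simp flip: left_diff_distrib)
      then show ?thesis unfolding mp by (simp add: algebra_simps)
    qed
    finally show ?thesis by (simp add: G1_def)
  qed
  have A_le: "A epowr p \<le> K * ((ennreal (2 powr \<beta>) * (?E epowr (\<beta> / \<alpha>) * (1 + J) epowr (\<beta> / \<alpha>))) * ?G2)"
  proof -
    have "A epowr p = integral_on U (\<lambda>x. (powr_one \<bar>u x\<bar> (m - 1) * norm (Du x)) powr (r1 * p)) epowr (1 / r1)"
      using p r1_pos by (simp add: A_def epowr_epowr q_def)
    also have "\<dots> \<le> K * (integral_on U (\<lambda>x. (1 + \<bar>u x\<bar>) powr \<alpha> * \<phi> x) epowr (\<beta> / \<alpha>) * ?G2)"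
      unfolding K_def integral_on_def G2_tilde_def m_def m_exp_def
      using pos p r1 r1_pos rng \<beta> \<alpha>s by (intro weighted_gradient_power) auto
    also have "\<dots> \<le> K * ((ennreal (2 powr \<alpha>) * (?E * (1 + J))) epowr (\<beta> / \<alpha>) * ?G2)"
      unfolding J_def E1_def integral_on_def using pos rng \<beta>
      by (intro mult_left_mono mult_right_mono epowr_mono shifted_power_integral_le) auto
    also have "(ennreal (2 powr \<alpha>) * (?E * (1 + J))) epowr (\<beta> / \<alpha>)
        = ennreal (2 powr \<beta>) * (?E epowr (\<beta> / \<alpha>) * (1 + J) epowr (\<beta> / \<alpha>))"
      using rng \<beta> by (simp add: epowr_mult powr_powr)
    finally show ?thesis .
  qed
  have lohi: "0 < lo" "lo \<le> 1 + r / \<alpha>" "1 + r / \<alpha> \<le> hi" "lo \<le> 1 + \<mu> / \<alpha>" "1 + \<mu> / \<alpha> + \<gamma> / \<alpha> \<le> hi"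
  proof -
    have "mu2_hat r \<mu> > - \<alpha>" using rng r0 by (simp add: mu2_hat_def)
    then show "0 < lo" using rng by (simp add: lo_def field_simps)
    show "lo \<le> 1 + r / \<alpha>" "lo \<le> 1 + \<mu> / \<alpha>"
      using rng by (simp_all add: lo_def mu2_hat_def divide_right_mono)
    show "1 + r / \<alpha> \<le> hi" using rng by (simp add: hi_def mu3_hat_def divide_right_mono)
    have "(\<mu> + \<gamma>) / \<alpha> \<le> mu3_hat r \<beta> \<theta> \<mu> / \<alpha>"
      using rng by (intro divide_right_mono) (auto simp: mu3_hat_def mu1_hat_def \<gamma>_def)
    then show "1 + \<mu> / \<alpha> + \<gamma> / \<alpha> \<le> hi" by (simp add: hi_def add_divide_distrib)
  qed
  let ?T1 = "ennreal ?D * Y epowr (p * \<theta>)" and ?T2 = "ennreal (?D * m powr (p * \<theta>)) * A epowr (p * \<theta>)"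
    and ?YA = "Y epowr (p * \<theta>) + (ennreal m * A) epowr (p * \<theta>)"
  have X_pow: "X epowr (p * \<theta>) \<le> ?T1 + ?T2"
  proof -
    have pt: "p * \<theta> > 0" using p rng by simp
    have "X epowr (p * \<theta>) \<le> (ennreal C * (Y + ennreal m * A)) epowr (p * \<theta>)"
      using X_le pt by (intro epowr_mono) auto
    also have "\<dots> = ennreal (C powr (p * \<theta>)) * (Y + ennreal m * A) epowr (p * \<theta>)"
      using pt C by (simp add: epowr_mult)
    also have "\<dots> \<le> ennreal (C powr (p * \<theta>)) * (ennreal (2 powr (p * \<theta>)) * ?YA)"
      using pt by (intro mult_left_mono epowr_sum_le) auto
    also have "\<dots> = ennreal (C powr (p * \<theta>) * 2 powr (p * \<theta>)) * ?YA"
      by (simp add: ennreal_mult mult.assoc)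
    also have "\<dots> \<le> ennreal ?D * ?YA"
    proof (intro mult_right_mono ennreal_leI)
      have "C powr (p * \<theta>) * 2 powr (p * \<theta>) = (C * 2 powr 1) powr (\<theta> * p)"
        using C by (simp add: powr_mult mult.commute)
      also have "\<dots> \<le> ?D"
        using C pt rng(1) by (intro powr_mono2 mult_left_mono powr_mono) (auto simp: mult.commute)
      finally show "C powr (p * \<theta>) * 2 powr (p * \<theta>) \<le> ?D" .
    qed auto
    also have "(ennreal m * A) epowr (p * \<theta>) = ennreal (m powr (p * \<theta>)) * A epowr (p * \<theta>)"
      using pt rng(1) by (simp add: epowr_mult)
    finally show ?thesis by (simp add: distrib_left ennreal_mult mult.assoc)
  qed
  let ?H = "J epowr \<kappa> * ?G3 epowr (1 - \<theta>)"
  have first: "?T1 * ?H \<le> ?c1 * ?\<Phi>1 * S"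
  proof -
    have "Y epowr (p * \<theta>) = (Y epowr p) epowr \<theta>" by (simp add: epowr_epowr)
    also have "\<dots> \<le> (J epowr (p * m / \<alpha>) * ?G1) epowr \<theta>"
      using Y_le rng by (intro epowr_mono) auto
    also have "\<dots> = J epowr (p * m / \<alpha> * \<theta>) * ?G1 epowr \<theta>"
      using rng by (simp add: epowr_mult epowr_epowr)
    finally have "?T1 * ?H \<le> ennreal ?D * (J epowr (p * m / \<alpha> * \<theta>) * ?G1 epowr \<theta>) * ?H"
      by (intro mult_right_mono mult_left_mono) auto
    also have "\<dots> = ennreal ?D * (?G1 epowr \<theta> * ?G3 epowr (1 - \<theta>)) * (J epowr (p * m / \<alpha> * \<theta>) * J epowr \<kappa>)"
      by (simp only: mult_ac)
    also have "J epowr (p * m / \<alpha> * \<theta>) * J epowr \<kappa> = J epowr (1 + r / \<alpha>)"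
    proof -
      have "\<alpha> * (p * m / \<alpha> * \<theta> + \<kappa>) = (m * p) * \<theta> + \<alpha> * \<kappa>" using rng by (simp add: field_simps)
      also have "\<dots> = \<alpha> * (1 + r / \<alpha>)" unfolding mp \<alpha>\<kappa> using rng by (simp add: field_simps)
      finally have "p * m / \<alpha> * \<theta> + \<kappa> = 1 + r / \<alpha>" using rng by simp
      then show ?thesis by (simp only: epowr_add)
    qed
    also have "J epowr (1 + r / \<alpha>) \<le> S"
      unfolding S_def using lohi by (intro power_le_min) auto
    finally show ?thesis by (simp add: D1_def Phi1_def mult_left_mono)
  qed
  \<comment> \<open>\<open>Z\<close> is what must stand next to the gradient integral for Young's inequality with the exponents \<open>\<theta>\<close> and \<open>1 - \<theta>\<close>.\<close>
  define Z where "Z = ennreal (D2 C p m \<theta>) * ennreal (2 powr \<gamma>) * ?\<Phi>2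
      * ((1 + J) epowr (\<gamma> / \<alpha>) * J epowr (1 + \<mu> / \<alpha>))"
  have second: "?T2 * ?H \<le> K epowr \<theta> * Z epowr (1 - \<theta>)"
  proof -
    have t1: "1 - \<theta> > 0" using rng by simp
    have "A epowr (p * \<theta>) = (A epowr p) epowr \<theta>" by (simp add: epowr_epowr)
    also have "\<dots> \<le> (K * ((ennreal (2 powr \<beta>) * (?E epowr (\<beta> / \<alpha>) * (1 + J) epowr (\<beta> / \<alpha>))) * ?G2)) epowr \<theta>"
      using A_le rng by (intro epowr_mono) auto
    also have "\<dots> = K epowr \<theta> * (ennreal (2 powr (\<beta> * \<theta>)) * (?E epowr (\<beta> / \<alpha> * \<theta>) * (1 + J) epowr (\<beta> / \<alpha> * \<theta>)) * ?G2 epowr \<theta>)"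
      using rng by (simp add: epowr_mult epowr_epowr powr_powr)
    finally have "?T2 * ?H
      \<le> ennreal (?D * m powr (p * \<theta>)) * (K epowr \<theta> * (ennreal (2 powr (\<beta> * \<theta>)) * (?E epowr (\<beta> / \<alpha> * \<theta>) * (1 + J) epowr (\<beta> / \<alpha> * \<theta>)) * ?G2 epowr \<theta>)) * ?H"
      by (intro mult_right_mono mult_left_mono) auto
    also have "\<dots> = K epowr \<theta> * (ennreal (?D * m powr (p * \<theta>)) * ennreal (2 powr (\<beta> * \<theta>)) *
        (?G2 epowr \<theta> * ?G3 epowr (1 - \<theta>) * ?E epowr (\<beta> / \<alpha> * \<theta>)) * ((1 + J) epowr (\<beta> / \<alpha> * \<theta>) * J epowr \<kappa>))"
      by (simp only: mult_ac)
    also have "\<dots> = K epowr \<theta> * Z epowr (1 - \<theta>)"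
    proof -
      have "?D * m powr (p * \<theta>) = (D2 C p m \<theta>) powr (1 - \<theta>)"
        using t1 C rng(1) by (simp add: D2_def powr_powr powr_mult mult_ac)
      moreover have "2 powr (\<beta> * \<theta>) = (2 powr \<gamma>) powr (1 - \<theta>)"
        using t1 by (simp add: powr_powr \<gamma>_def)
      moreover have "(1 + J) epowr (\<beta> / \<alpha> * \<theta>) = ((1 + J) epowr (\<gamma> / \<alpha>)) epowr (1 - \<theta>)"
        using t1 by (simp add: epowr_epowr \<gamma>_def)
      moreover have "J epowr \<kappa> = (J epowr (1 + \<mu> / \<alpha>)) epowr (1 - \<theta>)"
        by (simp add: epowr_epowr \<kappa>_def mult.commute)
      moreover have "?G2 epowr \<theta> = (?G2 epowr (\<theta> / (1 - \<theta>))) epowr (1 - \<theta>)"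
        using t1 by (simp add: epowr_epowr)
      moreover have "?E epowr (\<beta> / \<alpha> * \<theta>) = (?E epowr (\<beta> * \<theta> / (\<alpha> * (1 - \<theta>)))) epowr (1 - \<theta>)"
        using t1 by (simp add: epowr_epowr)
      ultimately show ?thesis
        using t1 by (simp add: Z_def Phi2_tilde_def epowr_mult D2_def)
    qed
    finally show ?thesis .
  qed
  have Z_le: "ennreal (?\<eta>) * Z \<le>
    ?c2 * ?\<Phi>2 * S"
  proof -
    have "(1 + J) epowr (\<gamma> / \<alpha>) * J epowr (1 + \<mu> / \<alpha>) \<le> ennreal (2 powr (1 + \<gamma> / \<alpha>)) * S"
      unfolding S_def using lohi \<gamma> rng by (intro power_product_le_min) auto
    then have "ennreal (?\<eta>) * Z \<le> ennreal (?\<eta>) *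
      (ennreal (D2 C p m \<theta>) * ennreal (2 powr \<gamma>) * ?\<Phi>2 * (ennreal (2 powr (1 + \<gamma> / \<alpha>)) * S))"
      unfolding Z_def by (intro mult_left_mono) auto
    also have "\<dots> = (ennreal (2 powr \<gamma>) * ennreal (2 powr (1 + \<gamma> / \<alpha>)) * ennreal (?\<eta>) * ennreal (D2 C p m \<theta>))
       * ?\<Phi>2 * S"
      by (simp only: mult_ac)
    also have "ennreal (2 powr \<gamma>) * ennreal (2 powr (1 + \<gamma> / \<alpha>)) = ennreal (2 powr (1 + beta1_hat \<alpha> \<beta> \<theta>))"
    proof -
      have "\<gamma> + (1 + \<gamma> / \<alpha>) = 1 + beta1_hat \<alpha> \<beta> \<theta>"
        by (simp add: beta1_hat_def \<gamma>_def distrib_left)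
      then have "2 powr \<gamma> * 2 powr (1 + \<gamma> / \<alpha>) = (2::real) powr (1 + beta1_hat \<alpha> \<beta> \<theta>)"
        by (simp only: powr_add[symmetric])
      then show ?thesis by (simp flip: ennreal_mult)
    qed
    also have "ennreal (2 powr (1 + beta1_hat \<alpha> \<beta> \<theta>)) * ennreal (?\<eta>) * ennreal (D2 C p m \<theta>)
      = ?c2"
      by (simp add: ennreal_mult D2_def)
    finally show ?thesis .
  qed
  have "?I
    \<le> (?T1 + ?T2) * ?H"
    using interp mult_right_mono[OF X_pow, of ?H] by (auto intro: order.trans)
  also have "\<dots> \<le> ?c1 * ?\<Phi>1 * S + K epowr \<theta> * Z epowr (1 - \<theta>)"
    unfolding distrib_right by (intro add_mono first second)
  also have "\<dots> \<le> ?c1 * ?\<Phi>1 * S +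
      (ennreal \<epsilon> * K + ennreal (?\<eta>) * Z)"
    using rng \<epsilon> by (intro add_left_mono Young_epowr_epsilon) auto
  also have "\<dots> \<le> ?c1 * ?\<Phi>1 * S +
      (ennreal \<epsilon> * K + ?c2 * ?\<Phi>2 * S)"
    by (intro add_left_mono Z_le)
  also have "\<dots> = ennreal \<epsilon> * K + (?c1 * ?\<Phi>1
            + ?c2 * ?\<Phi>2) * S"
    by (simp only: distrib_right add_ac)
  finally show ?thesis
    by (simp only: S_def K_def)
qed

theorem lemma3p2:
  fixes U :: "(real ^ 'n) set" and n p r1 :: real
  assumes n_def: "n = real CARD('n)" and "CARD('n) \<ge> 2"
    and "U \<noteq> {}" "open U" "bounded U" "C1_boundary U"
    and "p > 1" "r1 > 0" "n / (n + p) < r1" "r1 < 1" "1 \<le> r1 * p" "r1 * p < n"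
  shows "\<exists>c3>0. \<exists>c4>0.
    \<forall>(r::real) (s::real) (\<beta>::real) (\<alpha>::real)
      (\<phi>::real^'n \<Rightarrow> real) (W::real^'n \<Rightarrow> real) (\<omega>::real^'n \<Rightarrow> real).
      r \<ge> 0 \<and> \<beta> > 0 \<and>
      \<alpha> \<ge> s \<and> \<alpha> > (p - s) / (p - 1) \<and> \<alpha> > 2 * (r + s - p) / r_star n p r1 \<and>
      \<alpha> > r1 * \<beta> / (1 - r1) \<and>
      \<phi> \<in> borel_measurable (lebesgue_on U) \<and> W \<in> borel_measurable (lebesgue_on U) \<and>
      \<omega> \<in> borel_measurable (lebesgue_on U) \<and>
      (\<forall>x\<in>U. \<phi> x > 0 \<and> W x > 0 \<and> \<omega> x \<ge> 0) \<longrightarrow>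
      (let m = m_exp p s \<alpha>;
           \<theta> = theta n p r1 r s \<alpha>;
           \<mu> = mu1 p r s \<theta>;
           \<mu>2 = mu2_hat r \<mu>;
           \<mu>3 = mu3_hat r \<beta> \<theta> \<mu>
       in \<forall>u Du \<epsilon>. in_W1_with_gradient U (r1 * p * m) u Du \<and> \<epsilon> > 0 \<longrightarrow>
         (let \<Phi>_hat = ennreal (D1 c4 p m \<theta>) * Phi1 U p s \<alpha> \<theta> \<mu> \<phi> \<omega>
                + ennreal (2 powr (1 + beta1_hat \<alpha> \<beta> \<theta>) * \<epsilon> powr (- (\<theta> / (1 - \<theta>))) * D2 c3 p m \<theta>)
                  * Phi2_tilde U r1 \<alpha> \<beta> \<theta> \<mu> \<phi> W \<omega>;
              J = integral_on U (\<lambda>x. \<bar>u x\<bar> powr \<alpha> * \<phi> x)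
          in integral_on U (\<lambda>x. \<bar>u x\<bar> powr (\<alpha> + r) * \<omega> x)
             \<le> ennreal \<epsilon> * integral_on U (\<lambda>x. powr_one \<bar>u x\<bar> (\<alpha> - s) / (1 + \<bar>u x\<bar>) powr \<beta>
                                              * norm (Du x) powr p * W x)
               + \<Phi>_hat * min (J epowr (1 + \<mu>2 / \<alpha>) + J epowr (1 + \<mu>3 / \<alpha>))
                             ((1 + J) epowr (1 + \<mu>3 / \<alpha>))))"
proof -
  define q where "q = r1 * p"
  have q: "1 \<le> q" "q < n" using assms(11,12) by (simp_all add: q_def)
  have "n > 0" using assms(2) n_def by simp
  obtain C where C: "C > 0" and Sobolev: "\<forall>m u Du. m \<ge> 1 \<longrightarrow> in_W1_with_gradient U (q * m) u Du \<longrightarrow>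
    integral_on U (\<lambda>x. \<bar>u x\<bar> powr (m * (n * q / (n - q)))) epowr (1 / (n * q / (n - q)))
    \<le> ennreal C * (integral_on U (\<lambda>x. \<bar>u x\<bar> powr m) +
        ennreal m * integral_on U (\<lambda>x. (powr_one \<bar>u x\<bar> (m - 1) * norm (Du x)) powr q) epowr (1 / q))"
    using Sobolev_power_inequality[OF assms(4-6), of q] assms(2) q
    unfolding n_def by auto
  show ?thesis
    unfolding Let_def
  proof (rule exI[of _ C], rule conjI[OF C], rule exI[of _ C], rule conjI[OF C], intro allI impI, elim conjE,
      goal_cases)
    case (1 r s \<beta> \<alpha> \<phi> W \<omega> u Du \<epsilon>)
    have exponents: "r \<ge> 0" "\<beta> > 0" "\<alpha> \<ge> s" "\<alpha> > (p - s) / (p - 1)" "\<alpha> > 2 * (r + s - p) / r_star n p r1"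
        "\<alpha> > r1 * \<beta> / (1 - r1)"
      and weights: "\<phi> \<in> borel_measurable (lebesgue_on U)" "W \<in> borel_measurable (lebesgue_on U)"
        "\<omega> \<in> borel_measurable (lebesgue_on U)" "\<forall>x\<in>U. \<phi> x > 0 \<and> W x > 0 \<and> \<omega> x \<ge> 0"
      and W1: "in_W1_with_gradient U (r1 * p * m_exp p s \<alpha>) u Du" and \<epsilon>: "\<epsilon> > 0"
      using 1 by simp_all
    have u: "u \<in> borel_measurable (lebesgue_on U)" "Du \<in> borel_measurable (lebesgue_on U)"
      using W1 by (auto simp: in_W1_with_gradient_def in_Lq_def)
    have m: "1 \<le> m_exp p s \<alpha>"
      using exponent_ranges(3)[OF \<open>n > 0\<close> assms(7,9,10,12) exponents] .
    from interpolation_from_Sobolev[OF \<open>n > 0\<close> assms(7,9,10,12) exponents weights u \<epsilon> C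
        Sobolev[unfolded q_def, rule_format, OF m W1]]
    show ?case .
  qed
qed

end
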